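(* Let $r\ge1$, let $n_1,\dots,n_r$ be non-negative integers, and let $a,x_1,\dots,x_r$ be generic nonzero complex parameters. Then $$\sum_{\substack{0\le k_i\le n_i\\ i=1,\dots,r}}\frac{\Delta(\mathbf xq^{4\mathbf k};p)}{\Delta(\mathbf x;p)}q^{|\mathbf k|-3e_2(\mathbf k)}\frac{(-1,-q,-q^2;q^2,p)_{|\mathbf k|}}{\prod_{1\le i<j\le r}(-a^2x_ix_jq;q^4,p)_{k_i+k_j}}$$ $$\times\prod_{i=1}^r\left(\frac{\theta(ax_iq^{|\mathbf k|+4k_i};p)}{\theta(ax_i;p)}\frac{(ax_i;q,p)_{|\mathbf k|}\,(-1/ax_i;q,p)_{|\mathbf k|-k_i}}{(ax_iq^{4n_i+1},-q^{-4n_i}/ax_i;q,p)_{|\mathbf k|}\,(-q^{k_i-|\mathbf k|+1}ax_i;q,p)_{3k_i}}\right)$$ $$\times\prod_{i,j=1}^r\frac{(q^{-4n_j}x_i/x_j,-a^2x_ix_jq^{4n_j+1};q^4,p)_{k_i}}{(q^4x_i/x_j;q^4,p)_{k_i}}=\prod_{i=1}^r\frac{(ax_iq;q,p)_{4n_i}}{(-ax_iq;q,p)_{4n_i}}.$$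
   Context: $p,q$ are complex numbers with $|p|<1$, $q\ne0$, and $q^k\notin p^{\mathbb Z}$ for all integers $k>0$ (if $p=0$: $q^k\ne1$). For $x\ne0$, $\theta(x;p)=\prod_{j=0}^\infty(1-p^jx)(1-p^{j+1}/x)$. Elliptic shifted factorials: $(a;q,p)_k=\prod_{j=0}^{k-1}\theta(aq^j;p)$ for $k\in\mathbb Z_{\ge0}$ (similarly with bases $q^2$, $q^4$), and $(a_1,\dots,a_m;q,p)_k=(a_1;q,p)_k\cdots(a_m;q,p)_k$. For $\mathbf k=(k_1,\dots,k_r)$, $|\mathbf k|=k_1+\cdots+k_r$ and $e_2(\mathbf k)=\sum_{1\le i<j\le r}k_ik_j$. For $\mathbf x=(x_1,\dots,x_r)$, $\Delta(\mathbf x;p)=\prod_{1\le i<j\le r}x_j\theta(x_i/x_j;p)$, and $\mathbf xq^{4\mathbf k}=(x_1q^{4k_1},\dots,x_rq^{4k_r})$. In expressions such as $-1/ax_i$, everything after the slash is in the denominator. All parameters are assumed generic so that no denominator vanishes. *)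

theory Defs
  imports "HOL-Analysis.Analysis" "HOL-Library.FuncSet"
begin

definition theta :: "complex \<Rightarrow> complex \<Rightarrow> complex" where
  "theta x p = (\<Prod>j. (1 - p ^ j * x) * (1 - p ^ (j + 1) / x))"

definition ell_fact :: "complex \<Rightarrow> complex \<Rightarrow> complex \<Rightarrow> nat \<Rightarrow> complex" where
  "ell_fact a q p k = (\<Prod>j<k. theta (a * q ^ j) p)"

text \<open>\<open>ell_facts [a\<^sub>1, \<dots>, a\<^sub>m] q p k\<close> is \<open>(a\<^sub>1, \<dots>, a\<^sub>m; q, p)\<^sub>k\<close>.\<close>

definition ell_facts :: "complex list \<Rightarrow> complex \<Rightarrow> complex \<Rightarrow> nat \<Rightarrow> complex" where
  "ell_facts as q p k = (\<Prod>a\<leftarrow>as. ell_fact a q p k)"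

text \<open>An \<open>r\<close>-tuple is a function on \<open>nat\<close> of which only the values at \<open>1, \<dots>, r\<close> matter.\<close>

definition index_pairs :: "nat \<Rightarrow> (nat \<times> nat) set" where
  "index_pairs r = {(i, j). 1 \<le> i \<and> i < j \<and> j \<le> r}"

definition tuple_sum :: "nat \<Rightarrow> (nat \<Rightarrow> nat) \<Rightarrow> nat" where
  "tuple_sum r k = (\<Sum>i = 1..r. k i)"

definition e2 :: "nat \<Rightarrow> (nat \<Rightarrow> nat) \<Rightarrow> nat" where
  "e2 r k = (\<Sum>(i, j)\<in>index_pairs r. k i * k j)"

definition Delta :: "nat \<Rightarrow> (nat \<Rightarrow> complex) \<Rightarrow> complex \<Rightarrow> complex" where
  "Delta r x p = (\<Prod>(i, j)\<in>index_pairs r. x j * theta (x i / x j) p)"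

text \<open>The summation range. Restricting to extensional functions counts every tuple
  exactly once.\<close>

definition multi_range :: "nat \<Rightarrow> (nat \<Rightarrow> nat) \<Rightarrow> (nat \<Rightarrow> nat) set" where
  "multi_range r n = (\<Pi>\<^sub>E i\<in>{1..r}. {0..n i})"

end

theory Submission
  imports Defs "HOL-Complex_Analysis.Complex_Analysis"
begin

text \<open>
  The proof is a multivariable telescoping argument. Let \<open>\<xi>\<^sub>i = log (a x\<^sub>i)\<close>, \<open>q = exp \<eta>\<close> and
  \<open>v\<^sub>i = \<xi>\<^sub>i + 4 k\<^sub>i \<eta>\<close>, and fix an index \<open>c\<close> with \<open>n\<^sub>c > 0\<close>. The summand, as a function of the upper ends
  \<open>\<xi>\<^sub>i + 4 n\<^sub>i \<eta>\<close>, is expanded by Lagrange interpolation with nodes \<open>v\<^sub>1, \<dots>, v\<^sub>r\<close> and one further node;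
  its coefficients satisfy a recursion that is an elliptic partial fraction identity. Together these show
  that the sum and a multiple of the sum with \<open>\<xi>\<^sub>c\<close> shifted by \<open>4 \<eta>\<close> and \<open>n\<^sub>c\<close> lowered by one differ by
  telescoping terms that vanish on the boundary of the box, and the result follows by induction on
  \<open>n\<^sub>1 + \<dots> + n\<^sub>r\<close>. Both interpolation identities are consequences of Weierstrass's three-term relation,
  which comes from Liouville's theorem. Non-generic parameters are reached by continuity.
\<close>

section \<open>Brackets\<close>

text \<open>The upper limits enter the summand only through the kernel
  \<open>D u v = br (u - v) * br (u + v + (\<eta> + \<omega>))\<close>: the numerators of the double
  product are values of \<open>D\<close> at a node and an upper end, and the denominators (a x
  q^(4n+1), -q^(-4n)/(a x); q)_|k| are values of \<open>D\<close> at an upper end and at -(m+1)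
  \<eta>. With one argument varying, such kernels fill a space of dimension two only, so Lagrange
  interpolation applies; the denominators dictate -|k| \<eta> as the further node. Interpolation
  removes the upper limits from the problem: the recursion left for the coefficients no longer
  contains n. Raising \<xi> c by 4 \<eta> while lowering n c by one fixes every upper end, so the
  two sums are compared at the same interpolation data. The factor between them is then forced to be
  the quotient of the two product sides.\<close>

lemma card_ge_2_obtain:
  assumes "2 \<le> card I"
  obtains i j where "i \<in> I" "j \<in> I" "i \<noteq> j"
proof -
  obtain B where B: "B \<subseteq> I" "card B = 2"
    using obtain_subset_with_card_n[OF assms] by metis
  from B(2) obtain i j where "B = {i, j}" "i \<noteq> j" by (meson card_2_iff)
  then show thesis using B(1) that by blast
qed

lemma card_ge_3_obtain:
  assumes "3 \<le> card I"
  obtains i j k where "i \<in> I" "j \<in> I" "k \<in> I" "i \<noteq> j" "i \<noteq> k" "j \<noteq> k"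
proof -
  obtain B where B: "B \<subseteq> I" "card B = 3"
    using obtain_subset_with_card_n[OF assms] by metis
  from B(2) obtain i j k where "B = {i, j, k}" "i \<noteq> j" "j \<noteq> k" "i \<noteq> k"
    by (meson card_3_iff)
  then show thesis using B(1) that by blast
qed

section \<open>Two interpolation identities from the three-term relation\<close>

locale odd_bracket =
  fixes br :: "complex \<Rightarrow> complex"
  assumes br_minus: "br (- z) = - br z"
    and three_term: "br (x + y) * br (x - y) * br (u + v) * br (u - v)
        - br (x + v) * br (x - v) * br (u + y) * br (u - y)
        = br (y + v) * br (y - v) * br (x + u) * br (x - u)"
    and br_zero_diff: "br x = 0 \<Longrightarrow> br y = 0 \<Longrightarrow> br (x - y) = 0"
begin

lemma br_0 [simp]: "br 0 = 0"
  using br_minus[of 0] by simp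

lemma br_swap: "br (x - y) = - br (y - x)"
  using br_minus[of "y - x"] by simp

text \<open>For fixed \<open>s\<close> the three-term relation says that this antisymmetric function has rank two.\<close>

definition weier :: "complex \<Rightarrow> complex \<Rightarrow> complex \<Rightarrow> complex" where
  "weier s u v = br (u - v) * br (u + v + s)"

lemma weier_swap: "weier s u v = - weier s v u"
  unfolding weier_def by (subst br_swap) (simp add: add.commute)

lemma weier_self [simp]: "weier s u u = 0"
  by (simp add: weier_def)

lemma weier_pluecker: "weier s x y * weier s u v = weier s x u * weier s y v - weier s x v * weier s y u"
proof -
  have *: "weier s a b = br ((a + s/2) + (b + s/2)) * br ((a + s/2) - (b + s/2))" for a b
    by (simp add: weier_def algebra_simps)
  show ?thesis
    using three_term[of "x + s/2" "y + s/2" "u + s/2" "v + s/2"] br_swap[of "y + s/2" "u + s/2"]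
    unfolding * by (simp add: algebra_simps)
qed

text \<open>As a function of one \<open>X a\<close>, the sum lies in a two-dimensional space by the Pluecker relation,
  and at \<open>X a = u l\<close> it degenerates to the same identity with one point less.\<close>

theorem weier_interpolation:
  assumes "finite A" "finite I" "card I = card A + 2"
    and "\<And>i j. i \<in> I \<Longrightarrow> j \<in> I \<Longrightarrow> i \<noteq> j \<Longrightarrow> weier s (u i) (u j) \<noteq> 0"
  shows "(\<Sum>i\<in>I. (\<Prod>a\<in>A. weier s (X a) (u i)) / (\<Prod>j\<in>I - {i}. weier s (u i) (u j))) = 0"
  using assms
proof (induction A arbitrary: I rule: finite_induct)
  case empty
  then have "card I = 2" by simp
  then obtain i j where I: "I = {i, j}" "i \<noteq> j"
    by (meson card_2_iff)
  have "{i, j} - {i} = {j}" "{i, j} - {j} = {i}" using I by auto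
  then show ?case
    using I weier_swap[of s "u i" "u j"] by simp
next
  case (insert a A)
  define c where "c i = (\<Prod>a\<in>A. weier s (X a) (u i)) / (\<Prod>j\<in>I - {i}. weier s (u i) (u j))" for i
  define f where "f x = (\<Sum>i\<in>I. c i * weier s x (u i))" for x
  have cI: "card I = Suc (Suc (Suc (card A)))"
    using insert by simp
  have f0: "f (u l) = 0" if l: "l \<in> I" for l
  proof -
    have "f (u l) = (\<Sum>i\<in>I - {l}. c i * weier s (u l) (u i))"
      unfolding f_def by (subst sum.remove[OF \<open>finite I\<close> l]) simp
    also have "\<dots> = (\<Sum>i\<in>I - {l}. - ((\<Prod>a\<in>A. weier s (X a) (u i))
        / (\<Prod>j\<in>(I - {l}) - {i}. weier s (u i) (u j))))"
    proof (rule sum.cong[OF refl])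
      fix i assume i: "i \<in> I - {l}"
      have "(\<Prod>j\<in>I - {i}. weier s (u i) (u j)) = weier s (u i) (u l) * (\<Prod>j\<in>I - {i} - {l}. weier s (u i) (u j))"
        using i l \<open>finite I\<close> by (intro prod.remove) auto
      moreover have "I - {i} - {l} = (I - {l}) - {i}" by auto
      moreover have "weier s (u i) (u l) \<noteq> 0" using insert.prems(3) i l by auto
      ultimately show "c i * weier s (u l) (u i) = - ((\<Prod>a\<in>A. weier s (X a) (u i))
        / (\<Prod>j\<in>(I - {l}) - {i}. weier s (u i) (u j)))"
        unfolding c_def using weier_swap[of s "u l" "u i"] by simp
    qed
    also have "\<dots> = 0"
      using insert.IH[of "I - {l}"] insert.prems l \<open>finite I\<close> cI
      by (simp add: sum_negf)
    finally show ?thesis .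
  qed
  have "2 \<le> card I" using cI by simp
  then obtain l m where lm: "l \<in> I" "m \<in> I" "l \<noteq> m"
    by (rule card_ge_2_obtain)
  \<comment> \<open>Multiplying by the nonzero \<open>weier s (u l) (u m)\<close> lets the Pluecker
    relation express \<open>f\<close> at any point through its values at \<open>u l\<close> and
    \<open>u m\<close>, both of which are zero.\<close>
  have "f (X a) * weier s (u l) (u m) = (\<Sum>i\<in>I. c i * (weier s (X a) (u i) * weier s (u l) (u m)))"
    unfolding f_def by (simp add: sum_distrib_right mult.assoc)
  also have "\<dots> = (\<Sum>i\<in>I. c i * (weier s (X a) (u m) * weier s (u l) (u i) - weier s (X a) (u l) * weier s (u m) (u i)))"
  proof (rule sum.cong[OF refl])
    fix i
    show "c i * (weier s (X a) (u i) * weier s (u l) (u m))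
      = c i * (weier s (X a) (u m) * weier s (u l) (u i) - weier s (X a) (u l) * weier s (u m) (u i))"
      using weier_pluecker[of s "X a" "u i" "u l" "u m"] weier_swap[of s "u i" "u m"] weier_swap[of s "u i" "u l"]
      by simp
  qed
  also have "\<dots> = weier s (X a) (u m) * f (u l) - weier s (X a) (u l) * f (u m)"
    unfolding f_def by (simp add: algebra_simps sum_subtractf sum_distrib_left)
  finally have "f (X a) = 0"
    using f0 lm insert.prems(3) by simp
  then show ?case
    unfolding f_def c_def using insert.hyps by (simp add: mult.commute)
qed

text \<open>If \<open>br (u i + u j + s)\<close> and \<open>br (u i + u k + s)\<close> both
  vanished, so would \<open>br (u j - u k)\<close>. This supplies the nondegenerate pair for the
  rank-two argument when nothing is known about \<open>s\<close>.\<close>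

lemma weier_nonzero_ex:
  assumes "finite I" "card I \<ge> 3"
    and nz: "\<And>i j. i \<in> I \<Longrightarrow> j \<in> I \<Longrightarrow> i \<noteq> j \<Longrightarrow> br (u i - u j) \<noteq> 0"
  shows "\<exists>l\<in>I. \<exists>m\<in>I. weier s (u l) (u m) \<noteq> 0"
proof -
  obtain i j k where ijk: "i \<in> I" "j \<in> I" "k \<in> I" "i \<noteq> j" "i \<noteq> k" "j \<noteq> k"
    using card_ge_3_obtain[OF assms(2)] by blast
  have "br (u i + u j + s) \<noteq> 0 \<or> br (u i + u k + s) \<noteq> 0"
    using br_zero_diff[of "u i + u j + s" "u i + u k + s"] nz[of j k] ijk by auto
  then show ?thesis
    using ijk nz[of i j] nz[of i k] unfolding weier_def by (metis mult_eq_0_iff)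
qed

text \<open>An algebraic form of the residue theorem; the condition on the sums is what makes the
  underlying quotient elliptic. In the induction the sum \<open>S\<close> of two parameters is kept
  fixed, so that their factors combine to \<open>weier (- S) (u i) x\<close> with \<open>x\<close>
  one of the two. At \<open>x = u l\<close> a denominator cancels, and the identity with one node
  less remains, balanced by the parameter \<open>S - u l\<close>.\<close>

theorem bracket_partial_fractions:
  assumes "finite I" "finite J" "card I = card J" "I \<noteq> {}"
    and "(\<Sum>i\<in>I. u i) = (\<Sum>j\<in>J. a j)"
    and "\<And>i j. i \<in> I \<Longrightarrow> j \<in> I \<Longrightarrow> i \<noteq> j \<Longrightarrow> br (u i - u j) \<noteq> 0"
  shows "(\<Sum>i\<in>I. (\<Prod>j\<in>J. br (u i - a j)) / (\<Prod>j\<in>I - {i}. br (u i - u j))) = 0"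
  using assms
proof (induction "card I" arbitrary: I J a rule: less_induct)
  case less
  note nz = less.prems(6)
  have "card I > 0" using less.prems(1,4) by (simp add: card_gt_0_iff)
  then consider "card I = 1" | "card I = 2" | "card I \<ge> 3" by linarith
  then show ?case
  proof cases
    case 1
    then obtain i where I: "I = {i}" by (auto simp: card_1_singleton_iff)
    from 1 less.prems(3) obtain j where J: "J = {j}" by (auto simp: card_1_singleton_iff)
    show ?thesis using less.prems(5) by (simp add: I J)
  next
    case 2
    then obtain i i' where I: "I = {i, i'}" "i \<noteq> i'" by (meson card_2_iff)
    from 2 less.prems(3) obtain j j' where J: "J = {j, j'}" "j \<noteq> j'" by (metis card_2_iff)
    have s: "u i + u i' = a j + a j'" using less.prems(5) I J by simp
    \<comment> \<open>Balancing exchanges the two parameters up to sign, so the two terms cancel.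
      The general step does not reach this case because \<open>weier_nonzero_ex\<close> works with
      three nodes.\<close>
    have "u i' - a j = - (u i - a j')" "u i' - a j' = - (u i - a j)"
      using s by (simp_all add: algebra_simps)
    then have "br (u i' - a j) = - br (u i - a j')" "br (u i' - a j') = - br (u i - a j)"
      by (simp_all only: br_minus)
    moreover have "{i, i'} - {i} = {i'}" "{i, i'} - {i'} = {i}" using I by auto
    ultimately show ?thesis using I J br_swap[of "u i'" "u i"] by simp
  next
    case 3
    then have "2 \<le> card J" using less.prems(3) by simp
    then obtain j1 j2 where j12: "j1 \<in> J" "j2 \<in> J" "j1 \<noteq> j2"
      by (rule card_ge_2_obtain)
    define J' where "J' = J - {j1} - {j2}"
    have J: "J = insert j1 (insert j2 J')" "j1 \<notin> insert j2 J'" "j2 \<notin> J'" "finite J'"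
      using j12 less.prems(2) by (auto simp: J'_def)
    define S where "S = a j1 + a j2"
    define c where "c i = (\<Prod>j\<in>J'. br (u i - a j)) / (\<Prod>j\<in>I - {i}. br (u i - u j))" for i
    define f where "f x = (\<Sum>i\<in>I. c i * weier (- S) (u i) x)" for x
    have f0: "f (u l) = 0" if l: "l \<in> I" for l
    proof -
      define a' where "a' = a(j2 := S - u l)"
      have "f (u l) = (\<Sum>i\<in>I - {l}. c i * weier (-S) (u i) (u l))"
        unfolding f_def by (subst sum.remove[OF less.prems(1) l]) simp
      also have "\<dots> = (\<Sum>i\<in>I - {l}. ((\<Prod>j\<in>insert j2 J'. br (u i - a' j))
          / (\<Prod>j\<in>(I - {l}) - {i}. br (u i - u j))))"
      proof (rule sum.cong[OF refl])
        fix i assume i: "i \<in> I - {l}"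
        have "(\<Prod>j\<in>I - {i}. br (u i - u j)) = br (u i - u l) * (\<Prod>j\<in>I - {i} - {l}. br (u i - u j))"
          using i l less.prems(1) by (intro prod.remove) auto
        moreover have "I - {i} - {l} = (I - {l}) - {i}" by auto
        moreover have "br (u i - u l) \<noteq> 0" using nz i l by auto
        moreover have "(\<Prod>j\<in>J'. br (u i - a' j)) = (\<Prod>j\<in>J'. br (u i - a j))"
          using J by (intro prod.cong) (auto simp: a'_def)
        moreover have "br (u i - a' j2) = br (u i + u l - S)"
          by (simp add: a'_def algebra_simps)
        ultimately show "c i * weier (-S) (u i) (u l) = (\<Prod>j\<in>insert j2 J'. br (u i - a' j))
          / (\<Prod>j\<in>(I - {l}) - {i}. br (u i - u j))"
          unfolding c_def weier_def using J by simp
      qed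
      also have "\<dots> = 0"
      proof (rule less.hyps)
        have cl: "card I = Suc (card (I - {l}))" by (rule card.remove[OF less.prems(1) l])
        then show "card (I - {l}) < card I" by simp
        show "finite (I - {l})" "finite (insert j2 J')" using less.prems J by auto
        have "card J = Suc (card (insert j2 J'))" using J by simp
        then show "card (I - {l}) = card (insert j2 J')"
          using less.prems(3) cl by simp
        have "card (I - {l}) \<noteq> 0" using 3 cl by linarith
        then show "I - {l} \<noteq> {}" by (metis card.empty)
        have "(\<Sum>i\<in>I. u i) = u l + (\<Sum>i\<in>I - {l}. u i)" by (rule sum.remove[OF less.prems(1) l])
        moreover have "(\<Sum>j\<in>J'. a' j) = (\<Sum>j\<in>J'. a j)"
          using J by (intro sum.cong) (auto simp: a'_def)
        moreover have "(\<Sum>j\<in>J. a j) = S + (\<Sum>j\<in>J'. a j)" using J by (simp add: S_def)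
        ultimately show "(\<Sum>i\<in>I - {l}. u i) = (\<Sum>j\<in>insert j2 J'. a' j)"
          using J less.prems(5) by (simp add: a'_def algebra_simps)
      qed (use nz in auto)
      finally show ?thesis .
    qed
    obtain l m where lm: "l \<in> I" "m \<in> I" "weier (-S) (u l) (u m) \<noteq> 0"
      using weier_nonzero_ex[OF less.prems(1) 3, of u "-S"] nz by blast
    have "f x * weier (-S) (u l) (u m) = 0" for x
    proof -
      have "f x * weier (-S) (u l) (u m) = (\<Sum>i\<in>I. c i * (weier (-S) (u i) x * weier (-S) (u l) (u m)))"
        unfolding f_def by (simp add: sum_distrib_right mult.assoc)
      also have "\<dots> = (\<Sum>i\<in>I. c i * (weier (-S) (u i) (u l) * weier (-S) x (u m) - weier (-S) (u i) (u m) * weier (-S) x (u l)))"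
        by (intro sum.cong refl arg_cong[where f = "\<lambda>z. c _ * z"] weier_pluecker)
      also have "\<dots> = weier (-S) x (u m) * f (u l) - weier (-S) x (u l) * f (u m)"
        unfolding f_def by (simp add: algebra_simps sum_subtractf sum_distrib_left)
      finally show ?thesis using f0 lm by simp
    qed
    then have "f (a j1) = 0" using lm by simp
    moreover have "c i * weier (-S) (u i) (a j1)
       = (\<Prod>j\<in>J. br (u i - a j)) / (\<Prod>j\<in>I - {i}. br (u i - u j))" for i
      unfolding c_def weier_def using J by (simp add: S_def algebra_simps)
    ultimately show ?thesis unfolding f_def by simp
  qed
qed

end

section \<open>Factors of the summand in additive notation\<close>

definition ordered_pairs :: "nat set \<Rightarrow> (nat \<times> nat) set" where
  "ordered_pairs I = {(i, j). i \<in> I \<and> j \<in> I \<and> i < j}"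

lemma finite_ordered_pairs [simp]: "finite I \<Longrightarrow> finite (ordered_pairs I)"
  by (rule finite_subset[of _ "I \<times> I"]) (auto simp: ordered_pairs_def)

lemma prod_ordered_pairs_remove:
  fixes F :: "nat \<Rightarrow> nat \<Rightarrow> 'a::comm_monoid_mult"
  assumes I: "finite I" "i \<in> I" and sym: "\<And>j. j \<in> I \<Longrightarrow> j \<noteq> i \<Longrightarrow> F j i = F i j"
  shows "(\<Prod>(j, l)\<in>ordered_pairs I. F j l)
    = (\<Prod>(j, l)\<in>ordered_pairs (I - {i}). F j l) * (\<Prod>l\<in>I - {i}. F i l)"
proof -
  let ?G = "(\<lambda>l. if i < l then (i, l) else (l, i)) ` (I - {i})"
  have "ordered_pairs I = ordered_pairs (I - {i}) \<union> ?G"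
    using I by (auto simp: ordered_pairs_def image_iff split: if_splits)
  moreover have "ordered_pairs (I - {i}) \<inter> ?G = {}"
    by (auto simp: ordered_pairs_def split: if_splits)
  moreover have "(\<Prod>(j, l)\<in>?G. F j l) = (\<Prod>l\<in>I - {i}. F i l)"
  proof (subst prod.reindex)
    show "inj_on (\<lambda>l. if i < l then (i, l) else (l, i)) (I - {i})"
      by (auto simp: inj_on_def split: if_splits)
    show "prod ((\<lambda>(j, l). F j l) \<circ> (\<lambda>l. if i < l then (i, l) else (l, i))) (I - {i})
      = (\<Prod>l\<in>I - {i}. F i l)"
    proof (rule prod.cong[OF refl])
      fix l assume "l \<in> I - {i}"
      then show "((\<lambda>(j, l). F j l) \<circ> (\<lambda>l. if i < l then (i, l) else (l, i))) l = F i l"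
        using sym[of l] by simp
    qed
  qed
  ultimately show ?thesis
    using I by (simp add: prod.union_disjoint)
qed

text \<open>Additive notation: \<open>q = exp \<eta>\<close> and \<open>-1 = exp \<omega>\<close>, so that adding \<open>\<eta> + \<omega>\<close> is multiplication by \<open>-q\<close>.
  In these terms all monomial prefactors of the theorem cancel.\<close>

locale quartic_bracket = odd_bracket +
  fixes \<eta> \<omega> :: complex
  assumes br_shift: "br (z + 2 * \<omega>) = - br z"
    and br_eta: "m \<noteq> 0 \<Longrightarrow> br (of_int m * \<eta>) \<noteq> 0"
    and br_omega: "br (\<omega> + of_int m * \<eta>) \<noteq> 0"
begin

abbreviation D :: "complex \<Rightarrow> complex \<Rightarrow> complex" where
  "D \<equiv> weier (\<eta> + \<omega>)"

definition sfac :: "complex \<Rightarrow> complex \<Rightarrow> nat \<Rightarrow> complex" where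
  "sfac h z n = (\<Prod>m<n. br (z + of_nat m * h))"

lemma sfac_0 [simp]: "sfac h z 0 = 1"
  by (simp add: sfac_def)

lemma sfac_Suc: "sfac h z (Suc n) = sfac h z n * br (z + of_nat n * h)"
  by (simp add: sfac_def)

lemma sfac_Suc_shift: "sfac h z (Suc n) = br z * sfac h (z + h) n"
  unfolding sfac_def prod.lessThan_Suc_shift by (simp add: algebra_simps)

text \<open>The factors \<open>(-1/ax; q)\<^sub>K\<^sub>-\<^sub>k\<close> and \<open>(-q\<^sup>k\<^sup>-\<^sup>K\<^sup>+\<^sup>1 ax; q)\<^sub>3\<^sub>k\<close> combine to a single shifted factorial
  whose length \<open>4k - K + 1\<close> may be negative.\<close>

definition gfac :: "complex \<Rightarrow> int \<Rightarrow> complex" where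
  "gfac z N = (if 0 \<le> N then sfac \<eta> z (nat N) else 1 / sfac \<eta> (z + of_int N * \<eta>) (nat (- N)))"

lemma gfac_step:
  assumes "br (z + of_int N * \<eta>) \<noteq> 0"
  shows "gfac z (N + 1) = gfac z N * br (z + of_int N * \<eta>)"
proof (cases "0 \<le> N")
  case True
  then have "nat (N + 1) = Suc (nat N)" by simp
  then show ?thesis using True by (simp add: gfac_def sfac_Suc)
next
  case False
  then have *: "nat (- N) = Suc (nat (- (N + 1)))" by simp
  show ?thesis
  proof (cases "N = -1")
    case True
    then show ?thesis using assms by (simp add: gfac_def sfac_Suc)
  next
    case F2: False
    then have "\<not> 0 \<le> N + 1" using False by simp
    then show ?thesis
      using False assms unfolding gfac_def * sfac_Suc_shift by (simp add: algebra_simps)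
  qed
qed

lemma gfac_shift:
  assumes "br z \<noteq> 0"
  shows "gfac (z + \<eta>) N = gfac z (N + 1) / br z"
proof (cases "0 \<le> N")
  case True
  then have "nat (N + 1) = Suc (nat N)" by simp
  then show ?thesis using True assms by (simp add: gfac_def sfac_Suc_shift)
next
  case False
  then have *: "nat (- N) = Suc (nat (- (N + 1)))" by simp
  show ?thesis
  proof (cases "N = -1")
    case True
    then show ?thesis using assms by (simp add: gfac_def sfac_Suc)
  next
    case F2: False
    then have **: "\<not> 0 \<le> N + 1" "\<not> 0 \<le> N" using False by auto
    have e: "(of_nat (nat (- (N + 1))) :: complex) = - of_int (N + 1)"
      using ** by (simp add: of_nat_nat)
    have "sfac \<eta> (z + \<eta> + of_int N * \<eta>) (nat (- N))
        = sfac \<eta> (z + of_int (N + 1) * \<eta>) (nat (- (N + 1))) * br z"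
      unfolding * sfac_Suc e by (simp add: algebra_simps)
    then show ?thesis
      using ** by (simp add: gfac_def)
  qed
qed

definition node :: "complex \<Rightarrow> nat \<Rightarrow> complex" where
  "node x k = x + 4 * of_nat k * \<eta>"

text \<open>The factor \<open>(-1, -q, -q^2; q^2, p)_K\<close>, up to its exponential
  prefactor.\<close>

definition Nfac :: "nat \<Rightarrow> complex" where
  "Nfac K = sfac (2 * \<eta>) \<omega> K * sfac (2 * \<eta>) (\<omega> + \<eta>) K * sfac (2 * \<eta>) (\<omega> + 2 * \<eta>) K"

text \<open>The factors attached to a single index, apart from those with upper limits. The quotient
  of \<open>br (x + \<omega>)\<close> by \<open>gfac\<close> is the combination explained at
  \<open>gfac\<close>; the last denominator is the diagonal part \<open>i = j\<close> of the double
  product.\<close>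

definition Sfac :: "complex \<Rightarrow> nat \<Rightarrow> nat \<Rightarrow> complex" where
  "Sfac x k K = br (node x k + of_nat K * \<eta>) * sfac \<eta> x K / br x
     * (br (x + \<omega>) / gfac (x + \<omega>) (4 * int k - int K + 1)) / sfac (4 * \<eta>) (4 * \<eta>) k"

text \<open>The factors attached to a pair of indices: the ratio of the two \<open>Delta\<close>
  factors, the pair denominator, and the denominators of the double product at \<open>(i, j)\<close>
  and \<open>(j, i)\<close>. Joining the last two makes the expression symmetric.\<close>

definition Efac :: "complex \<Rightarrow> complex \<Rightarrow> nat \<Rightarrow> nat \<Rightarrow> complex" where
  "Efac x y k l = br (node x k - node y l) / br (x - y)
     / (sfac (4 * \<eta>) (x + y + (\<eta> + \<omega>)) (k + l) * sfac (4 * \<eta>) (x - y + 4 * \<eta>) k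
        * sfac (4 * \<eta>) (y - x + 4 * \<eta>) l)"

lemma Efac_swap: "Efac x y k l = Efac y x l k"
  unfolding Efac_def using br_swap[of x y] br_swap[of "node x k" "node y l"]
  by (simp add: add.commute mult_ac)

text \<open>The factorials of length \<open>k + l\<close> and \<open>k\<close> lose their last
  factors. The kernel \<open>D\<close> arises because the bracket lost by the first one meets the
  numerator \<open>br (node x k - node y l)\<close>.\<close>

lemma Efac_low:
  assumes "br (node x (Suc k) - node y l) \<noteq> 0" "br (node x (Suc k) - y) \<noteq> 0"
    "br (node x k + node y l + (\<eta> + \<omega>)) \<noteq> 0"
  shows "Efac x y k l = Efac x y (Suc k) l
    * (D (node x k) (node y l) * br (node x (Suc k) - y) / br (node x (Suc k) - node y l))"
proof -
  have 1: "sfac (4 * \<eta>) (x + y + (\<eta> + \<omega>)) (Suc k + l)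
      = sfac (4 * \<eta>) (x + y + (\<eta> + \<omega>)) (k + l) * br (node x k + node y l + (\<eta> + \<omega>))"
    unfolding add_Suc sfac_Suc by (simp add: node_def algebra_simps)
  have 2: "sfac (4 * \<eta>) (x - y + 4 * \<eta>) (Suc k)
      = sfac (4 * \<eta>) (x - y + 4 * \<eta>) k * br (node x (Suc k) - y)"
    unfolding sfac_Suc by (simp add: node_def algebra_simps)
  show ?thesis unfolding Efac_def 1 2 weier_def using assms by (simp add: field_simps)
qed

text \<open>Raising \<open>x\<close> by \<open>4 * \<eta>\<close> while its index drops by one fixes
  \<open>node\<close>. The factorials of length \<open>k + l\<close> and \<open>k\<close> now lose
  their first factors, and the third one moves by one step.\<close>

lemma Efac_shift:
  assumes "br (x - y) \<noteq> 0" "br (x + 4 * \<eta> - y) \<noteq> 0" "br (x + y + (\<eta> + \<omega>)) \<noteq> 0"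
    "br (x - node y l) \<noteq> 0"
  shows "Efac (x + 4 * \<eta>) y k l = Efac x y (Suc k) l
    * (br (x + y + (\<eta> + \<omega>)) * br (x - node y l))"
proof -
  have 1: "sfac (4 * \<eta>) (x + y + (\<eta> + \<omega>)) (Suc k + l)
      = br (x + y + (\<eta> + \<omega>)) * sfac (4 * \<eta>) (x + 4 * \<eta> + y + (\<eta> + \<omega>)) (k + l)"
    unfolding add_Suc sfac_Suc_shift by (simp add: algebra_simps)
  have 2: "sfac (4 * \<eta>) (x - y + 4 * \<eta>) (Suc k)
      = br (x + 4 * \<eta> - y) * sfac (4 * \<eta>) (x + 4 * \<eta> - y + 4 * \<eta>) k"
    unfolding sfac_Suc_shift by (simp add: algebra_simps)
  have "br (y - x) * sfac (4 * \<eta>) (y - x + 4 * \<eta>) l = sfac (4 * \<eta>) (y - x) l * br (node y l - x)"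
    unfolding sfac_Suc_shift[symmetric] sfac_Suc by (simp add: node_def algebra_simps)
  then have 3: "sfac (4 * \<eta>) (y - x) l = br (x - y) * sfac (4 * \<eta>) (y - x + 4 * \<eta>) l / br (x - node y l)"
    using br_swap[of y x] br_swap[of "node y l" x] assms(4) by (simp add: field_simps)
  have 4: "node (x + 4 * \<eta>) k = node x (Suc k)" "y - (x + 4 * \<eta>) + 4 * \<eta> = y - x"
    by (simp_all add: node_def algebra_simps)
  show ?thesis unfolding Efac_def 1 2 3 4 using assms by (simp add: field_simps)
qed

text \<open>The case of an index that keeps its value while another one drops, so that only the
  total changes.\<close>

lemma Sfac_same:
  assumes "br (node x k + of_nat (Suc K) * \<eta>) \<noteq> 0" "br (x + of_nat K * \<eta>) \<noteq> 0"
    "br (node x k + \<omega> - of_nat K * \<eta>) \<noteq> 0"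
  shows "Sfac x k K = Sfac x k (Suc K)
    * (br (node x k + of_nat K * \<eta>) / (D (node x k) (- of_nat (Suc K) * \<eta>) * br (x + of_nat K * \<eta>)))"
proof -
  have e: "x + \<omega> + of_int (4 * int k - int K) * \<eta> = node x k + \<omega> - of_nat K * \<eta>"
    by (simp add: node_def algebra_simps)
  have "4 * int k - int (Suc K) + 1 = 4 * int k - int K" by simp
  moreover have "gfac (x + \<omega>) (4 * int k - int K + 1)
      = gfac (x + \<omega>) (4 * int k - int K) * br (node x k + \<omega> - of_nat K * \<eta>)"
    using gfac_step[of "x + \<omega>" "4 * int k - int K"] assms(3) unfolding e by simp
  moreover have "D (node x k) (- of_nat (Suc K) * \<eta>)
      = br (node x k + of_nat (Suc K) * \<eta>) * br (node x k + \<omega> - of_nat K * \<eta>)"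
    unfolding weier_def by (simp add: algebra_simps)
  ultimately show ?thesis
    unfolding Sfac_def sfac_Suc using assms by (simp add: field_simps)
qed

text \<open>Index and total drop together, so the length \<open>4k - K + 1\<close> of
  \<open>gfac\<close> drops by three; hence the three brackets containing
  \<open>\<omega>\<close>.\<close>

lemma Sfac_low:
  assumes "br (node x (Suc k) + of_nat (Suc K) * \<eta>) \<noteq> 0" "br (x + of_nat K * \<eta>) \<noteq> 0"
    "\<And>m. br (x + \<omega> + of_int m * \<eta>) \<noteq> 0"
  shows "Sfac x k K = Sfac x (Suc k) (Suc K)
    * (br (node x k + of_nat K * \<eta>) * br (node x (Suc k) - x)
       * (br (node x (Suc k) + \<omega> - of_nat (K + 3) * \<eta>)
          * br (node x (Suc k) + \<omega> - of_nat (K + 2) * \<eta>)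
          * br (node x (Suc k) + \<omega> - of_nat (K + 1) * \<eta>))
       / (br (node x (Suc k) + of_nat (Suc K) * \<eta>) * br (x + of_nat K * \<eta>)))"
proof -
  define M where "M = 4 * int k - int K"
  have a: "x + \<omega> + of_int (M + 1) * \<eta> = node x (Suc k) + \<omega> - of_nat (K + 3) * \<eta>"
    "x + \<omega> + of_int (M + 2) * \<eta> = node x (Suc k) + \<omega> - of_nat (K + 2) * \<eta>"
    "x + \<omega> + of_int (M + 3) * \<eta> = node x (Suc k) + \<omega> - of_nat (K + 1) * \<eta>"
    by (simp_all add: node_def M_def algebra_simps)
  have g: "gfac (x + \<omega>) (M + 4) = gfac (x + \<omega>) (M + 1)
      * (br (node x (Suc k) + \<omega> - of_nat (K + 3) * \<eta>)
          * br (node x (Suc k) + \<omega> - of_nat (K + 2) * \<eta>)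
          * br (node x (Suc k) + \<omega> - of_nat (K + 1) * \<eta>))"
    using gfac_step[OF assms(3), of "M + 1"] gfac_step[OF assms(3), of "M + 2"]
      gfac_step[OF assms(3), of "M + 3"]
    unfolding a[symmetric] by (simp add: add.assoc mult.assoc)
  have nz: "br (node x (Suc k) + \<omega> - of_nat (K + 3) * \<eta>) \<noteq> 0"
    "br (node x (Suc k) + \<omega> - of_nat (K + 2) * \<eta>) \<noteq> 0"
    "br (node x (Suc k) + \<omega> - of_nat (K + 1) * \<eta>) \<noteq> 0"
    unfolding a[symmetric] by (rule assms(3))+
  have m: "4 * int (Suc k) - int (Suc K) + 1 = M + 4" "4 * int k - int K + 1 = M + 1"
    by (simp_all add: M_def)
  have s: "sfac (4 * \<eta>) (4 * \<eta>) (Suc k) = sfac (4 * \<eta>) (4 * \<eta>) k * br (node x (Suc k) - x)"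
    unfolding sfac_Suc by (simp add: node_def algebra_simps)
  have n: "br (node x (Suc k) - x) \<noteq> 0"
    using br_eta[of "4 * int (Suc k)"] by (simp add: node_def algebra_simps)
  show ?thesis
    unfolding Sfac_def m g s sfac_Suc[of _ _ K] using nz n assms(1,2) by (simp add: divide_simps)
qed

text \<open>The prefactor is the quotient of the product sides before and after the shift. It brings
  \<open>sfac\<close> and \<open>gfac\<close>, whose base points have moved by four steps, back to
  their old base points.\<close>

lemma Sfac_shift:
  assumes "br (node x (Suc k) + of_nat (Suc K) * \<eta>) \<noteq> 0"
    "\<And>m. br (x + of_int m * \<eta>) \<noteq> 0" "\<And>m. br (x + \<omega> + of_int m * \<eta>) \<noteq> 0"
  shows "sfac \<eta> (x + \<eta>) 4 / sfac \<eta> (x + \<omega> + \<eta>) 4 * Sfac (x + 4 * \<eta>) k K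
    = Sfac x (Suc k) (Suc K)
    * (br (node x (Suc k) + of_nat K * \<eta>) * br (node x (Suc k) - x)
       * (br (x + of_nat (K + 1) * \<eta>) * br (x + of_nat (K + 2) * \<eta>) * br (x + of_nat (K + 3) * \<eta>))
       / D (node x (Suc k)) (- of_nat (Suc K) * \<eta>))"
proof -
  define M where "M = 4 * int k - int K"
  have a: "x + \<omega> + of_int (M + 4) * \<eta> = node x (Suc k) + \<omega> - of_nat K * \<eta>"
    by (simp add: node_def M_def algebra_simps)
  have g: "gfac (x + \<omega>) (M + 5) = gfac (x + \<omega>) (M + 4) * br (node x (Suc k) + \<omega> - of_nat K * \<eta>)"
    using gfac_step[OF assms(3), of "M + 4"] unfolding a[symmetric] by (simp add: add.assoc)
  have nz: "br (node x (Suc k) + \<omega> - of_nat K * \<eta>) \<noteq> 0"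
    unfolding a[symmetric] by (rule assms(3))+
  have m: "4 * int (Suc k) - int (Suc K) + 1 = M + 4" "4 * int k - int K + 1 = M + 1"
    by (simp_all add: M_def)
  have s: "sfac (4 * \<eta>) (4 * \<eta>) (Suc k) = sfac (4 * \<eta>) (4 * \<eta>) k * br (node x (Suc k) - x)"
    unfolding sfac_Suc by (simp add: node_def algebra_simps)
  have n: "br (node x (Suc k) - x) \<noteq> 0"
    using br_eta[of "4 * int (Suc k)"] by (simp add: node_def algebra_simps)
  define y where "y = x + \<omega>"
  have y: "br (y + of_int m * \<eta>) \<noteq> 0" for m using assms(3) by (simp add: y_def)
  have y0: "br y \<noteq> 0" "br (y + \<eta>) \<noteq> 0" "br (y + 2 * \<eta>) \<noteq> 0" "br (y + 3 * \<eta>) \<noteq> 0" "br (y + 4 * \<eta>) \<noteq> 0"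
    using y[of 0] y[of 1] y[of 2] y[of 3] y[of 4] by simp_all
  have "gfac (y + \<eta>) (M + 4) = gfac y (M + 5) / br y"
    using gfac_shift[OF y0(1), of "M + 4"] by (simp add: add.assoc)
  moreover have "gfac (y + 2 * \<eta>) (M + 3) = gfac (y + \<eta>) (M + 4) / br (y + \<eta>)"
    using gfac_shift[OF y0(2), of "M + 3"] by (simp add: add.assoc flip: mult_2)
  moreover have "gfac (y + 3 * \<eta>) (M + 2) = gfac (y + 2 * \<eta>) (M + 3) / br (y + 2 * \<eta>)"
    using gfac_shift[OF y0(3), of "M + 2"] by (simp add: algebra_simps)
  moreover have "gfac (y + 4 * \<eta>) (M + 1) = gfac (y + 3 * \<eta>) (M + 2) / br (y + 3 * \<eta>)"
    using gfac_shift[OF y0(4), of "M + 1"] by (simp add: algebra_simps)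
  ultimately have gg: "gfac (y + 4 * \<eta>) (M + 1)
      = gfac y (M + 5) / (br y * br (y + \<eta>) * br (y + 2 * \<eta>) * br (y + 3 * \<eta>))"
    by simp
  have s4: "sfac \<eta> (z + \<eta>) 4 = br (z + \<eta>) * br (z + 2 * \<eta>) * br (z + 3 * \<eta>) * br (z + 4 * \<eta>)" for z
    by (simp add: numeral_eq_Suc sfac_Suc algebra_simps)
  have x0: "br x \<noteq> 0" "br (x + 4 * \<eta>) \<noteq> 0"
    using assms(2)[of 0] assms(2)[of 4] by simp_all
  have "br x * sfac \<eta> (x + \<eta>) 4 * sfac \<eta> (x + 4 * \<eta>) K = br (x + 4 * \<eta>) * sfac \<eta> x (K + 4)"
  proof -
    have "sfac \<eta> z (Suc n) = br z * sfac \<eta> (z + \<eta>) n" for z n by (rule sfac_Suc_shift)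
    then show ?thesis unfolding s4 by (simp add: numeral_eq_Suc algebra_simps)
  qed
  also have "sfac \<eta> x (K + 4) = sfac \<eta> x (Suc K) * (br (x + of_nat (K + 1) * \<eta>) * br (x + of_nat (K + 2) * \<eta>) * br (x + of_nat (K + 3) * \<eta>))"
    by (simp add: numeral_eq_Suc sfac_Suc algebra_simps)
  finally have xx: "sfac \<eta> (x + \<eta>) 4 * sfac \<eta> (x + 4 * \<eta>) K / br (x + 4 * \<eta>)
     = sfac \<eta> x (Suc K) * (br (x + of_nat (K + 1) * \<eta>) * br (x + of_nat (K + 2) * \<eta>) * br (x + of_nat (K + 3) * \<eta>)) / br x"
    using x0 by (simp add: field_simps)
  have Dv: "D (node x (Suc k)) (- of_nat (Suc K) * \<eta>)
      = br (node x (Suc k) + of_nat (Suc K) * \<eta>) * br (node x (Suc k) + \<omega> - of_nat K * \<eta>)"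
    unfolding weier_def by (simp add: algebra_simps)
  have nds: "node (x + 4 * \<eta>) k = node x (Suc k)" "x + 4 * \<eta> + \<omega> = y + 4 * \<eta>" "x + \<omega> = y"
    by (simp_all add: node_def y_def algebra_simps)
  have "sfac \<eta> (x + \<eta>) 4 / sfac \<eta> (y + \<eta>) 4 * Sfac (x + 4 * \<eta>) k K
     = (sfac \<eta> (x + \<eta>) 4 * sfac \<eta> (x + 4 * \<eta>) K / br (x + 4 * \<eta>)) * br (node x (Suc k) + of_nat K * \<eta>)
       * (br (y + 4 * \<eta>) / sfac \<eta> (y + \<eta>) 4 / gfac (y + 4 * \<eta>) (M + 1)) / sfac (4 * \<eta>) (4 * \<eta>) k"
    unfolding Sfac_def nds m by (simp add: mult_ac)
  also have "br (y + 4 * \<eta>) / sfac \<eta> (y + \<eta>) 4 / gfac (y + 4 * \<eta>) (M + 1) = br y / gfac y (M + 5)"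
    unfolding gg s4 using y0 by (simp add: divide_simps)
  finally have fin: "sfac \<eta> (x + \<eta>) 4 / sfac \<eta> (y + \<eta>) 4 * Sfac (x + 4 * \<eta>) k K
     = (sfac \<eta> (x + \<eta>) 4 * sfac \<eta> (x + 4 * \<eta>) K / br (x + 4 * \<eta>)) * br (node x (Suc k) + of_nat K * \<eta>)
       * (br y / gfac y (M + 5)) / sfac (4 * \<eta>) (4 * \<eta>) k" .
  show ?thesis
    unfolding nds(3) fin xx
    unfolding Sfac_def m s Dv nds g[unfolded nds] using nz n assms(1)
    by (simp add: divide_simps)
qed

end

section \<open>Partial fractions and ratios of coefficients\<close>

text \<open>Two exceptional nodes are adjoined in the second summand of a sum type, so that their
  terms can be separated from the sum over \<open>I\<close>.\<close>

definition two_more :: "'i set \<Rightarrow> ('i + bool) set" where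
  "two_more I = insert (Inr True) (insert (Inr False) (Inl ` I))"

lemma card_two_more: "finite I \<Longrightarrow> card (two_more I) = card I + 2"
  by (simp add: two_more_def card_image image_iff)

lemma sum_two_more:
  fixes f :: "'i + bool \<Rightarrow> 'a::comm_monoid_add"
  shows "finite I \<Longrightarrow> sum f (two_more I) = (\<Sum>i\<in>I. f (Inl i)) + f (Inr True) + f (Inr False)"
  by (simp add: two_more_def sum.reindex image_iff ac_simps)

lemma prod_two_more_remove:
  fixes f :: "'i + bool \<Rightarrow> 'a::comm_monoid_mult"
  assumes "finite I"
  shows "prod f (two_more I - {Inl i}) = f (Inr True) * f (Inr False) * (\<Prod>j\<in>I - {i}. f (Inl j))"
    "prod f (two_more I - {Inr b}) = f (Inr (\<not> b)) * (\<Prod>j\<in>I. f (Inl j))"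
proof -
  have "two_more I - {Inl i} = insert (Inr True) (insert (Inr False) (Inl ` (I - {i})))"
    "two_more I - {Inr b} = insert (Inr (\<not> b)) (Inl ` I)"
    by (cases b; auto simp: two_more_def)+
  then show "prod f (two_more I - {Inl i}) = f (Inr True) * f (Inr False) * (\<Prod>j\<in>I - {i}. f (Inl j))"
    "prod f (two_more I - {Inr b}) = f (Inr (\<not> b)) * (\<Prod>j\<in>I. f (Inl j))"
    using assms by (simp_all add: prod.reindex image_iff ac_simps)
qed

text \<open>Antisymmetry reduces each pair of nodes to one order. The function \<open>f\<close> is
  general because the lemma serves both \<open>br (x - y)\<close> and
  \<open>weier s\<close>.\<close>

lemma two_more_antisym_nonzero:
  fixes f :: "complex \<Rightarrow> complex \<Rightarrow> complex"
  assumes f: "\<And>x y. f x y = - f y x"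
    and nz: "\<And>i j. i \<in> I \<Longrightarrow> j \<in> I \<Longrightarrow> i \<noteq> j \<Longrightarrow> f (v i) (v j) \<noteq> 0"
      "\<And>i. i \<in> I \<Longrightarrow> f (v i) b \<noteq> 0" "\<And>i. i \<in> I \<Longrightarrow> f (v i) c \<noteq> 0" "f b c \<noteq> 0"
    and ij: "i \<in> two_more I" "j \<in> two_more I" "i \<noteq> j"
  defines "u \<equiv> case_sum v (\<lambda>t. if t then b else c)"
  shows "f (u i) (u j) \<noteq> 0"
proof -
  have "f b (v l) \<noteq> 0" "f c (v l) \<noteq> 0" if "l \<in> I" for l
    using nz(2,3)[OF that] f[of b "v l"] f[of c "v l"] by simp_all
  moreover have "f c b \<noteq> 0" using nz(4) f[of b c] by simp
  moreover have "l = m" if "f (v l) (v m) = 0" "l \<in> I" "m \<in> I" for l m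
    using nz(1) that by blast
  ultimately show ?thesis
    using nz(2-) ij unfolding two_more_def u_def by auto
qed

context odd_bracket
begin

lemma bracket_partial_fractions_2:
  fixes v :: "'i \<Rightarrow> complex" and a :: "'j \<Rightarrow> complex"
  assumes I: "finite I" and J: "finite J" "card J = card I + 2"
    and s: "(\<Sum>i\<in>I. v i) + b + c = (\<Sum>j\<in>J. a j)"
    and nz: "\<And>i j. i \<in> I \<Longrightarrow> j \<in> I \<Longrightarrow> i \<noteq> j \<Longrightarrow> br (v i - v j) \<noteq> 0"
      "\<And>i. i \<in> I \<Longrightarrow> br (v i - b) \<noteq> 0" "\<And>i. i \<in> I \<Longrightarrow> br (v i - c) \<noteq> 0" "br (b - c) \<noteq> 0"
  shows "(\<Sum>i\<in>I. (\<Prod>j\<in>J. br (v i - a j))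
        / (br (v i - b) * br (v i - c) * (\<Prod>j\<in>I - {i}. br (v i - v j))))
      + (\<Prod>j\<in>J. br (b - a j)) / (br (b - c) * (\<Prod>j\<in>I. br (b - v j)))
      + (\<Prod>j\<in>J. br (c - a j)) / (br (c - b) * (\<Prod>j\<in>I. br (c - v j))) = 0"
proof -
  define u where "u = case_sum v (\<lambda>t. if t then b else c)"
  have "(\<Sum>i\<in>two_more I. (\<Prod>j\<in>J. br (u i - a j)) / (\<Prod>j\<in>two_more I - {i}. br (u i - u j))) = 0"
  proof (rule bracket_partial_fractions)
    show "finite (two_more I)" "two_more I \<noteq> {}" using I by (auto simp: two_more_def)
    show "card (two_more I) = card J" using I J by (simp add: card_two_more)
    show "sum u (two_more I) = sum a J"
      unfolding s[symmetric] sum_two_more[OF I] u_def by simp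
    show "br (u i - u j) \<noteq> 0" if "i \<in> two_more I" "j \<in> two_more I" "i \<noteq> j" for i j
      unfolding u_def
      by (rule two_more_antisym_nonzero[where f = "\<lambda>x y. br (x - y)", OF br_swap nz that])
  qed (use J in auto)
  then show ?thesis
    unfolding sum_two_more[OF I] prod_two_more_remove[OF I] by (simp add: u_def)
qed

text \<open>There will be one kernel in the numerator for each upper end, hence as many as ordinary
  nodes; since interpolation takes two nodes more than kernels, exactly two companions
  \<open>b\<close> and \<open>c\<close> are added.\<close>

lemma weier_interpolation_2:
  fixes v :: "'i \<Rightarrow> complex" and X :: "'j \<Rightarrow> complex"
  assumes I: "finite I" and A: "finite A" "card I = card A"
    and nz: "\<And>i j. i \<in> I \<Longrightarrow> j \<in> I \<Longrightarrow> i \<noteq> j \<Longrightarrow> weier s (v i) (v j) \<noteq> 0"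
      "\<And>i. i \<in> I \<Longrightarrow> weier s (v i) b \<noteq> 0" "\<And>i. i \<in> I \<Longrightarrow> weier s (v i) c \<noteq> 0" "weier s b c \<noteq> 0"
  shows "(\<Sum>i\<in>I. (\<Prod>a\<in>A. weier s (X a) (v i))
        / (weier s (v i) b * weier s (v i) c * (\<Prod>j\<in>I - {i}. weier s (v i) (v j))))
      + (\<Prod>a\<in>A. weier s (X a) b) / (weier s b c * (\<Prod>j\<in>I. weier s b (v j)))
      + (\<Prod>a\<in>A. weier s (X a) c) / (weier s c b * (\<Prod>j\<in>I. weier s c (v j))) = 0"
proof -
  define u where "u = case_sum v (\<lambda>t. if t then b else c)"
  have "(\<Sum>i\<in>two_more I. (\<Prod>a\<in>A. weier s (X a) (u i)) / (\<Prod>j\<in>two_more I - {i}. weier s (u i) (u j))) = 0"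
  proof (rule weier_interpolation)
    show "finite (two_more I)" using I by (simp add: two_more_def)
    show "card (two_more I) = card A + 2" using I A by (simp add: card_two_more)
    show "weier s (u i) (u j) \<noteq> 0" if "i \<in> two_more I" "j \<in> two_more I" "i \<noteq> j" for i j
      unfolding u_def by (rule two_more_antisym_nonzero[where f = "weier s", OF weier_swap nz that])
  qed (use A in auto)
  then show ?thesis
    unfolding sum_two_more[OF I] prod_two_more_remove[OF I] by (simp add: u_def)
qed

end

context quartic_bracket
begin

section \<open>Ratios of coefficients at neighbouring points\<close>

definition Nstep :: "nat \<Rightarrow> complex" where
  "Nstep K = br (\<omega> + of_nat (2 * K) * \<eta>) * br (\<omega> + of_nat (2 * K + 1) * \<eta>) * br (\<omega> + of_nat (2 * K + 2) * \<eta>)"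

lemma Nstep_nonzero: "Nstep K \<noteq> 0"
  using br_omega[of "int (2 * K)"] br_omega[of "int (2 * K + 1)"] br_omega[of "int (2 * K + 2)"]
  by (simp add: Nstep_def)

lemma Nfac_Suc: "Nfac (Suc K) = Nfac K * Nstep K"
  unfolding Nfac_def sfac_Suc Nstep_def by (simp add: algebra_simps)

text \<open>The part of the summand that does not involve the upper summation limits.\<close>

definition tau :: "nat set \<Rightarrow> (nat \<Rightarrow> complex) \<Rightarrow> (nat \<Rightarrow> nat) \<Rightarrow> complex" where
  "tau I \<xi> k = Nfac (sum k I) * (\<Prod>i\<in>I. Sfac (\<xi> i) (k i) (sum k I))
    * (\<Prod>(i, j)\<in>ordered_pairs I. Efac (\<xi> i) (\<xi> j) (k i) (k j))"

lemma tau_split: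
  assumes "finite I" "i \<in> I"
  shows "tau I \<xi> k = Nfac (sum k I) * Sfac (\<xi> i) (k i) (sum k I)
    * (\<Prod>l\<in>I - {i}. Sfac (\<xi> l) (k l) (sum k I) * Efac (\<xi> i) (\<xi> l) (k i) (k l))
    * (\<Prod>(j, l)\<in>ordered_pairs (I - {i}). Efac (\<xi> j) (\<xi> l) (k j) (k l))"
  unfolding tau_def
  using prod_ordered_pairs_remove[OF assms, of "\<lambda>i j. Efac (\<xi> i) (\<xi> j) (k i) (k j)"]
    prod.remove[OF assms, of "\<lambda>i. Sfac (\<xi> i) (k i) (sum k I)"]
  by (simp add: Efac_swap prod.distrib mult_ac)

text \<open>Quantifying over all integers \<open>m\<close> makes the condition invariant under the
  shifts by \<open>4 * \<eta>\<close> in the induction. The sums include \<open>j = i\<close>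
  because a node of an index is also paired with the starting point of the same index.\<close>

definition generic :: "nat set \<Rightarrow> (nat \<Rightarrow> complex) \<Rightarrow> bool" where
  "generic I \<xi> \<longleftrightarrow> (\<forall>i\<in>I. \<forall>m::int. br (\<xi> i + of_int m * \<eta>) \<noteq> 0 \<and> br (\<xi> i + \<omega> + of_int m * \<eta>) \<noteq> 0
     \<and> (\<forall>j\<in>I. br (\<xi> i + \<xi> j + \<omega> + of_int m * \<eta>) \<noteq> 0 \<and> (i \<noteq> j \<longrightarrow> br (\<xi> i - \<xi> j + of_int m * \<eta>) \<noteq> 0)))"

lemma genericD:
  assumes "generic I \<xi>" "i \<in> I"
  shows "br (\<xi> i + of_int m * \<eta>) \<noteq> 0" "br (\<xi> i + \<omega> + of_int m * \<eta>) \<noteq> 0"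
    "j \<in> I \<Longrightarrow> br (\<xi> i + \<xi> j + \<omega> + of_int m * \<eta>) \<noteq> 0"
    "j \<in> I \<Longrightarrow> i \<noteq> j \<Longrightarrow> br (\<xi> i - \<xi> j + of_int m * \<eta>) \<noteq> 0"
  using assms by (auto simp: generic_def)

lemma generic_node:
  assumes g: "generic I \<xi>" and i: "i \<in> I"
  shows "br (node (\<xi> i) k + of_nat m * \<eta>) \<noteq> 0" "br (node (\<xi> i) k + \<omega> - of_nat m * \<eta>) \<noteq> 0"
    "j \<in> I \<Longrightarrow> br (node (\<xi> i) k + node (\<xi> j) l + (\<eta> + \<omega>)) \<noteq> 0"
    "j \<in> I \<Longrightarrow> br (node (\<xi> i) k + \<xi> j + (\<eta> + \<omega>)) \<noteq> 0"
    "j \<in> I \<Longrightarrow> br (\<xi> i + node (\<xi> j) l + (\<eta> + \<omega>)) \<noteq> 0"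
    "j \<in> I \<Longrightarrow> br (\<xi> i + \<xi> j + (\<eta> + \<omega>)) \<noteq> 0"
    "j \<in> I \<Longrightarrow> i \<noteq> j \<Longrightarrow> br (node (\<xi> i) k - node (\<xi> j) l) \<noteq> 0"
    "j \<in> I \<Longrightarrow> i \<noteq> j \<Longrightarrow> br (node (\<xi> i) k - \<xi> j) \<noteq> 0"
    "j \<in> I \<Longrightarrow> i \<noteq> j \<Longrightarrow> br (\<xi> i - node (\<xi> j) l) \<noteq> 0"
    "j \<in> I \<Longrightarrow> i \<noteq> j \<Longrightarrow> br (\<xi> i - \<xi> j) \<noteq> 0"
    "j \<in> I \<Longrightarrow> i \<noteq> j \<Longrightarrow> br (\<xi> i + 4 * \<eta> - \<xi> j) \<noteq> 0"
    "br (\<xi> i + of_nat m * \<eta>) \<noteq> 0"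
    "0 < k \<Longrightarrow> br (node (\<xi> i) k - \<xi> i) \<noteq> 0"
proof -
  note d = genericD[OF g i]
  show "br (node (\<xi> i) k + of_nat m * \<eta>) \<noteq> 0"
    using d(1)[of "4 * int k + int m"] by (simp add: node_def algebra_simps)
  show "br (node (\<xi> i) k + \<omega> - of_nat m * \<eta>) \<noteq> 0"
    using d(2)[of "4 * int k - int m"] by (simp add: node_def algebra_simps)
  show "br (\<xi> i + of_nat m * \<eta>) \<noteq> 0"
    using d(1)[of "int m"] by simp
  show "0 < k \<Longrightarrow> br (node (\<xi> i) k - \<xi> i) \<noteq> 0"
    using br_eta[of "4 * int k"] by (simp add: node_def algebra_simps)
  assume j: "j \<in> I"
  show "br (node (\<xi> i) k + node (\<xi> j) l + (\<eta> + \<omega>)) \<noteq> 0"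
    using d(3)[OF j, of "4 * int k + 4 * int l + 1"] by (simp add: node_def algebra_simps)
  show "br (node (\<xi> i) k + \<xi> j + (\<eta> + \<omega>)) \<noteq> 0"
    using d(3)[OF j, of "4 * int k + 1"] by (simp add: node_def algebra_simps)
  show "br (\<xi> i + node (\<xi> j) l + (\<eta> + \<omega>)) \<noteq> 0"
    using d(3)[OF j, of "4 * int l + 1"] by (simp add: node_def algebra_simps)
  show "br (\<xi> i + \<xi> j + (\<eta> + \<omega>)) \<noteq> 0"
    using d(3)[OF j, of 1] by (simp add: node_def algebra_simps)
  assume ij: "i \<noteq> j"
  note d4 = d(4)[OF j ij]
  show "br (node (\<xi> i) k - node (\<xi> j) l) \<noteq> 0"
    using d4[of "4 * int k - 4 * int l"] by (simp add: node_def algebra_simps)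
  show "br (node (\<xi> i) k - \<xi> j) \<noteq> 0"
    using d4[of "4 * int k"] by (simp add: node_def algebra_simps)
  show "br (\<xi> i - node (\<xi> j) l) \<noteq> 0"
    using d4[of "- 4 * int l"] by (simp add: node_def algebra_simps)
  show "br (\<xi> i - \<xi> j) \<noteq> 0"
    using d4[of 0] by simp
  show "br (\<xi> i + 4 * \<eta> - \<xi> j) \<noteq> 0"
    using d4[of 4] by (simp add: algebra_simps)
qed

lemma sum_fun_upd_pred:
  fixes k :: "nat \<Rightarrow> nat"
  assumes "finite I" "i \<in> I" "k i = Suc k'" "sum k I = Suc K"
  shows "sum (k(i := k')) I = K"
  using assms sum.remove[OF assms(1,2), of k] sum.remove[OF assms(1,2), of "k(i := k')"]
  by simp

text \<open>Lowering \<open>k i\<close> lowers the total too, so every index contributes: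
  \<open>i\<close> itself through \<open>Sfac_low\<close>, any other index through
  \<open>Sfac_same\<close> and through its pair with \<open>i\<close>. Pairs without
  \<open>i\<close> do not change.\<close>

lemma tau_low:
  assumes I: "finite I" "i \<in> I" and g: "generic I \<xi>" and k: "k i = Suc k'" "sum k I = Suc K"
  defines "v \<equiv> \<lambda>l. node (\<xi> l) (k l)"
  shows "tau I \<xi> (k(i := k')) = tau I \<xi> k / Nstep K
    * (br (node (\<xi> i) k' + of_nat K * \<eta>) * br (v i - \<xi> i)
       * (br (v i + \<omega> - of_nat (K + 3) * \<eta>) * br (v i + \<omega> - of_nat (K + 2) * \<eta>)
          * br (v i + \<omega> - of_nat (K + 1) * \<eta>))
       / (br (v i + of_nat (Suc K) * \<eta>) * br (\<xi> i + of_nat K * \<eta>)))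
    * (\<Prod>l\<in>I - {i}. br (v l + of_nat K * \<eta>) / (D (v l) (- of_nat (Suc K) * \<eta>) * br (\<xi> l + of_nat K * \<eta>))
        * (D (node (\<xi> i) k') (v l) * br (v i - \<xi> l) / br (v i - v l)))"
proof -
  let ?t = "\<lambda>l. br (v l + of_nat K * \<eta>) / (D (v l) (- of_nat (Suc K) * \<eta>) * br (\<xi> l + of_nat K * \<eta>))
        * (D (node (\<xi> i) k') (v l) * br (v i - \<xi> l) / br (v i - v l))"
  note K' = sum_fun_upd_pred[OF I k]
  have gi: "br (\<xi> i + \<omega> + of_int m * \<eta>) \<noteq> 0" for m by (rule genericD(2)[OF g I(2)])
  have 1: "Sfac (\<xi> i) k' K = Sfac (\<xi> i) (k i) (Suc K) *
      (br (node (\<xi> i) k' + of_nat K * \<eta>) * br (v i - \<xi> i)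
       * (br (v i + \<omega> - of_nat (K + 3) * \<eta>) * br (v i + \<omega> - of_nat (K + 2) * \<eta>)
          * br (v i + \<omega> - of_nat (K + 1) * \<eta>))
       / (br (v i + of_nat (Suc K) * \<eta>) * br (\<xi> i + of_nat K * \<eta>)))"
    unfolding v_def k(1)
    by (rule Sfac_low[OF _ _ gi]) (intro generic_node[OF g I(2)])+
  have 2: "Sfac (\<xi> l) (k l) K * Efac (\<xi> i) (\<xi> l) k' (k l)
    = Sfac (\<xi> l) (k l) (Suc K) * Efac (\<xi> i) (\<xi> l) (k i) (k l)
     * ?t l"
    if l: "l \<in> I - {i}" for l
  proof -
    have l': "l \<in> I" "i \<noteq> l" using l by auto
    have "Sfac (\<xi> l) (k l) K = Sfac (\<xi> l) (k l) (Suc K)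
      * (br (v l + of_nat K * \<eta>) / (D (v l) (- of_nat (Suc K) * \<eta>) * br (\<xi> l + of_nat K * \<eta>)))"
      unfolding v_def by (rule Sfac_same) (intro generic_node[OF g l'(1)])+
    moreover have "Efac (\<xi> i) (\<xi> l) k' (k l) = Efac (\<xi> i) (\<xi> l) (k i) (k l)
      * (D (node (\<xi> i) k') (v l) * br (v i - \<xi> l) / br (v i - v l))"
      unfolding v_def k(1) by (rule Efac_low) (intro generic_node[OF g I(2)] l')+
    ultimately show ?thesis by (simp add: mult_ac)
  qed
  have 3: "(\<Prod>(j, l)\<in>ordered_pairs (I - {i}). Efac (\<xi> j) (\<xi> l) ((k(i := k')) j) ((k(i := k')) l))
    = (\<Prod>(j, l)\<in>ordered_pairs (I - {i}). Efac (\<xi> j) (\<xi> l) (k j) (k l))"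
    by (rule prod.cong) (auto simp: ordered_pairs_def)
  have "(\<Prod>l\<in>I - {i}. Sfac (\<xi> l) ((k(i := k')) l) K * Efac (\<xi> i) (\<xi> l) k' ((k(i := k')) l))
    = (\<Prod>l\<in>I - {i}. Sfac (\<xi> l) (k l) (Suc K) * Efac (\<xi> i) (\<xi> l) (k i) (k l)
     * ?t l)"
    by (rule prod.cong[OF refl]) (subst 2[symmetric], auto)
  then show ?thesis
    unfolding tau_split[OF I] K' k(2) 3 fun_upd_same 1 prod.distrib Nfac_Suc
    using Nstep_nonzero[of K] by simp
qed

text \<open>The counterpart of \<open>tau_low\<close> in which the node of \<open>i\<close> stays
  fixed and its starting point moves up.\<close>

lemma tau_shift:
  assumes I: "finite I" "i \<in> I" and g: "generic I \<xi>" and k: "k i = Suc k'" "sum k I = Suc K"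
  defines "v \<equiv> \<lambda>l. node (\<xi> l) (k l)"
  shows "sfac \<eta> (\<xi> i + \<eta>) 4 / sfac \<eta> (\<xi> i + \<omega> + \<eta>) 4
      * tau I (\<xi>(i := \<xi> i + 4 * \<eta>)) (k(i := k')) = tau I \<xi> k / Nstep K
    * (br (v i + of_nat K * \<eta>) * br (v i - \<xi> i)
       * (br (\<xi> i + of_nat (K + 1) * \<eta>) * br (\<xi> i + of_nat (K + 2) * \<eta>) * br (\<xi> i + of_nat (K + 3) * \<eta>))
       / D (v i) (- of_nat (Suc K) * \<eta>))
    * (\<Prod>l\<in>I - {i}. br (v l + of_nat K * \<eta>) / (D (v l) (- of_nat (Suc K) * \<eta>) * br (\<xi> l + of_nat K * \<eta>))
        * (br (\<xi> i + \<xi> l + (\<eta> + \<omega>)) * br (\<xi> i - v l)))"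
proof -
  let ?t = "\<lambda>l. br (v l + of_nat K * \<eta>) / (D (v l) (- of_nat (Suc K) * \<eta>) * br (\<xi> l + of_nat K * \<eta>))
        * (br (\<xi> i + \<xi> l + (\<eta> + \<omega>)) * br (\<xi> i - v l))"
  let ?s = "br (v i + of_nat K * \<eta>) * br (v i - \<xi> i)
       * (br (\<xi> i + of_nat (K + 1) * \<eta>) * br (\<xi> i + of_nat (K + 2) * \<eta>) * br (\<xi> i + of_nat (K + 3) * \<eta>))
       / D (v i) (- of_nat (Suc K) * \<eta>)"
  note K' = sum_fun_upd_pred[OF I k]
  have gi: "br (\<xi> i + of_int m * \<eta>) \<noteq> 0" "br (\<xi> i + \<omega> + of_int m * \<eta>) \<noteq> 0" for m
    by (rule genericD[OF g I(2)])+
  let ?c = "sfac \<eta> (\<xi> i + \<eta>) 4 / sfac \<eta> (\<xi> i + \<omega> + \<eta>) 4"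
  have 1: "?c * Sfac (\<xi> i + 4 * \<eta>) k' K = Sfac (\<xi> i) (k i) (Suc K) *
      ?s"
    unfolding v_def k(1)
    by (rule Sfac_shift[OF _ gi]) (intro generic_node[OF g I(2)])
  have 2: "Sfac (\<xi> l) (k l) K * Efac (\<xi> i + 4 * \<eta>) (\<xi> l) k' (k l)
    = Sfac (\<xi> l) (k l) (Suc K) * Efac (\<xi> i) (\<xi> l) (k i) (k l)
     * ?t l"
    if l: "l \<in> I - {i}" for l
  proof -
    have l': "l \<in> I" "i \<noteq> l" using l by auto
    have "Sfac (\<xi> l) (k l) K = Sfac (\<xi> l) (k l) (Suc K)
      * (br (v l + of_nat K * \<eta>) / (D (v l) (- of_nat (Suc K) * \<eta>) * br (\<xi> l + of_nat K * \<eta>)))"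
      unfolding v_def by (rule Sfac_same) (intro generic_node[OF g l'(1)])+
    moreover have "Efac (\<xi> i + 4 * \<eta>) (\<xi> l) k' (k l) = Efac (\<xi> i) (\<xi> l) (k i) (k l)
      * (br (\<xi> i + \<xi> l + (\<eta> + \<omega>)) * br (\<xi> i - v l))"
      unfolding v_def k(1) by (rule Efac_shift) (intro generic_node[OF g I(2)] l')+
    ultimately show ?thesis by (simp add: mult_ac)
  qed
  let ?x = "\<xi>(i := \<xi> i + 4 * \<eta>)"
  have 3: "(\<Prod>(j, l)\<in>ordered_pairs (I - {i}). Efac (?x j) (?x l) ((k(i := k')) j) ((k(i := k')) l))
    = (\<Prod>(j, l)\<in>ordered_pairs (I - {i}). Efac (\<xi> j) (\<xi> l) (k j) (k l))"
    by (rule prod.cong) (auto simp: ordered_pairs_def)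
  have 4: "(\<Prod>l\<in>I - {i}. Sfac (?x l) ((k(i := k')) l) K * Efac (\<xi> i + 4 * \<eta>) (?x l) k' ((k(i := k')) l))
    = (\<Prod>l\<in>I - {i}. Sfac (\<xi> l) (k l) (Suc K) * Efac (\<xi> i) (\<xi> l) (k i) (k l)
     * ?t l)"
    by (rule prod.cong[OF refl]) (subst 2[symmetric], auto)
  have "?c * tau I ?x (k(i := k')) = Nfac K * (?c * Sfac (\<xi> i + 4 * \<eta>) k' K)
    * (\<Prod>l\<in>I - {i}. Sfac (?x l) ((k(i := k')) l) K * Efac (\<xi> i + 4 * \<eta>) (?x l) k' ((k(i := k')) l))
    * (\<Prod>(j, l)\<in>ordered_pairs (I - {i}). Efac (\<xi> j) (\<xi> l) (k j) (k l))"
    unfolding tau_split[OF I] K' 3 fun_upd_same by (simp add: mult_ac)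
  also have "\<dots> = tau I \<xi> k / Nstep K
    * ?s
    * (\<Prod>l\<in>I - {i}. ?t l)"
    unfolding 4 1 unfolding tau_split[OF I] k(2) Nfac_Suc prod.distrib using Nstep_nonzero[of K] by simp
  finally show ?thesis .
qed

end

section \<open>The recursion of the coefficients\<close>

context quartic_bracket
begin

context
  fixes I :: "nat set" and \<xi> :: "nat \<Rightarrow> complex" and k :: "nat \<Rightarrow> nat" and c K :: nat
  assumes I: "finite I" "c \<in> I" and g: "generic I \<xi>" and kc: "0 < k c" and K: "sum k I = Suc K"
begin

definition vtx :: "nat \<Rightarrow> complex" where
  "vtx l = node (\<xi> l) (k l)"

text \<open>With \<open>tau I \<xi> k\<close> the common factor of all terms of the recursion; once
  it is divided out, a pure partial fraction identity remains.\<close>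

definition weier_ratio :: "complex" where
  "weier_ratio = (\<Prod>l\<in>I. D (\<xi> c) (vtx l) / D (vtx l) (- of_nat (Suc K) * \<eta>))"

text \<open>The brackets with \<open>K + 2\<close> and \<open>K + 1\<close> come from the change of
  \<open>gfac\<close> in \<open>tau_low\<close>; its third bracket, with \<open>K + 3\<close>,
  cancels against the kernel at \<open>- of_nat K * \<eta>\<close>. The bracket with
  \<open>K\<close> compensates a factor of \<open>D (vtx i) (- of_nat (Suc K) * \<eta>)\<close> in
  \<open>weier_ratio\<close>.\<close>

definition numer3 :: "complex \<Rightarrow> complex" where
  "numer3 z = br (z + \<omega> - of_nat (K + 2) * \<eta>) * br (z + \<omega> - of_nat (K + 1) * \<eta>) * br (z + \<omega> - of_nat K * \<eta>)"

text \<open>The residues at \<open>vtx i\<close> of an elliptic function whose remaining poles, at \<open>-K\<eta>\<close> and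
  \<open>-(\<eta> + \<omega>) - \<xi> c\<close>, yield the left-hand side and the shifted term of the recursion.\<close>

definition residue :: "nat \<Rightarrow> complex" where
  "residue i = numer3 (vtx i) * (\<Prod>l\<in>I - {c}. br (vtx i - \<xi> l))
    / (br (vtx i + of_nat K * \<eta>) * br (vtx i + \<xi> c + (\<eta> + \<omega>)) * (\<Prod>l\<in>I - {i}. br (vtx i - vtx l)))"

text \<open>Divided by \<open>tau I \<xi> k * weier_ratio\<close>, the term lowered at
  \<open>i\<close> becomes \<open>- residue_coeff * residue i\<close> and the shifted term becomes
  \<open>shift_coeff\<close>.\<close>

definition residue_coeff :: complex where
  "residue_coeff = D (\<xi> c) (- of_nat K * \<eta>) / Nstep K
    * ((\<Prod>l\<in>I. br (vtx l + of_nat K * \<eta>)) / (\<Prod>l\<in>I. br (\<xi> l + of_nat K * \<eta>)))"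

definition shift_coeff :: complex where
  "shift_coeff = - (\<Prod>l\<in>I. br (vtx l + of_nat K * \<eta>)) / (\<Prod>l\<in>I - {c}. br (\<xi> l + of_nat K * \<eta>))
    * (br (\<xi> c + of_nat (K + 1) * \<eta>) * br (\<xi> c + of_nat (K + 2) * \<eta>) * br (\<xi> c + of_nat (K + 3) * \<eta>))
    * (\<Prod>l\<in>I - {c}. br (\<xi> c + \<xi> l + (\<eta> + \<omega>))) / (\<Prod>l\<in>I. br (\<xi> c + vtx l + (\<eta> + \<omega>))) / Nstep K"

lemma vtx_xi_nonzero:
  assumes "l \<in> I"
  shows "br (vtx l - \<xi> c) \<noteq> 0"
proof (cases "l = c")
  case True
  then show ?thesis using generic_node(13)[OF g I(2) kc] by (simp add: vtx_def)
next
  case False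
  then show ?thesis using generic_node(8)[OF g assms I(2)] by (simp add: vtx_def)
qed

lemma D_xi_vtx_nonzero: "l \<in> I \<Longrightarrow> D (\<xi> c) (vtx l) \<noteq> 0"
  using vtx_xi_nonzero[of l] br_swap[of "\<xi> c" "vtx l"] generic_node(5)[OF g I(2), of l "k l"]
  by (simp add: weier_def vtx_def)

lemma D_vtx_neg: "D (vtx l) (- of_nat (Suc K) * \<eta>)
    = br (vtx l + of_nat (Suc K) * \<eta>) * br (vtx l + \<omega> - of_nat K * \<eta>)"
  unfolding weier_def by (simp add: algebra_simps)

lemma D_vtx_neg_nonzero: "l \<in> I \<Longrightarrow> D (vtx l) (- of_nat (Suc K) * \<eta>) \<noteq> 0"
  using generic_node(1)[OF g, of l "k l" "Suc K"] generic_node(2)[OF g, of l "k l" K] unfolding D_vtx_neg unfolding vtx_def by simp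

lemma low_term:
  assumes i: "i \<in> I" and ki: "k i = Suc k'"
  shows "tau I \<xi> (k(i := k')) * (\<Prod>l\<in>I - {i}. D (\<xi> c) (vtx l) / D (node (\<xi> i) k') (vtx l))
      * (D (\<xi> c) (- of_nat K * \<eta>) / D (node (\<xi> i) k') (- of_nat K * \<eta>))
    = - (tau I \<xi> k * weier_ratio * residue_coeff * residue i)"
proof -
  let ?w = "node (\<xi> i) k'"
  define a where "a l = br (vtx l + of_nat K * \<eta>)" for l
  define x where "x l = br (\<xi> l + of_nat K * \<eta>)" for l
  define d where "d l = D (vtx l) (- of_nat (Suc K) * \<eta>)" for l
  define d0 where "d0 l = D (\<xi> c) (vtx l)" for l
  define y where "y l = br (vtx i - \<xi> l)" for l
  define z where "z l = br (vtx i - vtx l)" for l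
  have w: "D ?w (- of_nat K * \<eta>) = br (?w + of_nat K * \<eta>) * br (vtx i + \<omega> - of_nat (K + 3) * \<eta>)"
    unfolding weier_def vtx_def ki node_def by (simp add: algebra_simps)
  have nz: "a l \<noteq> 0" "x l \<noteq> 0" "d l \<noteq> 0" "d0 l \<noteq> 0" if "l \<in> I" for l
    using generic_node(1,12)[OF g that] D_xi_vtx_nonzero[OF that] D_vtx_neg_nonzero[OF that]
    unfolding a_def x_def d_def d0_def by (auto simp: vtx_def)
  have D': "D ?w (vtx l) \<noteq> 0" "z l \<noteq> 0" if "l \<in> I - {i}" for l
    using that generic_node(3,7)[OF g i, of l] unfolding weier_def vtx_def z_def by auto
  have nzw: "br (?w + of_nat K * \<eta>) \<noteq> 0" "br (vtx i + \<omega> - of_nat (K + 3) * \<eta>) \<noteq> 0"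
    "br (vtx i + of_nat (Suc K) * \<eta>) \<noteq> 0" "br (vtx i + \<omega> - of_nat K * \<eta>) \<noteq> 0"
    unfolding vtx_def by (intro generic_node[OF g i])+
  have "(\<Prod>l\<in>I - {i}. a l / (d l * x l) * (D ?w (vtx l) * y l / z l)) * (\<Prod>l\<in>I - {i}. d0 l / D ?w (vtx l))
    = (\<Prod>l\<in>I - {i}. d0 l / d l * (a l / x l) * (y l / z l))"
    unfolding prod.distrib[symmetric] using D' by (intro prod.cong refl) (simp add: divide_simps)
  also have "\<dots> = (\<Prod>l\<in>I - {i}. d0 l / d l) * (prod a (I - {i}) / prod x (I - {i}))
      * (prod y (I - {i}) / prod z (I - {i}))"
    by (simp only: prod.distrib prod_dividef)
  finally have p: "(\<Prod>l\<in>I - {i}. a l / (d l * x l) * (D ?w (vtx l) * y l / z l)) * (\<Prod>l\<in>I - {i}. d0 l / D ?w (vtx l))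
     = (\<Prod>l\<in>I - {i}. d0 l / d l) * (prod a (I - {i}) / prod x (I - {i}))
      * (prod y (I - {i}) / prod z (I - {i}))" .
  have r: "weier_ratio = d0 i / d i * (\<Prod>l\<in>I - {i}. d0 l / d l)"
    "prod a I = a i * prod a (I - {i})" "prod x I = x i * prod x (I - {i})"
    "prod y I = y i * prod y (I - {i})"
    unfolding weier_ratio_def d0_def[symmetric] d_def[symmetric] by (rule prod.remove[OF I(1) i])+
  have y: "prod y I = y c * prod y (I - {c})" by (rule prod.remove[OF I(1,2)])
  \<comment> \<open>The factor \<open>y c\<close> omitted from the product in \<open>residue\<close>
    and the factor of the pole at \<open>- (\<eta> + \<omega>) - \<xi> c\<close> together make up
    the kernel \<open>d0 i\<close>, up to sign.\<close>
  have yc: "d0 i = - y c * br (vtx i + \<xi> c + (\<eta> + \<omega>))"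
    unfolding d0_def y_def weier_def by (subst br_swap) (simp add: add.commute)
  have nyc: "y c \<noteq> 0" "br (vtx i + \<xi> c + (\<eta> + \<omega>)) \<noteq> 0"
    using yc nz(4)[OF i] by auto
  have residue: "residue i = - (numer3 (vtx i) * prod y I / (a i * d0 i * prod z (I - {i})))"
    unfolding residue_def y y_def[symmetric] z_def[symmetric] a_def[symmetric] yc using nyc by simp
  let ?s = "br (?w + of_nat K * \<eta>) * y i
       * (br (vtx i + \<omega> - of_nat (K + 3) * \<eta>) * br (vtx i + \<omega> - of_nat (K + 2) * \<eta>)
          * br (vtx i + \<omega> - of_nat (K + 1) * \<eta>))
       / (br (vtx i + of_nat (Suc K) * \<eta>) * x i)"
  have "tau I \<xi> (k(i := k')) * (\<Prod>l\<in>I - {i}. d0 l / D ?w (vtx l))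
     = tau I \<xi> k / Nstep K * ?s *
       ((\<Prod>l\<in>I - {i}. a l / (d l * x l) * (D ?w (vtx l) * y l / z l)) * (\<Prod>l\<in>I - {i}. d0 l / D ?w (vtx l)))"
    unfolding tau_low[OF I(1) i g ki K] vtx_def[symmetric] a_def x_def d_def y_def z_def by (simp only: mult_ac)
  then have "tau I \<xi> (k(i := k')) * (\<Prod>l\<in>I - {i}. d0 l / D ?w (vtx l)) * (D (\<xi> c) (- of_nat K * \<eta>) / D ?w (- of_nat K * \<eta>))
     = tau I \<xi> k / Nstep K * ?s *
       ((\<Prod>l\<in>I - {i}. d0 l / d l) * (prod a (I - {i}) / prod x (I - {i}))
      * (prod y (I - {i}) / prod z (I - {i})))
      * (D (\<xi> c) (- of_nat K * \<eta>) / (br (?w + of_nat K * \<eta>) * br (vtx i + \<omega> - of_nat (K + 3) * \<eta>)))"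
    unfolding p w by simp
  also have "\<dots> = tau I \<xi> k * (\<Prod>l\<in>I - {i}. d0 l / d l) * (D (\<xi> c) (- of_nat K * \<eta>) / Nstep K)
     * ((br (vtx i + \<omega> - of_nat (K + 2) * \<eta>)
          * br (vtx i + \<omega> - of_nat (K + 1) * \<eta>)) / (br (vtx i + of_nat (Suc K) * \<eta>)))
     * (y i * prod y (I - {i}) / prod z (I - {i})) * (prod a (I - {i}) / (x i * prod x (I - {i})))"
    using nzw by (simp add: mult_ac)
  also have "\<dots> = - (tau I \<xi> k * weier_ratio * residue_coeff * residue i)"
    unfolding residue residue_coeff_def a_def[symmetric] x_def[symmetric] r numer3_def
    unfolding d_def[of i, unfolded D_vtx_neg] using nzw nz(1,2,4)[OF i]
    by (simp add: divide_simps)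
  finally show ?thesis unfolding d0_def .
qed

lemma shift_term:
  assumes kc': "k c = Suc k'"
  shows "sfac \<eta> (\<xi> c + \<eta>) 4 / sfac \<eta> (\<xi> c + \<omega> + \<eta>) 4
      * tau I (\<xi>(c := \<xi> c + 4 * \<eta>)) (k(c := k')) = tau I \<xi> k * weier_ratio * shift_coeff"
proof -
  define a where "a l = br (vtx l + of_nat K * \<eta>)" for l
  define x where "x l = br (\<xi> l + of_nat K * \<eta>)" for l
  define d where "d l = D (vtx l) (- of_nat (Suc K) * \<eta>)" for l
  define d0 where "d0 l = D (\<xi> c) (vtx l)" for l
  define e where "e l = br (\<xi> c + \<xi> l + (\<eta> + \<omega>))" for l
  define h where "h l = br (\<xi> c + vtx l + (\<eta> + \<omega>))" for l
  have nz: "a l \<noteq> 0" "x l \<noteq> 0" "d l \<noteq> 0" "d0 l \<noteq> 0" if "l \<in> I" for l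
    using generic_node(1,12)[OF g that] D_xi_vtx_nonzero[OF that] D_vtx_neg_nonzero[OF that]
    unfolding a_def x_def d_def d0_def by (auto simp: vtx_def)
  have d0: "d0 l = br (\<xi> c - vtx l) * h l" for l
    unfolding d0_def weier_def h_def ..
  have nh: "h l \<noteq> 0" "br (\<xi> c - vtx l) \<noteq> 0" if "l \<in> I" for l
    using nz(4)[OF that] unfolding d0 by auto
  have "(\<Prod>l\<in>I - {c}. a l / (d l * x l) * (e l * br (\<xi> c - vtx l)))
      = (\<Prod>l\<in>I - {c}. d0 l / d l * (a l / x l) * (e l / h l))"
    unfolding d0 using nh by (intro prod.cong refl) (simp add: divide_simps)
  also have "\<dots> = (\<Prod>l\<in>I - {c}. d0 l / d l) * (prod a (I - {c}) / prod x (I - {c}))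
      * (prod e (I - {c}) / prod h (I - {c}))"
    by (simp only: prod.distrib prod_dividef)
  finally have p: "(\<Prod>l\<in>I - {c}. a l / (d l * x l) * (e l * br (\<xi> c - vtx l)))
     = (\<Prod>l\<in>I - {c}. d0 l / d l) * (prod a (I - {c}) / prod x (I - {c}))
      * (prod e (I - {c}) / prod h (I - {c}))" .
  have r: "weier_ratio = d0 c / d c * (\<Prod>l\<in>I - {c}. d0 l / d l)"
    "prod a I = a c * prod a (I - {c})" "prod h I = h c * prod h (I - {c})"
    unfolding weier_ratio_def d0_def[symmetric] d_def[symmetric] by (rule prod.remove[OF I(1,2)])+
  have sw: "br (vtx c - \<xi> c) = - br (\<xi> c - vtx c)" by (rule br_swap)
  show ?thesis
    unfolding tau_shift[OF I g kc' K] vtx_def[symmetric] a_def[symmetric] x_def[symmetric]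
      d_def[symmetric] e_def[symmetric] p r shift_coeff_def h_def[symmetric] sw d0[of c]
    using nh[OF I(2)] nz[OF I(2)] by (simp add: mult_ac)
qed

text \<open>Elliptic partial fractions with the nodes \<open>vtx i\<close>,
  \<open>- of_nat K * \<eta>\<close> and \<open>- (\<eta> + \<omega>) - \<xi> c\<close>. At the
  first extra node the three special brackets become \<open>Nstep K\<close>, which yields the term
  1; at the second they become the three brackets in \<open>shift_coeff\<close>. Balancing holds
  because the \<open>k i\<close> add up to \<open>Suc K\<close>.\<close>

lemma residue_sum: "residue_coeff * (\<Sum>i\<in>I. residue i) = 1 - shift_coeff"
proof -
  define J :: "(nat + nat) set" where "J = insert (Inr 0) (insert (Inr 1) (insert (Inr 2) (Inl ` (I - {c}))))"
  \<comment> \<open>The zeros of the numerator. The last one is placed at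
    \<open>of_nat K * \<eta> + \<omega>\<close> and not at
    \<open>of_nat K * \<eta> - \<omega>\<close>: this is a move by the antiperiod
    \<open>2 * \<omega>\<close>, which costs a sign and makes the zeros balance the nodes.\<close>
  define al :: "nat + nat \<Rightarrow> complex" where "al = case_sum \<xi> (\<lambda>t. if t = 0 then of_nat (K + 2) * \<eta> - \<omega>
     else if t = 1 then of_nat (K + 1) * \<eta> - \<omega> else of_nat K * \<eta> + \<omega>)"
  let ?b = "- of_nat K * \<eta>"
  let ?s = "- (\<eta> + \<omega>) - \<xi> c"
  have num: "(\<Prod>j\<in>J. br (z - al j)) = - (numer3 z * (\<Prod>l\<in>I - {c}. br (z - \<xi> l)))" for z
  proof -
    have "br (z - (of_nat K * \<eta> + \<omega>)) = - br (z + \<omega> - of_nat K * \<eta>)"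
      using br_shift[of "z - of_nat K * \<eta> - \<omega>"] by (simp add: algebra_simps)
    then show ?thesis
      unfolding J_def using I by (simp add: prod.reindex image_iff al_def numer3_def algebra_simps)
  qed
  have cI: "card I = Suc (card (I - {c}))" by (rule card.remove[OF I])
  have sv: "(\<Sum>i\<in>I. vtx i) = \<xi> c + (\<Sum>i\<in>I - {c}. \<xi> i) + 4 * of_nat (Suc K) * \<eta>"
    unfolding K[symmetric] vtx_def node_def sum.distrib of_nat_sum sum_distrib_left sum_distrib_right
    using sum.remove[OF I, of \<xi>] by simp
  have nzb: "br (\<xi> c + \<omega> + \<eta> - of_nat K * \<eta>) \<noteq> 0"
    using genericD(2)[OF g I(2), of "1 - int K"] by (simp add: algebra_simps)
  have pf: "(\<Sum>i\<in>I. (\<Prod>j\<in>J. br (vtx i - al j))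
        / (br (vtx i - ?b) * br (vtx i - ?s) * (\<Prod>j\<in>I - {i}. br (vtx i - vtx j))))
      + (\<Prod>j\<in>J. br (?b - al j)) / (br (?b - ?s) * (\<Prod>j\<in>I. br (?b - vtx j)))
      + (\<Prod>j\<in>J. br (?s - al j)) / (br (?s - ?b) * (\<Prod>j\<in>I. br (?s - vtx j))) = 0"
  proof (rule bracket_partial_fractions_2)
    show "finite J" unfolding J_def using I by simp
    show "card J = card I + 2" unfolding J_def cI using I by (simp add: card_image image_iff)
    show "(\<Sum>i\<in>I. vtx i) + ?b + ?s = sum al J"
      unfolding sv J_def al_def using I by (simp add: sum.reindex image_iff algebra_simps)
    show "br (vtx i - vtx j) \<noteq> 0" if "i \<in> I" "j \<in> I" "i \<noteq> j" for i j
      unfolding vtx_def by (rule generic_node(7)[OF g that])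
    show "br (vtx i - ?b) \<noteq> 0" if "i \<in> I" for i
      using generic_node(1)[OF g that, of "k i" K] by (simp add: vtx_def)
    show "br (vtx i - ?s) \<noteq> 0" if "i \<in> I" for i
      using generic_node(4)[OF g that I(2), of "k i"] by (simp add: vtx_def algebra_simps)
    show "br (?b - ?s) \<noteq> 0" using nzb by (simp add: algebra_simps)
  qed (rule I)
  define a where "a l = br (vtx l + of_nat K * \<eta>)" for l
  define x where "x l = br (\<xi> l + of_nat K * \<eta>)" for l
  define e where "e l = br (\<xi> c + \<xi> l + (\<eta> + \<omega>))" for l
  define h where "h l = br (\<xi> c + vtx l + (\<eta> + \<omega>))" for l
  define m where "m = (- 1 :: complex) ^ card (I - {c})"
  have m: "m \<noteq> 0" "(-1) ^ card I = - m" unfolding m_def cI by simp_all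
  define F1 where "F1 = br (\<xi> c + of_nat (K + 1) * \<eta>) * br (\<xi> c + of_nat (K + 2) * \<eta>) * br (\<xi> c + of_nat (K + 3) * \<eta>)"
  define q where "q = br (\<xi> c + \<omega> + \<eta> - of_nat K * \<eta>)"
  have neg: "br (- z) = - br z" for z by (rule br_minus)
  have sA: "(\<Sum>i\<in>I. (\<Prod>j\<in>J. br (vtx i - al j))
        / (br (vtx i - ?b) * br (vtx i - ?s) * (\<Prod>j\<in>I - {i}. br (vtx i - vtx j)))) = - (\<Sum>i\<in>I. residue i)"
    unfolding num residue_def sum_negf[symmetric] by (simp add: algebra_simps)
  have sB: "(\<Prod>j\<in>J. br (?b - al j)) / (br (?b - ?s) * (\<Prod>j\<in>I. br (?b - vtx j)))
     = Nstep K * prod x (I - {c}) / (q * prod a I)"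
  proof -
    \<comment> \<open>Oddness and antiperiodicity together make the bracket symmetric about
      \<open>\<omega>\<close>; this turns the negative multiples of \<open>\<eta>\<close> into those
      of \<open>Nstep K\<close>.\<close>
    have refl3: "br (\<omega> - u) = br (\<omega> + u)" for u
      using br_shift[of "- \<omega> - u"] br_minus[of "\<omega> + u"] by (simp add: algebra_simps)
    have "numer3 ?b = br (\<omega> - of_nat (2 * K + 2) * \<eta>) * br (\<omega> - of_nat (2 * K + 1) * \<eta>) * br (\<omega> - of_nat (2 * K) * \<eta>)"
      unfolding numer3_def by (simp add: algebra_simps)
    then have "numer3 ?b = Nstep K" unfolding refl3 Nstep_def by (simp only: mult_ac)
    moreover have b: "br (?b - u) = - 1 * br (u + of_nat K * \<eta>)" for u
      unfolding mult_minus1 neg[symmetric] by (rule arg_cong[of _ _ br]) simp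
    have "(\<Prod>l\<in>I - {c}. br (?b - \<xi> l)) = m * prod x (I - {c})"
      unfolding b m_def x_def prod.distrib by simp
    moreover have "(\<Prod>l\<in>I. br (?b - vtx l)) = - m * prod a I"
      unfolding b m(2)[symmetric] a_def prod.distrib by simp
    moreover have "br (?b - ?s) = q" unfolding q_def by (simp add: algebra_simps)
    ultimately show ?thesis unfolding num using m by simp
  qed
  have sC: "(\<Prod>j\<in>J. br (?s - al j)) / (br (?s - ?b) * (\<Prod>j\<in>I. br (?s - vtx j)))
     = F1 * prod e (I - {c}) / (q * prod h I)"
  proof -
    have st: "br (?s + \<omega> - of_nat n * \<eta>) = - br (\<xi> c + of_nat (n + 1) * \<eta>)" for n
      unfolding neg[symmetric] by (simp add: algebra_simps)
    have "numer3 ?s = - F1" unfolding numer3_def F1_def st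
      by (simp add: numeral_3_eq_3 mult_ac del: of_nat_add of_nat_Suc)
    moreover have b: "br (?s - u) = - 1 * br (\<xi> c + u + (\<eta> + \<omega>))" for u
      unfolding mult_minus1 neg[symmetric] by (rule arg_cong[of _ _ br]) simp
    have "(\<Prod>l\<in>I - {c}. br (?s - \<xi> l)) = m * prod e (I - {c})"
      unfolding b m_def e_def prod.distrib by simp
    moreover have "(\<Prod>l\<in>I. br (?s - vtx l)) = - m * prod h I"
      unfolding b m(2)[symmetric] h_def prod.distrib by simp
    moreover have "br (?s - ?b) = - q" unfolding q_def neg[symmetric] by (simp add: algebra_simps)
    ultimately show ?thesis unfolding num using m by simp
  qed
  have "- s + b + d = 0 \<Longrightarrow> s = b + d" for s b d :: complex by algebra
  then have sr: "(\<Sum>i\<in>I. residue i) = Nstep K * prod x (I - {c}) / (q * prod a I) + F1 * prod e (I - {c}) / (q * prod h I)"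
    using pf unfolding sA sB sC by blast
  have nz: "prod a I \<noteq> 0" "prod x (I - {c}) \<noteq> 0" "x c \<noteq> 0" "prod h I \<noteq> 0" "q \<noteq> 0" "Nstep K \<noteq> 0"
  proof -
    show "prod a I \<noteq> 0" "prod x (I - {c}) \<noteq> 0" "x c \<noteq> 0" "prod h I \<noteq> 0"
      using I generic_node(1,12)[OF g] generic_node(5)[OF g I(2)]
      by (auto simp: a_def x_def h_def vtx_def)
    show "q \<noteq> 0" "Nstep K \<noteq> 0" using nzb Nstep_nonzero by (auto simp: q_def)
  qed
  have px: "prod x I = x c * prod x (I - {c})" by (rule prod.remove[OF I])
  have Dq: "D (\<xi> c) ?b = x c * q" unfolding weier_def x_def q_def by (simp add: algebra_simps)
  show ?thesis
    unfolding residue_coeff_def shift_coeff_def a_def[symmetric] x_def[symmetric] e_def[symmetric] h_def[symmetric]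
      F1_def[symmetric] sr px Dq using nz by (simp add: divide_simps)
qed

lemma tau_recursion:
  "tau I \<xi> k * (\<Prod>l\<in>I. D (\<xi> c) (node (\<xi> l) (k l)) / D (node (\<xi> l) (k l)) (- of_nat (Suc K) * \<eta>))
   = sfac \<eta> (\<xi> c + \<eta>) 4 / sfac \<eta> (\<xi> c + \<omega> + \<eta>) 4
      * tau I (\<xi>(c := \<xi> c + 4 * \<eta>)) (k(c := k c - 1))
    - (\<Sum>i\<in>{i \<in> I. 0 < k i}. tau I \<xi> (k(i := k i - 1))
        * (\<Prod>l\<in>I - {i}. D (\<xi> c) (node (\<xi> l) (k l)) / D (node (\<xi> i) (k i - 1)) (node (\<xi> l) (k l)))
        * (D (\<xi> c) (- of_nat K * \<eta>) / D (node (\<xi> i) (k i - 1)) (- of_nat K * \<eta>)))"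
proof -
  let ?S = "(\<Sum>i\<in>{i \<in> I. 0 < k i}. tau I \<xi> (k(i := k i - 1))
        * (\<Prod>l\<in>I - {i}. D (\<xi> c) (vtx l) / D (node (\<xi> i) (k i - 1)) (vtx l))
        * (D (\<xi> c) (- of_nat K * \<eta>) / D (node (\<xi> i) (k i - 1)) (- of_nat K * \<eta>)))"
  let ?R = "\<lambda>i. - (tau I \<xi> k * weier_ratio * residue_coeff * residue i)"
  have "?S
     = (\<Sum>i\<in>{i \<in> I. 0 < k i}. ?R i)"
    by (intro sum.cong refl low_term) auto
  also have "\<dots> = (\<Sum>i\<in>I. ?R i)"
  proof (rule sum.mono_neutral_left[OF I(1)])
    \<comment> \<open>At \<open>k i = 0\<close> the node \<open>vtx i\<close> is still
      \<open>\<xi> i\<close>, which is a zero of the numerator because \<open>i \<noteq> c\<close>.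
      So the sum over positive \<open>k i\<close> extends to all of \<open>I\<close>.\<close>
    show "\<forall>i\<in>I - {i \<in> I. 0 < k i}. ?R i = 0"
    proof
      fix i assume i: "i \<in> I - {i \<in> I. 0 < k i}"
      then have "i \<in> I - {c}" "vtx i = \<xi> i" using kc by (auto simp: vtx_def node_def)
      then have "(\<Prod>l\<in>I - {c}. br (vtx i - \<xi> l)) = 0"
        using I by (intro prod_zero) (auto intro!: bexI[of _ i])
      then show "?R i = 0" unfolding residue_def by simp
    qed
  qed auto
  also have "\<dots> = - (tau I \<xi> k * weier_ratio * (residue_coeff * (\<Sum>i\<in>I. residue i)))"
    by (simp add: sum_negf sum_distrib_left mult.assoc)
  finally have s: "?S
     = - (tau I \<xi> k * weier_ratio * (1 - shift_coeff))" unfolding residue_sum .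
  have t: "sfac \<eta> (\<xi> c + \<eta>) 4 / sfac \<eta> (\<xi> c + \<omega> + \<eta>) 4
      * tau I (\<xi>(c := \<xi> c + 4 * \<eta>)) (k(c := k c - 1)) = tau I \<xi> k * weier_ratio * shift_coeff"
    using kc by (intro shift_term) simp
  show ?thesis
    unfolding vtx_def[symmetric] s t weier_ratio_def[symmetric] by (simp add: algebra_simps)
qed

end

end

section \<open>Telescoping\<close>

context quartic_bracket
begin

text \<open>With \<open>x\<close> the upper end of an index \<open>b\<close>, this collects the
  numerators of the double product at all pairs \<open>(i, b)\<close>.\<close>

definition chain :: "nat set \<Rightarrow> (nat \<Rightarrow> complex) \<Rightarrow> (nat \<Rightarrow> nat) \<Rightarrow> complex \<Rightarrow> complex" where
  "chain I \<xi> k x = (\<Prod>j\<in>I. \<Prod>m<k j. D (node (\<xi> j) m) x)"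

text \<open>The part of the summand that contains the upper ends, which enter through
  \<open>X\<close> only. \<open>X\<close> is a parameter separate from \<open>\<xi>\<close> so that
  it can stay fixed while \<open>\<xi>\<close> is shifted.\<close>

definition phi :: "nat set \<Rightarrow> (nat \<Rightarrow> complex) \<Rightarrow> (nat \<Rightarrow> complex) \<Rightarrow> (nat \<Rightarrow> nat) \<Rightarrow> complex" where
  "phi I X \<xi> k = (\<Prod>a\<in>I. chain I \<xi> k (X a) / (\<Prod>m<sum k I. D (X a) (- of_nat (Suc m) * \<eta>)))"

lemma chain_low:
  assumes I: "finite I" "i \<in> I" and k: "k i = Suc k'"
  shows "chain I \<xi> k x = chain I \<xi> (k(i := k')) x * D (node (\<xi> i) k') x"
proof -
  have "(\<Prod>j\<in>I - {i}. \<Prod>m<(k(i := k')) j. D (node (\<xi> j) m) x) = (\<Prod>j\<in>I - {i}. \<Prod>m<k j. D (node (\<xi> j) m) x)"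
    by (intro prod.cong) auto
  then show ?thesis
    unfolding chain_def prod.remove[OF I] by (simp add: k)
qed

text \<open>The shifted chain starts one node later, so the factor at \<open>m = 0\<close>
  disappears, whereas in \<open>chain_low\<close> it is the last factor that does.\<close>

lemma chain_shift:
  assumes I: "finite I" "i \<in> I" and k: "k i = Suc k'"
  shows "chain I \<xi> k x = chain I (\<xi>(i := \<xi> i + 4 * \<eta>)) (k(i := k')) x * D (\<xi> i) x"
proof -
  have "(\<Prod>j\<in>I - {i}. \<Prod>m<(k(i := k')) j. D (node ((\<xi>(i := \<xi> i + 4 * \<eta>)) j) m) x)
      = (\<Prod>j\<in>I - {i}. \<Prod>m<k j. D (node (\<xi> j) m) x)"
    by (intro prod.cong) auto
  moreover have "node (\<xi> i + 4 * \<eta>) m = node (\<xi> i) (Suc m)" "node (\<xi> i) 0 = \<xi> i" for m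
    by (simp_all add: node_def algebra_simps)
  ultimately show ?thesis
    unfolding chain_def prod.remove[OF I] by (simp add: k prod.lessThan_Suc_shift del: prod.lessThan_Suc)
qed

lemma phi_low:
  assumes I: "finite I" "i \<in> I" and k: "k i = Suc k'" "sum k I = Suc K"
  shows "phi I X \<xi> k = phi I X \<xi> (k(i := k'))
    * (\<Prod>a\<in>I. D (node (\<xi> i) k') (X a) / D (X a) (- of_nat (Suc K) * \<eta>))"
  unfolding phi_def sum_fun_upd_pred[OF I k] k(2) prod.distrib[symmetric]
  by (subst chain_low[where k = k and i = i, OF I k(1)]) simp

lemma phi_shift:
  assumes I: "finite I" "i \<in> I" and k: "k i = Suc k'" "sum k I = Suc K"
  shows "phi I X \<xi> k = phi I X (\<xi>(i := \<xi> i + 4 * \<eta>)) (k(i := k'))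
    * (\<Prod>a\<in>I. D (\<xi> i) (X a) / D (X a) (- of_nat (Suc K) * \<eta>))"
  unfolding phi_def sum_fun_upd_pred[OF I k] k(2) prod.distrib[symmetric]
  by (subst chain_shift[where k = k and i = i, OF I k(1)]) simp

lemma generic_shift:
  assumes "generic I \<xi>" "c \<in> I"
  shows "generic I (\<xi>(c := \<xi> c + 4 * \<eta>))"
proof -
  have 1: "br (\<xi> c + 4 * \<eta> + of_int m * \<eta>) \<noteq> 0" "br (\<xi> c + 4 * \<eta> + \<omega> + of_int m * \<eta>) \<noteq> 0"
    "j \<in> I \<Longrightarrow> br (\<xi> c + 4 * \<eta> + \<xi> j + \<omega> + of_int m * \<eta>) \<noteq> 0"
    "j \<in> I \<Longrightarrow> br (\<xi> j + (\<xi> c + 4 * \<eta>) + \<omega> + of_int m * \<eta>) \<noteq> 0"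
    "br (\<xi> c + 4 * \<eta> + (\<xi> c + 4 * \<eta>) + \<omega> + of_int m * \<eta>) \<noteq> 0"
    "j \<in> I \<Longrightarrow> c \<noteq> j \<Longrightarrow> br (\<xi> c + 4 * \<eta> - \<xi> j + of_int m * \<eta>) \<noteq> 0"
    "j \<in> I \<Longrightarrow> j \<noteq> c \<Longrightarrow> br (\<xi> j - (\<xi> c + 4 * \<eta>) + of_int m * \<eta>) \<noteq> 0" for m j
    using genericD(1,2)[OF assms, of "m + 4"] genericD(3)[OF assms, of j "m + 4"]
      genericD(3)[OF assms, of c "m + 8"] genericD(4)[OF assms, of j "m + 4"]
      genericD(4)[OF assms(1) _ assms(2), of j "m - 4"] assms(2)
    by (simp_all add: algebra_simps)
  show ?thesis
    using assms(1) 1 unfolding generic_def by (auto split: if_splits)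
qed

definition summand :: "nat set \<Rightarrow> (nat \<Rightarrow> complex) \<Rightarrow> (nat \<Rightarrow> complex) \<Rightarrow> (nat \<Rightarrow> nat) \<Rightarrow> complex" where
  "summand I X \<xi> k = tau I \<xi> k * phi I X \<xi> k"

text \<open>Certificates: interpolating at the nodes \<open>\<xi> i + 4 k i \<eta>\<close> and at \<open>-|k| \<eta>\<close> splits a summand into
  \<open>flux i\<close> and \<open>source\<close>; by the recursion of the coefficients, \<open>source\<close> is a summand with \<open>\<xi> c\<close> shifted
  minus the fluxes at the lower neighbours of \<open>k\<close>.\<close>

definition flux :: "nat set \<Rightarrow> nat \<Rightarrow> (nat \<Rightarrow> complex) \<Rightarrow> (nat \<Rightarrow> complex) \<Rightarrow> nat \<Rightarrow> (nat \<Rightarrow> nat) \<Rightarrow> complex" where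
  "flux I c X \<xi> i k = summand I X \<xi> k
    * (\<Prod>a\<in>I. D (X a) (node (\<xi> i) (k i)) / D (X a) (\<xi> c))
    * (\<Prod>l\<in>I - {i}. D (\<xi> c) (node (\<xi> l) (k l)) / D (node (\<xi> i) (k i)) (node (\<xi> l) (k l)))
    * (D (\<xi> c) (- of_nat (sum k I) * \<eta>) / D (node (\<xi> i) (k i)) (- of_nat (sum k I) * \<eta>))"

definition source :: "nat set \<Rightarrow> nat \<Rightarrow> (nat \<Rightarrow> complex) \<Rightarrow> (nat \<Rightarrow> complex) \<Rightarrow> (nat \<Rightarrow> nat) \<Rightarrow> complex" where
  "source I c X \<xi> k = summand I X \<xi> k
    * (\<Prod>a\<in>I. D (X a) (- of_nat (sum k I) * \<eta>) / D (X a) (\<xi> c))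
    * (\<Prod>l\<in>I. D (\<xi> c) (node (\<xi> l) (k l)) / D (- of_nat (sum k I) * \<eta>) (node (\<xi> l) (k l)))"

lemma D_node_neg_nonzero:
  assumes "generic I \<xi>" "i \<in> I"
  shows "D (node (\<xi> i) k) (- of_nat K * \<eta>) \<noteq> 0" "D (\<xi> i) (- of_nat K * \<eta>) \<noteq> 0"
  using genericD(1)[OF assms, of "4 * int k + int K"] genericD(2)[OF assms, of "4 * int k - int K + 1"]
    genericD(1)[OF assms, of "int K"] genericD(2)[OF assms, of "- int K + 1"]
  by (simp_all add: weier_def node_def algebra_simps)

lemma D_node_nonzero:
  assumes "generic I \<xi>" "i \<in> I" "j \<in> I"
  shows "i \<noteq> j \<Longrightarrow> D (node (\<xi> i) k) (node (\<xi> j) l) \<noteq> 0"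
    "i \<noteq> j \<or> 0 < k \<Longrightarrow> D (node (\<xi> i) k) (\<xi> j) \<noteq> 0"
    "i \<noteq> j \<or> 0 < k \<Longrightarrow> D (\<xi> j) (node (\<xi> i) k) \<noteq> 0"
proof -
  show "i \<noteq> j \<Longrightarrow> D (node (\<xi> i) k) (node (\<xi> j) l) \<noteq> 0"
    using generic_node(3,7)[OF assms] by (simp add: weier_def)
  show *: "i \<noteq> j \<or> 0 < k \<Longrightarrow> D (node (\<xi> i) k) (\<xi> j) \<noteq> 0"
    using generic_node(4,8)[OF assms] generic_node(13)[OF assms(1,2)] by (auto simp: weier_def)
  show "i \<noteq> j \<or> 0 < k \<Longrightarrow> D (\<xi> j) (node (\<xi> i) k) \<noteq> 0"
    using * weier_swap[of _ "\<xi> j"] by simp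
qed

context
  fixes I :: "nat set" and \<xi> :: "nat \<Rightarrow> complex" and n :: "nat \<Rightarrow> nat" and c n' :: nat
  assumes I: "finite I" "c \<in> I" and g: "generic I \<xi>" and nc: "n c = Suc n'"
begin

definition upper :: "nat \<Rightarrow> complex" where
  "upper a = node (\<xi> a) (n a)"

lemma D_upper_xi: "a \<in> I \<Longrightarrow> D (upper a) (\<xi> c) \<noteq> 0"
  unfolding upper_def using D_node_nonzero(2)[OF g _ I(2)] nc by auto

text \<open>Interpolation at the nodes \<open>node (\<xi> l) (k l)\<close>, at
  \<open>- of_nat (sum k I) * \<eta>\<close> and at \<open>\<xi> c\<close>, divided by the term of
  \<open>\<xi> c\<close>. For \<open>k c = 0\<close> two of these nodes coincide; then the flux in
  direction \<open>c\<close> is the whole summand and the other pieces vanish.\<close>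

lemma summand_split:
  "summand I upper \<xi> k = (\<Sum>i\<in>I. flux I c upper \<xi> i k) + source I c upper \<xi> k"
proof (cases "k c = 0")
  case True
  then have vc: "node (\<xi> c) (k c) = \<xi> c" by (simp add: node_def)
  have "flux I c upper \<xi> c k = summand I upper \<xi> k"
  proof -
    have "(\<Prod>l\<in>I - {c}. D (\<xi> c) (node (\<xi> l) (k l)) / D (\<xi> c) (node (\<xi> l) (k l))) = 1"
      by (rule prod.neutral) (use D_node_nonzero(3)[OF g _ I(2)] in auto)
    moreover have "(\<Prod>a\<in>I. D (upper a) (\<xi> c) / D (upper a) (\<xi> c)) = 1"
      by (rule prod.neutral) (use D_upper_xi in auto)
    ultimately show ?thesis
      unfolding flux_def vc using D_node_neg_nonzero(2)[OF g I(2), of "sum k I"] by (simp del: of_nat_sum)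
  qed
  moreover have "flux I c upper \<xi> i k = 0" if "i \<in> I - {c}" for i
  proof -
    have "(\<Prod>l\<in>I - {i}. D (\<xi> c) (node (\<xi> l) (k l)) / D (node (\<xi> i) (k i)) (node (\<xi> l) (k l))) = 0"
      using I that vc by (intro prod_zero) (auto intro!: bexI[of _ c])
    then show ?thesis unfolding flux_def by simp
  qed
  moreover have "source I c upper \<xi> k = 0"
  proof -
    have "(\<Prod>l\<in>I. D (\<xi> c) (node (\<xi> l) (k l)) / D (- of_nat (sum k I) * \<eta>) (node (\<xi> l) (k l))) = 0"
      using I vc by (intro prod_zero) (auto intro!: bexI[of _ c])
    then show ?thesis unfolding source_def by simp
  qed
  ultimately show ?thesis
    using sum.remove[OF I, of "\<lambda>i. flux I c upper \<xi> i k"] by simp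
next
  case False
  define v where "v l = node (\<xi> l) (k l)" for l
  define b where "b = - of_nat (sum k I) * \<eta>"
  have bv: "D (v l) b \<noteq> 0" "D b (v l) \<noteq> 0" if "l \<in> I" for l
  proof -
    show "D (v l) b \<noteq> 0" unfolding v_def b_def by (rule D_node_neg_nonzero(1)[OF g that])
    then show "D b (v l) \<noteq> 0" using weier_swap[of "\<eta> + \<omega>" b "v l"] by simp
  qed
  have xb: "D (\<xi> c) b \<noteq> 0" "D b (\<xi> c) \<noteq> 0"
  proof -
    show "D (\<xi> c) b \<noteq> 0" unfolding b_def by (rule D_node_neg_nonzero(2)[OF g I(2)])
    then show "D b (\<xi> c) \<noteq> 0" using weier_swap[of "\<eta> + \<omega>" b "\<xi> c"] by simp
  qed
  have vtx: "D (v l) (\<xi> c) \<noteq> 0" "D (\<xi> c) (v l) \<noteq> 0" if "l \<in> I" for l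
    using D_node_nonzero(2,3)[OF g that I(2)] False unfolding v_def by auto
  have vv: "D (v i) (v j) \<noteq> 0" if "i \<in> I" "j \<in> I" "i \<noteq> j" for i j
    unfolding v_def by (rule D_node_nonzero(1)[OF g that])
  define M where "M = D (\<xi> c) b * (\<Prod>j\<in>I. D (\<xi> c) (v j))"
  have "(\<Sum>i\<in>I. (\<Prod>a\<in>I. D (upper a) (v i)) / (D (v i) b * D (v i) (\<xi> c) * (\<Prod>j\<in>I - {i}. D (v i) (v j))))
      + (\<Prod>a\<in>I. D (upper a) b) / (D b (\<xi> c) * (\<Prod>j\<in>I. D b (v j)))
      + (\<Prod>a\<in>I. D (upper a) (\<xi> c)) / (D (\<xi> c) b * (\<Prod>j\<in>I. D (\<xi> c) (v j))) = 0" (is "?A + ?B + ?C = 0")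
    by (rule weier_interpolation_2) (use I bv xb vtx vv in auto)
  then have e: "?C * M = - (?A * M) - ?B * M" by algebra
  have M0: "M \<noteq> 0" using xb vtx I by (simp add: M_def)
  then have C: "?C * M = (\<Prod>a\<in>I. D (upper a) (\<xi> c))" by (simp add: M_def)
  have P0: "(\<Prod>a\<in>I. D (upper a) (\<xi> c)) \<noteq> 0" using I D_upper_xi by simp
  have B: "- (?B * M) = (\<Prod>a\<in>I. D (upper a) b) * (\<Prod>l\<in>I. D (\<xi> c) (v l) / D b (v l))"
    unfolding M_def prod_dividef using weier_swap[of _ b "\<xi> c"] xb by simp
  have A: "- (?A * M) = (\<Sum>i\<in>I. (\<Prod>a\<in>I. D (upper a) (v i))
      * (\<Prod>l\<in>I - {i}. D (\<xi> c) (v l) / D (v i) (v l)) * (D (\<xi> c) b / D (v i) b))"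
    unfolding sum_distrib_right sum_negf[symmetric]
  proof (rule sum.cong[OF refl])
    fix i assume i: "i \<in> I"
    have "(\<Prod>j\<in>I. D (\<xi> c) (v j)) = D (\<xi> c) (v i) * (\<Prod>j\<in>I - {i}. D (\<xi> c) (v j))"
      by (rule prod.remove[OF I(1) i])
    then show "- ((\<Prod>a\<in>I. D (upper a) (v i)) / (D (v i) b * D (v i) (\<xi> c) * (\<Prod>j\<in>I - {i}. D (v i) (v j))) * M)
      = (\<Prod>a\<in>I. D (upper a) (v i)) * (\<Prod>l\<in>I - {i}. D (\<xi> c) (v l) / D (v i) (v l)) * (D (\<xi> c) b / D (v i) b)"
      unfolding M_def prod_dividef using weier_swap[of _ "\<xi> c" "v i"] vtx[OF i] by (simp add: mult_ac)
  qed
  have one: "1 = (\<Sum>i\<in>I. (\<Prod>a\<in>I. D (upper a) (v i) / D (upper a) (\<xi> c))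
      * (\<Prod>l\<in>I - {i}. D (\<xi> c) (v l) / D (v i) (v l)) * (D (\<xi> c) b / D (v i) b))
     + (\<Prod>a\<in>I. D (upper a) b / D (upper a) (\<xi> c)) * (\<Prod>l\<in>I. D (\<xi> c) (v l) / D b (v l))"
  proof -
    have "(\<Prod>a\<in>I. D (upper a) (\<xi> c)) = (\<Sum>i\<in>I. (\<Prod>a\<in>I. D (upper a) (v i))
      * (\<Prod>l\<in>I - {i}. D (\<xi> c) (v l) / D (v i) (v l)) * (D (\<xi> c) b / D (v i) b))
      + (\<Prod>a\<in>I. D (upper a) b) * (\<Prod>l\<in>I. D (\<xi> c) (v l) / D b (v l))"
      using e unfolding A C using B by simp
    then have "1 = ((\<Sum>i\<in>I. (\<Prod>a\<in>I. D (upper a) (v i))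
      * (\<Prod>l\<in>I - {i}. D (\<xi> c) (v l) / D (v i) (v l)) * (D (\<xi> c) b / D (v i) b))
      + (\<Prod>a\<in>I. D (upper a) b) * (\<Prod>l\<in>I. D (\<xi> c) (v l) / D b (v l))) / (\<Prod>a\<in>I. D (upper a) (\<xi> c))"
      using P0 by simp
    then show ?thesis
      unfolding prod_dividef[of "\<lambda>a. D (upper a) _"] add_divide_distrib sum_divide_distrib
      by (simp add: mult_ac)
  qed
  have "summand I upper \<xi> k = summand I upper \<xi> k * 1" by simp
  also have "\<dots> = (\<Sum>i\<in>I. flux I c upper \<xi> i k) + source I c upper \<xi> k"
    unfolding one distrib_left sum_distrib_left flux_def source_def v_def b_def by (simp only: mult.assoc)
  finally show ?thesis .
qed

text \<open>All terms share the factor \<open>\<Phi>\<close>: the kernels at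
  \<open>- of_nat (Suc K) * \<eta>\<close> cancel the last denominators of \<open>phi\<close>, and
  the first factors of the chains cancel the normalisation at \<open>\<xi> c\<close>. What remains
  is \<open>tau_recursion\<close>, where upper ends no longer occur.\<close>

lemma source_eq:
  assumes kc: "0 < k c"
  shows "source I c upper \<xi> k = sfac \<eta> (\<xi> c + \<eta>) 4 / sfac \<eta> (\<xi> c + \<omega> + \<eta>) 4
      * summand I upper (\<xi>(c := \<xi> c + 4 * \<eta>)) (k(c := k c - 1))
    - (\<Sum>i\<in>{i \<in> I. 0 < k i}. flux I c upper \<xi> i (k(i := k i - 1)))"
proof -
  obtain K where K: "sum k I = Suc K"
    using kc I by (metis sum.remove add_gr_0 gr0_implies_Suc)
  have kc1: "k c = Suc (k c - 1)" using kc by simp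
  let ?b = "- of_nat (Suc K) * \<eta>"
  let ?x = "\<xi>(c := \<xi> c + 4 * \<eta>)"
  define \<Phi> where "\<Phi> = phi I upper ?x (k(c := k c - 1))"
  define v where "v l = node (\<xi> l) (k l)" for l
  have ph: "phi I upper \<xi> k = \<Phi> * (\<Prod>a\<in>I. D (\<xi> c) (upper a) / D (upper a) ?b)"
    unfolding \<Phi>_def by (rule phi_shift[OF I kc1 K])
  have tb: "D (upper a) ?b \<noteq> 0" if "a \<in> I" for a
    unfolding upper_def by (rule D_node_neg_nonzero(1)[OF g that])
  have "source I c upper \<xi> k = tau I \<xi> k * \<Phi> * ((\<Prod>a\<in>I. D (\<xi> c) (upper a) / D (upper a) ?b)
     * (\<Prod>a\<in>I. D (upper a) ?b / D (upper a) (\<xi> c)) * (\<Prod>l\<in>I. D (\<xi> c) (v l) / D ?b (v l)))"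
    unfolding source_def summand_def ph K v_def by (simp only: mult.assoc)
  also have "((\<Prod>a\<in>I. D (\<xi> c) (upper a) / D (upper a) ?b)
     * (\<Prod>a\<in>I. D (upper a) ?b / D (upper a) (\<xi> c)) * (\<Prod>l\<in>I. D (\<xi> c) (v l) / D ?b (v l)))
     = (\<Prod>l\<in>I. D (\<xi> c) (v l) / D (v l) ?b)"
    unfolding prod.distrib[symmetric]
  proof (rule prod.cong[OF refl])
    fix l assume l: "l \<in> I"
    show "D (\<xi> c) (upper l) / D (upper l) ?b * (D (upper l) ?b / D (upper l) (\<xi> c)) * (D (\<xi> c) (v l) / D ?b (v l))
      = D (\<xi> c) (v l) / D (v l) ?b"
      using tb[OF l] D_upper_xi[OF l] weier_swap[of _ "\<xi> c" "upper l"] weier_swap[of _ ?b "v l"] by simp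
  qed
  finally have 1: "source I c upper \<xi> k = \<Phi> * (tau I \<xi> k * (\<Prod>l\<in>I. D (\<xi> c) (v l) / D (v l) ?b))"
    by simp
  let ?t = "\<lambda>i. \<Phi> * (tau I \<xi> (k(i := k i - 1))
        * (\<Prod>l\<in>I - {i}. D (\<xi> c) (v l) / D (node (\<xi> i) (k i - 1)) (v l))
        * (D (\<xi> c) (- of_nat K * \<eta>) / D (node (\<xi> i) (k i - 1)) (- of_nat K * \<eta>)))"
  have 2: "flux I c upper \<xi> i (k(i := k i - 1)) = ?t i"
    if i: "i \<in> {i \<in> I. 0 < k i}" for i
  proof -
    have i': "i \<in> I" "k i = Suc (k i - 1)" using i by auto
    let ?w = "node (\<xi> i) (k i - 1)" and ?p = "phi I upper \<xi> (k(i := k i - 1))"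
    have "?p * (\<Prod>a\<in>I. D ?w (upper a) / D (upper a) ?b)
      = \<Phi> * (\<Prod>a\<in>I. D (\<xi> c) (upper a) / D (upper a) ?b)"
      unfolding ph[symmetric] by (rule phi_low[OF I(1) i' K, symmetric])
    then have "?p * (\<Prod>a\<in>I. D ?w (upper a)) = \<Phi> * (\<Prod>a\<in>I. D (\<xi> c) (upper a))"
      unfolding prod_dividef using tb I by (simp add: field_simps)
    moreover have "D (upper a) ?w / D (upper a) (\<xi> c) = D ?w (upper a) / D (\<xi> c) (upper a)" for a
      using weier_swap[of _ "upper a"] by simp
    moreover have "(\<Prod>a\<in>I. D (\<xi> c) (upper a)) \<noteq> 0"
      using I D_upper_xi weier_swap[of _ "\<xi> c"] by (simp add: weier_swap[of _ "\<xi> c"])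
    ultimately have p: "?p * (\<Prod>a\<in>I. D (upper a) ?w / D (upper a) (\<xi> c)) = \<Phi>"
      by (simp add: prod_dividef field_simps)
    have "(\<Prod>l\<in>I - {i}. D (\<xi> c) (node (\<xi> l) ((k(i := k i - 1)) l)) / D ?w (node (\<xi> l) ((k(i := k i - 1)) l)))
      = (\<Prod>l\<in>I - {i}. D (\<xi> c) (v l) / D ?w (v l))"
      by (intro prod.cong) (auto simp: v_def)
    then show ?thesis
      unfolding flux_def summand_def sum_fun_upd_pred[OF I(1) i' K] fun_upd_same p[symmetric]
      by (simp only: mult_ac)
  qed
  have 3: "(\<Sum>i\<in>{i \<in> I. 0 < k i}. flux I c upper \<xi> i (k(i := k i - 1)))
    = (\<Sum>i\<in>{i \<in> I. 0 < k i}. ?t i)"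
    by (rule sum.cong[OF refl 2])
  show ?thesis
    unfolding 1 3 summand_def \<Phi>_def[symmetric]
      tau_recursion[OF I g kc K, folded v_def] right_diff_distrib sum_distrib_left
    by (simp only: mult_ac)
qed

definition box :: "(nat \<Rightarrow> nat) set" where
  "box = PiE I (\<lambda>i. {..n i})"

lemma finite_box: "finite box"
  unfolding box_def by (intro finite_PiE) (use I in auto)

text \<open>The condition \<open>P\<close> is imposed on the point before lowering, since it will be
  \<open>0 < k c\<close>, the hypothesis under which \<open>source_eq\<close> produces the lowered
  fluxes.\<close>

lemma sum_box_lower:
  fixes f :: "(nat \<Rightarrow> nat) \<Rightarrow> complex"
  assumes i: "i \<in> I"
  shows "(\<Sum>k\<in>{k \<in> box. 0 < k i \<and> P k}. f (k(i := k i - 1)))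
    = (\<Sum>k\<in>{k \<in> box. k i < n i \<and> P (k(i := Suc (k i)))}. f k)"
proof (rule sum.reindex_bij_witness[where i = "\<lambda>k. k(i := Suc (k i))" and j = "\<lambda>k. k(i := k i - 1)"])
  fix k assume k: "k \<in> {k \<in> box. 0 < k i \<and> P k}"
  show e: "(k(i := k i - 1))(i := Suc ((k(i := k i - 1)) i)) = k" using k by auto
  have "k i \<le> n i" using k i by (auto simp: box_def)
  then show "k(i := k i - 1) \<in> {k \<in> box. k i < n i \<and> P (k(i := Suc (k i)))}"
    using k i e by (auto simp: box_def PiE_iff extensional_def)
next
  fix k assume k: "k \<in> {k \<in> box. k i < n i \<and> P (k(i := Suc (k i)))}"
  then show "k(i := Suc (k i)) \<in> {k \<in> box. 0 < k i \<and> P k}"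
    using i by (auto simp: box_def PiE_iff extensional_def)
qed auto

text \<open>At \<open>k i = n i\<close> the node of \<open>i\<close> is its own upper end, a zero of
  the product over \<open>a\<close>. At \<open>k c = 0\<close> the node of \<open>c\<close> is
  \<open>\<xi> c\<close>, a zero of the product over \<open>I - {i}\<close>. Exactly these points
  are missing when the lowered fluxes are compared with the sum over the box.\<close>

lemma flux_boundary:
  assumes i: "i \<in> I" and k: "k i = n i \<or> (i \<noteq> c \<and> k c = 0)"
  shows "flux I c upper \<xi> i k = 0"
proof (cases "k i = n i")
  case True
  then have "(\<Prod>a\<in>I. D (upper a) (node (\<xi> i) (k i)) / D (upper a) (\<xi> c)) = 0"
    using I i by (intro prod_zero) (auto simp: upper_def intro!: bexI[of _ i])
  then show ?thesis unfolding flux_def by simp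
next
  case False
  then have "(\<Prod>l\<in>I - {i}. D (\<xi> c) (node (\<xi> l) (k l)) / D (node (\<xi> i) (k i)) (node (\<xi> l) (k l))) = 0"
    using I k by (intro prod_zero) (auto simp: node_def intro!: bexI[of _ c])
  then show ?thesis unfolding flux_def by simp
qed

text \<open>Each flux occurs positively at its own point by \<open>summand_split\<close> and
  negatively at the upper neighbour by \<open>source_eq\<close>. As the boundary fluxes vanish, all
  of them cancel and only shifted summands are left.\<close>

lemma sum_box_shift:
  "(\<Sum>k\<in>box. summand I upper \<xi> k) = sfac \<eta> (\<xi> c + \<eta>) 4 / sfac \<eta> (\<xi> c + \<omega> + \<eta>) 4
    * (\<Sum>k\<in>PiE I (\<lambda>i. {..(n(c := n')) i}). summand I upper (\<xi>(c := \<xi> c + 4 * \<eta>)) k)"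
proof -
  let ?cst = "sfac \<eta> (\<xi> c + \<eta>) 4 / sfac \<eta> (\<xi> c + \<omega> + \<eta>) 4"
  let ?S = "summand I upper (\<xi>(c := \<xi> c + 4 * \<eta>))"
  let ?B = "{k \<in> box. 0 < k c}"
  have src0: "source I c upper \<xi> k = 0" if "k c = 0" for k
  proof -
    have "(\<Prod>l\<in>I. D (\<xi> c) (node (\<xi> l) (k l)) / D (- of_nat (sum k I) * \<eta>) (node (\<xi> l) (k l))) = 0"
      using I that by (intro prod_zero) (auto simp: node_def intro!: bexI[of _ c])
    then show ?thesis unfolding source_def by simp
  qed
  have "(\<Sum>k\<in>box. source I c upper \<xi> k) = (\<Sum>k\<in>?B. source I c upper \<xi> k)"
    using finite_box src0 by (intro sum.mono_neutral_right) auto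
  also have "\<dots> = (\<Sum>k\<in>?B. ?cst * ?S (k(c := k c - 1)))
      - (\<Sum>k\<in>?B. \<Sum>i\<in>{i \<in> I. 0 < k i}. flux I c upper \<xi> i (k(i := k i - 1)))"
    unfolding sum_subtractf[symmetric] by (rule sum.cong[OF refl], rule source_eq) simp
  also have "(\<Sum>k\<in>?B. ?cst * ?S (k(c := k c - 1))) = ?cst * (\<Sum>k\<in>PiE I (\<lambda>i. {..(n(c := n')) i}). ?S k)"
  proof -
    have "{k \<in> box. k c < n c} = PiE I (\<lambda>i. {..(n(c := n')) i})"
    proof (intro set_eqI iffI)
      fix k assume "k \<in> {k \<in> box. k c < n c}"
      then show "k \<in> PiE I (\<lambda>i. {..(n(c := n')) i})"
        using nc by (auto simp: box_def PiE_iff)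
    next
      fix k assume k: "k \<in> PiE I (\<lambda>i. {..(n(c := n')) i})"
      then have "k i \<le> (n(c := n')) i" if "i \<in> I" for i using that by (auto simp: PiE_iff)
      from this[OF I(2)] this show "k \<in> {k \<in> box. k c < n c}"
        using k nc by (fastforce simp: box_def PiE_iff split: if_splits)
    qed
    then show ?thesis
      using sum_box_lower[OF I(2), where P = "\<lambda>_. True" and f = ?S]
      unfolding sum_distrib_left[symmetric] by simp
  qed
  also have "(\<Sum>k\<in>?B. \<Sum>i\<in>{i \<in> I. 0 < k i}. flux I c upper \<xi> i (k(i := k i - 1)))
    = (\<Sum>i\<in>I. \<Sum>k\<in>{k \<in> ?B. 0 < k i}. flux I c upper \<xi> i (k(i := k i - 1)))"
    using finite_box I by (intro sum.swap_restrict) auto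
  also have "\<dots> = (\<Sum>i\<in>I. \<Sum>k\<in>box. flux I c upper \<xi> i k)"
  proof (rule sum.cong[OF refl])
    fix i assume i: "i \<in> I"
    have "{k \<in> ?B. 0 < k i} = {k \<in> box. 0 < k i \<and> 0 < k c}" by auto
    then have "(\<Sum>k\<in>{k \<in> ?B. 0 < k i}. flux I c upper \<xi> i (k(i := k i - 1)))
      = (\<Sum>k\<in>{k \<in> box. k i < n i \<and> 0 < (k(i := Suc (k i))) c}. flux I c upper \<xi> i k)"
      using sum_box_lower[OF i, where P = "\<lambda>k. 0 < k c" and f = "flux I c upper \<xi> i"] by simp
    also have "\<dots> = (\<Sum>k\<in>box. flux I c upper \<xi> i k)"
    proof (rule sum.mono_neutral_left[OF finite_box])
      show "\<forall>k\<in>box - {k \<in> box. k i < n i \<and> 0 < (k(i := Suc (k i))) c}. flux I c upper \<xi> i k = 0"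
      proof
        fix k assume k: "k \<in> box - {k \<in> box. k i < n i \<and> 0 < (k(i := Suc (k i))) c}"
        then have "k i \<le> n i" using i by (auto simp: box_def)
        then have "k i = n i \<or> (i \<noteq> c \<and> k c = 0)" using k by (auto split: if_splits)
        then show "flux I c upper \<xi> i k = 0" by (rule flux_boundary[OF i])
      qed
    qed auto
    finally show "(\<Sum>k\<in>{k \<in> ?B. 0 < k i}. flux I c upper \<xi> i (k(i := k i - 1)))
      = (\<Sum>k\<in>box. flux I c upper \<xi> i k)" .
  qed
  also have "\<dots> = (\<Sum>k\<in>box. \<Sum>i\<in>I. flux I c upper \<xi> i k)" by (rule sum.swap)
  finally have e: "(\<Sum>k\<in>box. source I c upper \<xi> k)
    = ?cst * (\<Sum>k\<in>PiE I (\<lambda>i. {..(n(c := n')) i}). ?S k) - (\<Sum>k\<in>box. \<Sum>i\<in>I. flux I c upper \<xi> i k)" .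
  have "a + (x - a) = x" for a x :: complex by simp
  then show ?thesis
    unfolding summand_split sum.distrib e by blast
qed

end

lemma tau_0:
  assumes g: "generic I \<xi>" and I: "finite I" and k: "\<And>i. i \<in> I \<Longrightarrow> k i = 0"
  shows "tau I \<xi> k = 1"
proof -
  have "sum k I = 0" using k by simp
  \<comment> \<open>Here \<open>gfac\<close> has length 1 and cancels against
    \<open>br (\<xi> i + \<omega>)\<close>.\<close>
  moreover have "Sfac (\<xi> i) 0 0 = 1" if "i \<in> I" for i
    using genericD(1)[OF g that, of 0] genericD(2)[OF g that, of 0]
    by (simp add: Sfac_def node_def gfac_def sfac_Suc)
  moreover have "Efac (\<xi> i) (\<xi> j) (k i) (k j) = 1" if "i \<in> I" "j \<in> I" "i < j" for i j
    using genericD(4)[OF g that(1,2), of 0] that k by (simp add: Efac_def node_def)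
  ultimately show ?thesis
    unfolding tau_def using k by (auto simp: Nfac_def ordered_pairs_def intro!: prod.neutral)
qed

lemma phi_0: "(\<And>i. i \<in> I \<Longrightarrow> k i = 0) \<Longrightarrow> phi I X \<xi> k = 1"
  by (simp add: phi_def chain_def)

theorem bracket_sum:
  assumes "finite I" "generic I \<xi>"
  shows "(\<Sum>k\<in>PiE I (\<lambda>i. {..n i}). summand I (\<lambda>a. node (\<xi> a) (n a)) \<xi> k)
    = (\<Prod>i\<in>I. sfac \<eta> (\<xi> i + \<eta>) (4 * n i) / sfac \<eta> (\<xi> i + \<omega> + \<eta>) (4 * n i))"
  using assms
proof (induction "sum n I" arbitrary: n \<xi> rule: less_induct)
  case less
  show ?case
  proof (cases "\<exists>c\<in>I. n c \<noteq> 0")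
    case False
    then have n: "n i = 0" if "i \<in> I" for i using that by auto
    have "summand I (\<lambda>a. node (\<xi> a) (n a)) \<xi> k = 1" if "k \<in> PiE I (\<lambda>i. {..n i})" for k
    proof -
      have "k i = 0" if "i \<in> I" for i using \<open>k \<in> _\<close> that n by (fastforce simp: PiE_iff)
      then show ?thesis unfolding summand_def using tau_0[OF less.prems(2,1)] phi_0 by simp
    qed
    then have "(\<Sum>k\<in>PiE I (\<lambda>i. {..n i}). summand I (\<lambda>a. node (\<xi> a) (n a)) \<xi> k)
      = of_nat (card (PiE I (\<lambda>i. {..n i})))" by simp
    then show ?thesis using n less.prems(1) by (simp add: card_PiE)
  next
    case True
    then obtain c n' where c: "c \<in> I" "n c = Suc n'" by (metis not0_implies_Suc)
    note I = less.prems(1) c(1)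
    let ?x = "\<xi>(c := \<xi> c + 4 * \<eta>)"
    let ?n = "n(c := n')"
    have upper: "(\<lambda>a. node (?x a) (?n a)) = (\<lambda>a. node (\<xi> a) (n a))"
      using c(2) by (auto simp: node_def algebra_simps)
    have "sum n I = Suc (sum ?n I)"
      using sum.remove[OF I, of n] sum.remove[OF I, of ?n] c(2) by simp
    then have IH: "(\<Sum>k\<in>PiE I (\<lambda>i. {..?n i}). summand I (\<lambda>a. node (\<xi> a) (n a)) ?x k)
      = (\<Prod>i\<in>I. sfac \<eta> (?x i + \<eta>) (4 * ?n i) / sfac \<eta> (?x i + \<omega> + \<eta>) (4 * ?n i))"
      using less.hyps[of ?n ?x] less.prems generic_shift[OF less.prems(2) c(1)] upper by simp
    have s4: "sfac \<eta> x (4 * n c) = sfac \<eta> x 4 * sfac \<eta> (x + 4 * \<eta>) (4 * n')" for x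
    proof -
      have "sfac \<eta> x (m + l) = sfac \<eta> x m * sfac \<eta> (x + of_nat m * \<eta>) l" for m l
        by (induction m arbitrary: x) (simp_all add: sfac_Suc_shift algebra_simps)
      from this[of 4 "4 * n'"] show ?thesis using c(2) by (simp add: algebra_simps)
    qed
    have r: "(\<Prod>i\<in>I - {c}. sfac \<eta> (?x i + \<eta>) (4 * ?n i) / sfac \<eta> (?x i + \<omega> + \<eta>) (4 * ?n i))
      = (\<Prod>i\<in>I - {c}. sfac \<eta> (\<xi> i + \<eta>) (4 * n i) / sfac \<eta> (\<xi> i + \<omega> + \<eta>) (4 * n i))"
      by (intro prod.cong) auto
    show ?thesis
      using sum_box_shift[where n = n, OF I less.prems(2) c(2)]
      unfolding box_def[where n = n, OF I less.prems(2) c(2)]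
        upper_def[where n = n, OF I less.prems(2) c(2), abs_def] IH
      unfolding prod.remove[OF I] r fun_upd_same s4
      by (simp add: algebra_simps)
  qed
qed

end

section \<open>The three-term relation for theta functions\<close>

lemma continuous_zero_off_countable:
  fixes f :: "complex \<Rightarrow> complex"
  assumes f: "continuous_on UNIV f" and C: "countable C" "\<And>z. z \<notin> C \<Longrightarrow> f z = 0"
  shows "f z = 0"
proof (rule ccontr)
  assume z: "f z \<noteq> 0"
  have "open (f -` (- {0}))"
    by (rule open_vimage) (use f in auto)
  then obtain e where e: "e > 0" "ball z e \<subseteq> f -` (- {0})"
    using z by (metis ComplI openE singletonD vimageI2)
  then have "ball z e \<subseteq> C" using C(2) by auto
  then show False using C(1) e(1) uncountable_ball countable_subset by metis
qed

text \<open>The zeros of \<open>G\<close> are simple and are zeros of \<open>F\<close>, so the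
  singularities of the quotient are removable; l'Hopital's rule provides the values to put
  there.\<close>

lemma entire_quotient:
  fixes F G :: "complex \<Rightarrow> complex"
  assumes F: "F holomorphic_on UNIV" and G: "G holomorphic_on UNIV"
    and z: "\<And>z. G z = 0 \<Longrightarrow> F z = 0" "\<And>z. G z = 0 \<Longrightarrow> deriv G z \<noteq> 0"
  obtains H where "H holomorphic_on UNIV" "\<And>z. F z = H z * G z"
proof
  define H where "H z = (if G z = 0 then deriv F z / deriv G z else F z / G z)" for z
  show "F z = H z * G z" for z using z(1)[of z] by (simp add: H_def)
  have dF: "(F has_field_derivative deriv F x) (at x)" and dG: "(G has_field_derivative deriv G x) (at x)" for x
    using F G by (auto intro: holomorphic_derivI)
  have quot: "H holomorphic_on S" if "\<And>x. x \<in> S \<Longrightarrow> G x \<noteq> 0" for S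
  proof -
    have "(\<lambda>x. F x / G x) holomorphic_on S"
      using that F G by (intro holomorphic_intros) (auto intro: holomorphic_on_subset)
    then show ?thesis by (rule holomorphic_transform) (use that in \<open>auto simp: H_def\<close>)
  qed
  have cG: "continuous_on UNIV G" using G by (rule holomorphic_on_imp_continuous_on)
  have "\<exists>e>0. H holomorphic_on ball x e" for x
  proof (cases "G x = 0")
    case False
    have "open (G -` (- {0}))" by (rule open_vimage) (use cG in auto)
    then obtain e where "e > 0" "ball x e \<subseteq> G -` (- {0})"
      using False by (metis ComplI openE singletonD vimageI2)
    moreover from this have "H holomorphic_on ball x e" by (intro quot) auto
    ultimately show ?thesis by blast
  next
    case True
    have "((\<lambda>w. G w / (w - x)) \<longlongrightarrow> deriv G x) (at x)"
      using dG[of x] True unfolding has_field_derivative_iff by simp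
    then have "eventually (\<lambda>w. G w / (w - x) \<in> - {0}) (at x)"
      by (rule topological_tendstoD) (use z(2)[OF True] in auto)
    then have "eventually (\<lambda>w. G w \<noteq> 0) (at x)" by eventually_elim auto
    then obtain e where e: "e > 0" "\<And>w. w \<in> ball x e \<Longrightarrow> w \<noteq> x \<Longrightarrow> G w \<noteq> 0"
      unfolding eventually_at by (auto simp: dist_commute)
    have "H holomorphic_on ball x e"
    proof (rule no_isolated_singularity'[where K = "{x}"])
      show "H holomorphic_on ball x e - {x}" using e(2) by (intro quot) auto
      fix y assume y: "y \<in> {x}"
      have lim: "((\<lambda>w. F w / G w) \<longlongrightarrow> H x) (at x)"
        by (rule lhopital_complex_simple[OF dF dG]) (use True z in \<open>auto simp: H_def\<close>)
      have "eventually (\<lambda>w. F w / G w = H w) (at x)"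
        using \<open>eventually (\<lambda>w. G w \<noteq> 0) (at x)\<close> by eventually_elim (simp add: H_def)
      then have "(H \<longlongrightarrow> H x) (at x)" using lim by (rule Lim_transform_eventually[rotated])
      then show "(H \<longlongrightarrow> H y) (at y within ball x e)"
        using y by (auto intro: Lim_at_imp_Lim_at_within)
    qed auto
    then show ?thesis using e(1) by blast
  qed
  then show "H holomorphic_on UNIV"
    by (meson UNIV_I centre_in_ball holomorphic_on_imp_differentiable_at open_ball
        field_differentiable_at_within holomorphic_on_def)
qed

text \<open>\<open>Re t \<noteq> 0\<close> makes \<open>t\<close> and \<open>2 * pi * \<i>\<close>
  independent over the reals. Every point is therefore equivalent to one in a bounded parallelogram,
  and Liouville's theorem applies.\<close>

lemma entire_elliptic_const:
  fixes H :: "complex \<Rightarrow> complex" and t :: complex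
  assumes H: "H holomorphic_on UNIV" and t: "Re t \<noteq> 0"
    and per: "\<And>z. H (z + t) = H z" "\<And>z. H (z + 2 * pi * \<i>) = H z"
  shows "H z = H w"
proof -
  define P where "P = 2 * pi * \<i>"
  have per_int: "H (z + of_int m * s) = H z" if s: "\<And>z. H (z + s) = H z" for m :: int and s z
  proof (induction m rule: int_induct[where k = 0])
    case (step1 i)
    then show ?case using s[of "z + of_int i * s"] by (simp add: algebra_simps)
  next
    case (step2 i)
    then show ?case using s[of "z + of_int (i - 1) * s"] by (simp add: algebra_simps)
  qed simp
  let ?R = "norm t + norm P"
  have "H z \<in> H ` cball 0 ?R" for z
  proof -
    define a where "a = Re z / Re t"
    define b where "b = (Im z - a * Im t) / (2 * pi)"
    have zab: "z = of_real a * t + of_real b * P"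
      unfolding P_def by (rule complex_eqI) (use t in \<open>simp_all add: a_def b_def field_simps\<close>)
    define z' where "z' = of_real (frac a) * t + of_real (frac b) * P"
    have "z = z' + of_int \<lfloor>a\<rfloor> * t + of_int \<lfloor>b\<rfloor> * P"
      unfolding zab z'_def frac_def by (simp add: algebra_simps)
    then have "H z = H z'" using per per_int unfolding P_def by simp
    moreover have "norm z' \<le> norm (of_real (frac a) * t) + norm (of_real (frac b) * P)"
      unfolding z'_def by (rule norm_triangle_ineq)
    then have "norm z' \<le> frac a * norm t + frac b * norm P"
      by (simp add: norm_mult)
    moreover have "frac a * norm t \<le> 1 * norm t" "frac b * norm P \<le> 1 * norm P"
      using frac_lt_1[of a] frac_lt_1[of b] by (intro mult_right_mono; simp)+
    ultimately show ?thesis by (intro image_eqI[of _ _ z']) auto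
  qed
  then have "range H \<subseteq> H ` cball 0 ?R" by blast
  moreover have "compact (H ` cball 0 ?R)"
    by (intro compact_continuous_image holomorphic_on_imp_continuous_on
        holomorphic_on_subset[OF H]) auto
  ultimately have "bounded (range H)" using bounded_subset compact_imp_bounded by blast
  then have "H constant_on UNIV" by (rule Liouville_theorem[OF H])
  then show ?thesis unfolding constant_on_def by auto
qed

section \<open>The theta function, its bracket and their zeros\<close>

definition qpoch_inf :: "complex \<Rightarrow> complex \<Rightarrow> complex" where
  "qpoch_inf p x = (\<Prod>j. 1 - p ^ j * x)"

text \<open>The exponential makes the function odd, at the price of a sign under translation by
  \<open>2 * pi * \<i>\<close>.\<close>

definition theta_bracket :: "complex \<Rightarrow> complex \<Rightarrow> complex" where
  "theta_bracket p z = exp (- z / 2) * theta (exp z) p"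

context
  fixes p :: complex
  assumes p: "norm p < 1"
begin

lemma qpoch_convergent: "convergent_prod (\<lambda>j. 1 - p ^ j * x)"
proof -
  have "summable (\<lambda>j. norm (p ^ j * x))"
    unfolding norm_mult norm_power by (intro summable_mult2 summable_geometric) (use p in simp)
  then show ?thesis
    by (intro abs_convergent_prod_imp_convergent_prod summable_imp_abs_convergent_prod) simp
qed

lemma qpoch_LIMSEQ: "(\<lambda>n. \<Prod>j<n. 1 - p ^ j * x) \<longlonglongrightarrow> qpoch_inf p x"
  using convergent_prod_LIMSEQ[OF qpoch_convergent] LIMSEQ_lessThan_iff_atMost
  unfolding qpoch_inf_def by blast

lemma qpoch_shift: "qpoch_inf p x = (1 - x) * qpoch_inf p (p * x)"
proof -
  have "(\<lambda>n. \<Prod>j<Suc n. 1 - p ^ j * x) \<longlonglongrightarrow> qpoch_inf p x"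
    using qpoch_LIMSEQ by (subst filterlim_sequentially_Suc)
  moreover have "(\<Prod>j<Suc n. 1 - p ^ j * x) = (1 - x) * (\<Prod>j<n. 1 - p ^ j * (p * x))" for n
    unfolding prod.lessThan_Suc_shift by (simp add: mult_ac)
  moreover have "(\<lambda>n. (1 - x) * (\<Prod>j<n. 1 - p ^ j * (p * x))) \<longlonglongrightarrow> (1 - x) * qpoch_inf p (p * x)"
    by (intro tendsto_mult tendsto_const qpoch_LIMSEQ)
  ultimately show ?thesis using LIMSEQ_unique by simp
qed

lemma qpoch_eq_0: "qpoch_inf p x = 0 \<longleftrightarrow> (\<exists>j. p ^ j * x = 1)"
proof
  assume "qpoch_inf p x = 0"
  then show "\<exists>j. p ^ j * x = 1"
    using prodinf_nonzero[OF qpoch_convergent[of x]] unfolding qpoch_inf_def by force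
next
  assume "\<exists>j. p ^ j * x = 1"
  then obtain j where j: "p ^ j * x = 1" by blast
  have "eventually (\<lambda>n. 0 = (\<Prod>j<n. 1 - p ^ j * x)) sequentially"
    using eventually_gt_at_top[of j] by eventually_elim (use j in auto)
  then have "(\<lambda>n. \<Prod>j<n. 1 - p ^ j * x) \<longlonglongrightarrow> 0"
    by (rule Lim_transform_eventually[OF tendsto_const])
  then show "qpoch_inf p x = 0" using qpoch_LIMSEQ LIMSEQ_unique by blast
qed

lemma qpoch_holomorphic: "qpoch_inf p holomorphic_on UNIV"
proof (rule holomorphic_uniform_sequence[where f = "\<lambda>n x. \<Prod>j<n. 1 - p ^ j * x"])
  show "(\<lambda>x. \<Prod>j<n. 1 - p ^ j * x) holomorphic_on UNIV" for n
    by (intro holomorphic_intros)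
  fix x :: complex
  have "uniformly_convergent_on (cball x 1) (\<lambda>N y. \<Prod>n<N. 1 + (- (p ^ n * y)))"
  proof (rule uniformly_convergent_on_prod)
    show "continuous_on (cball x 1) (\<lambda>y. - (p ^ n * y))" for n by (intro continuous_intros)
    show "uniformly_convergent_on (cball x 1) (\<lambda>N y. \<Sum>n<N. norm (- (p ^ n * y)))"
    proof (rule Weierstrass_m_test')
      show "summable (\<lambda>n. norm p ^ n * (norm x + 1))"
        by (intro summable_mult2 summable_geometric) (use p in simp)
      fix n y assume "y \<in> cball x 1"
      then have "norm y \<le> norm x + 1"
        using norm_triangle_ineq2[of y x] by (simp add: dist_norm norm_minus_commute)
      then show "norm (norm (- (p ^ n * y))) \<le> norm p ^ n * (norm x + 1)"
        by (simp add: norm_mult norm_power mult_left_mono)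
    qed
  qed auto
  then obtain l where l: "uniform_limit (cball x 1) (\<lambda>N y. \<Prod>n<N. 1 - p ^ n * y) l sequentially"
    unfolding uniformly_convergent_on_def by auto
  then have "l y = qpoch_inf p y" if "y \<in> cball x 1" for y
    using tendsto_uniform_limitI[OF l that] qpoch_LIMSEQ LIMSEQ_unique by blast
  then have "uniform_limit (cball x 1) (\<lambda>N y. \<Prod>n<N. 1 - p ^ n * y) (qpoch_inf p) sequentially"
    using l by (subst uniform_limit_cong'[of _ _ _ _ l]) auto
  then show "\<exists>d>0. cball x d \<subseteq> UNIV \<and>
      uniform_limit (cball x d) (\<lambda>n x. \<Prod>j<n. 1 - p ^ j * x) (qpoch_inf p) sequentially"
    by (intro exI[of _ 1]) auto
qed auto

lemma theta_qpoch: "theta x p = qpoch_inf p x * qpoch_inf p (p / x)"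
  unfolding theta_def qpoch_inf_def
  by (subst prodinf_mult[OF qpoch_convergent qpoch_convergent]) (simp add: mult_ac)

text \<open>The left side is \<open>theta (1 / x) p\<close> and, for \<open>p \<noteq> 0\<close>,
  also \<open>theta (p * x) p\<close>, so both functional equations of theta are contained in this
  one.\<close>

lemma theta_functional:
  assumes "x \<noteq> 0"
  shows "qpoch_inf p (p * x) * qpoch_inf p (1 / x) = - theta x p / x"
proof -
  have c: "qpoch_inf p (1 / x) = (1 - 1 / x) * qpoch_inf p (p / x)"
    using qpoch_shift[of "1 / x"] by simp
  have t: "theta x p = (1 - x) * qpoch_inf p (p * x) * qpoch_inf p (p / x)"
    unfolding theta_qpoch by (subst qpoch_shift) simp
  show ?thesis unfolding c t using assms by (simp add: field_simps)
qed

lemma theta_inverse: "x \<noteq> 0 \<Longrightarrow> theta (1 / x) p = - theta x p / x"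
  using theta_functional[of x] by (simp add: theta_qpoch[of "1 / x"] mult.commute)

lemma theta_period: "x \<noteq> 0 \<Longrightarrow> p \<noteq> 0 \<Longrightarrow> theta (p * x) p = - theta x p / x"
  using theta_functional[of x] by (simp add: theta_qpoch[of "p * x"])

lemma theta_eq_0:
  assumes x: "x \<noteq> 0"
  shows "theta x p = 0 \<longleftrightarrow> (if p = 0 then x = 1 else \<exists>m::int. x = p powi m)"
proof (cases "p = 0")
  case True
  then show ?thesis unfolding theta_qpoch mult_eq_0_iff qpoch_eq_0
    by (auto simp: power_0_left split: if_splits intro: exI[of _ 0])
next
  case False
  have "(\<exists>j. p ^ j * x = 1) \<or> (\<exists>j. p ^ j * (p / x) = 1) \<longleftrightarrow> (\<exists>m::int. x = p powi m)"
  proof (intro iffI; elim disjE exE)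
    fix j assume "p ^ j * x = 1"
    then have "x = p powi (- int j)" using False by (simp add: power_int_minus field_simps)
    then show "\<exists>m::int. x = p powi m" by blast
  next
    fix j assume "p ^ j * (p / x) = 1"
    then have "x = p ^ Suc j" using x by (simp add: field_simps)
    also have "\<dots> = p powi (int (Suc j))" by (rule power_int_of_nat[symmetric])
    finally show "\<exists>m::int. x = p powi m" by blast
  next
    fix m :: int assume m: "x = p powi m"
    show "(\<exists>j. p ^ j * x = 1) \<or> (\<exists>j. p ^ j * (p / x) = 1)"
    proof (cases "m \<le> 0")
      case True
      then have "p ^ nat (- m) * x = 1"
        using False unfolding m by (cases "m = 0") (simp_all add: power_int_def field_simps)
      then show ?thesis by blast
    next
      case F2: False
      have "x = p ^ Suc (nat (m - 1))"
        unfolding m power_int_of_nat[symmetric] using F2 by (intro arg_cong[of _ _ "power_int p"]) simp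
      then show ?thesis using False x by (intro disjI2 exI[of _ "nat (m - 1)"]) (simp add: field_simps)
    qed
  qed
  then show ?thesis using False unfolding theta_qpoch mult_eq_0_iff qpoch_eq_0 by simp
qed

lemma theta_continuous: "continuous_on (- {0}) (\<lambda>x. theta x p)"
  unfolding theta_qpoch
  by (intro continuous_intros continuous_on_compose2[OF holomorphic_on_imp_continuous_on[OF qpoch_holomorphic]]) auto

lemma bracket_qpoch: "theta_bracket p z = exp (- z / 2) * (qpoch_inf p (exp z) * qpoch_inf p (p * exp (- z)))"
  unfolding theta_bracket_def theta_qpoch by (simp add: exp_minus field_simps)

lemma bracket_holomorphic: "theta_bracket p holomorphic_on UNIV"
  unfolding bracket_qpoch[abs_def]
  by (intro holomorphic_intros holomorphic_on_compose_gen[OF _ qpoch_holomorphic, unfolded o_def]) auto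

lemma bracket_minus: "theta_bracket p (- z) = - theta_bracket p z"
proof -
  have "exp (z / 2) = exp (- z / 2) * exp z" by (simp flip: exp_add)
  then show ?thesis
    unfolding theta_bracket_def using theta_inverse[of "exp z"] by (simp add: exp_minus field_simps)
qed

lemma bracket_shift: "theta_bracket p (z + 2 * (\<i> * pi)) = - theta_bracket p z"
proof -
  have "- (z + 2 * (\<i> * pi)) / 2 = - z / 2 + - (\<i> * pi)" by (simp add: field_simps)
  then have "exp (- (z + 2 * (\<i> * pi)) / 2) = exp (- z / 2) * exp (- (\<i> * pi))"
    by (simp only: exp_add)
  also have "exp (- (\<i> * pi)) = - 1" by (simp add: exp_minus)
  finally have "exp (- (z + 2 * (\<i> * pi)) / 2) = - exp (- z / 2)" by simp
  moreover have "exp (z + 2 * (\<i> * pi)) = exp z"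
    using exp_two_pi_i by (simp add: exp_add mult_ac)
  ultimately show ?thesis unfolding theta_bracket_def by simp
qed

lemma bracket_eq_0: "theta_bracket p z = 0 \<longleftrightarrow> (if p = 0 then exp z = 1 else \<exists>m::int. exp z = p powi m)"
  unfolding theta_bracket_def by (simp add: theta_eq_0)

lemma bracket_zero_diff:
  assumes "theta_bracket p x = 0" "theta_bracket p y = 0"
  shows "theta_bracket p (x - y) = 0"
proof (cases "p = 0")
  case False
  then obtain m l :: int where "exp x = p powi m" "exp y = p powi l"
    using assms by (auto simp: bracket_eq_0)
  then have "exp (x - y) = p powi (m - l)" using False by (simp add: exp_diff power_int_diff)
  then show ?thesis using False by (auto simp: bracket_eq_0)
next
  case True
  then show ?thesis using assms unfolding bracket_eq_0 by (simp add: exp_diff)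
qed

lemma bracket_period: "p \<noteq> 0 \<Longrightarrow> theta_bracket p (z + Ln p) = - exp (- Ln p / 2 - z) * theta_bracket p z"
proof -
  assume "p \<noteq> 0"
  then have "theta (exp (z + Ln p)) p = - theta (exp z) p / exp z"
    using theta_period[of "exp z"] by (simp add: exp_add mult.commute)
  moreover have "exp (- (z + Ln p) / 2) = exp (- Ln p / 2 - z) * exp z * exp (- z / 2)"
    by (simp add: field_simps flip: exp_add)
  ultimately show ?thesis unfolding theta_bracket_def by (simp add: mult_ac)
qed

lemma bracket_zeros:
  assumes "p \<noteq> 0" "theta_bracket p z = 0"
  obtains m l :: int where "z = of_int m * Ln p + of_int l * (2 * pi * \<i>)"
proof -
  obtain m :: int where "exp z = p powi m" using assms by (auto simp: bracket_eq_0)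
  also have "\<dots> = exp (of_int m * Ln p)" using assms(1)
    by (metis exp_Ln exp_power_int)
  finally obtain l :: int where "z = of_int m * Ln p + (of_int (2 * l) * pi) * \<i>"
    unfolding exp_eq by blast
  then show thesis by (intro that[of m l]) (simp add: mult_ac)
qed

text \<open>At the origin the simple zero splits off as \<open>1 - exp z\<close>, and the cofactor
  there is the square of \<open>qpoch_inf p p\<close>. All other zeros are reached by the
  quasi-periods, which multiply the derivative at a zero by a nonzero number.\<close>

lemma bracket_deriv_nonzero:
  assumes p0: "p \<noteq> 0" and z: "theta_bracket p z = 0"
  shows "deriv (theta_bracket p) z \<noteq> 0"
proof -
  let ?b = "theta_bracket p"
  have d: "(?b has_field_derivative deriv ?b x) (at x)" for x
    using bracket_holomorphic by (auto intro: holomorphic_derivI)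
  define Q where "Q z = exp (- z / 2) * (qpoch_inf p (p * exp z) * qpoch_inf p (p * exp (- z)))" for z
  have Q: "Q holomorphic_on UNIV" unfolding Q_def
    by (intro holomorphic_intros holomorphic_on_compose_gen[OF _ qpoch_holomorphic, unfolded o_def]) auto
  have bQ: "?b = (\<lambda>z. (1 - exp z) * Q z)"
    unfolding bracket_qpoch[abs_def] Q_def by (subst qpoch_shift) (simp add: mult_ac)
  have "((\<lambda>z. (1 - exp z) * Q z) has_field_derivative (0 - exp 0) * Q 0 + deriv Q 0 * (1 - exp 0)) (at 0)"
    by (rule DERIV_mult) (auto intro!: derivative_eq_intros holomorphic_derivI[OF Q])
  then have "deriv ?b 0 = - Q 0" unfolding bQ by (simp add: DERIV_imp_deriv)
  moreover have "qpoch_inf p p \<noteq> 0"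
  proof -
    have "p ^ j * p \<noteq> 1" for j
    proof
      assume "p ^ j * p = 1"
      then have "norm p ^ Suc j = 1" by (metis norm_one norm_power power_Suc2)
      then show False using p by (metis norm_ge_zero power_Suc_less_one less_irrefl power_0_Suc zero_neq_one order.order_iff_strict)
    qed
    then show ?thesis by (simp add: qpoch_eq_0)
  qed
  ultimately have d0: "deriv ?b 0 \<noteq> 0" by (simp add: Q_def)
  have stepP: "?b (x + 2 * pi * \<i>) = 0 \<and> deriv ?b (x + 2 * pi * \<i>) = - deriv ?b x" if "?b x = 0" for x
  proof -
    have "((\<lambda>x. ?b (x + 2 * pi * \<i>)) has_field_derivative deriv ?b (x + 2 * pi * \<i>)) (at x)"
      using d[of "x + 2 * pi * \<i>"] by (simp add: DERIV_shift)
    moreover have "(\<lambda>x. ?b (x + 2 * pi * \<i>)) = (\<lambda>x. - ?b x)"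
      using bracket_shift by (simp add: mult_ac)
    moreover have "((\<lambda>x. - ?b x) has_field_derivative - deriv ?b x) (at x)"
      by (intro DERIV_minus d)
    ultimately show ?thesis using that bracket_shift[of x] by (auto simp: mult_ac dest: DERIV_unique)
  qed
  have stepL: "?b (x + Ln p) = 0 \<and> deriv ?b (x + Ln p) = - exp (- Ln p / 2 - x) * deriv ?b x" if "?b x = 0" for x
  proof -
    have "((\<lambda>x. ?b (x + Ln p)) has_field_derivative deriv ?b (x + Ln p)) (at x)"
      using d[of "x + Ln p"] by (simp add: DERIV_shift)
    moreover have "((\<lambda>x. - exp (- Ln p / 2 - x) * ?b x) has_field_derivative
        exp (- Ln p / 2 - x) * ?b x + deriv ?b x * (- exp (- Ln p / 2 - x))) (at x)"
      by (rule DERIV_mult[OF _ d]) (auto intro!: derivative_eq_intros)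
    ultimately show ?thesis using that bracket_period[OF p0]
      by (auto simp: mult_ac dest: DERIV_unique)
  qed
  \<comment> \<open>Both conditions on \<open>s\<close> are equivalences so that the induction can
    also go down to negative integers.\<close>
  have int: "?b (x + of_int m * s) = 0 \<and> deriv ?b (x + of_int m * s) \<noteq> 0"
    if s: "\<And>x. ?b (x + s) = 0 \<longleftrightarrow> ?b x = 0" "\<And>x. ?b x = 0 \<Longrightarrow> deriv ?b (x + s) = 0 \<longleftrightarrow> deriv ?b x = 0"
      and x: "?b x = 0" "deriv ?b x \<noteq> 0" for m :: int and s x
  proof (induction m rule: int_induct[where k = 0])
    case base
    then show ?case using x by simp
  next
    case (step1 i)
    then show ?case using s[of "x + of_int i * s"] by (simp add: algebra_simps)
  next
    case (step2 i)
    have e: "x + of_int (i - 1) * s + s = x + of_int i * s" by (simp add: algebra_simps)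
    show ?case
      using s(1)[of "x + of_int (i - 1) * s", unfolded e] s(2)[of "x + of_int (i - 1) * s", unfolded e] step2(2)
      by blast
  qed
  obtain m l :: int where ml: "z = of_int m * Ln p + of_int l * (2 * pi * \<i>)"
    using bracket_zeros[OF p0 z] .
  have "?b 0 = 0" by (simp add: bQ)
  then have "?b (0 + of_int m * Ln p) = 0 \<and> deriv ?b (0 + of_int m * Ln p) \<noteq> 0"
    by (intro int d0) (use stepL bracket_period[OF p0] in auto)
  then have "?b (0 + of_int m * Ln p + of_int l * (2 * pi * \<i>)) = 0 \<and> deriv ?b (0 + of_int m * Ln p + of_int l * (2 * pi * \<i>)) \<noteq> 0"
    by (intro int) (use stepP bracket_shift in \<open>auto simp: mult_ac\<close>)
  then show ?thesis by (simp add: ml)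
qed

lemma bracket_continuous: "continuous_on A (theta_bracket p)"
  using bracket_holomorphic holomorphic_on_imp_continuous_on continuous_on_subset by blast

lemma bracket_diff_swap: "theta_bracket p (x - y) = - theta_bracket p (y - x)"
  using bracket_minus[of "y - x"] by simp

lemma countable_bracket_zeros:
  assumes "p \<noteq> 0"
  shows "countable {z. theta_bracket p z = 0}"
proof (rule countable_subset)
  show "{z. theta_bracket p z = 0} \<subseteq> (\<lambda>(m :: int, l :: int). of_int m * Ln p + of_int l * (2 * pi * \<i>)) ` UNIV"
    using bracket_zeros[OF assms] by (auto simp: image_iff) metis
qed simp

text \<open>The quotient of the two sides is an entire elliptic function of \<open>x\<close>; it vanishes at \<open>x = v\<close>.\<close>

lemma bracket_three_term_generic:
  assumes p0: "p \<noteq> 0" and nz: "theta_bracket p (2 * u) \<noteq> 0" "theta_bracket p (v + u) \<noteq> 0" "theta_bracket p (v - u) \<noteq> 0"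
  defines "b \<equiv> theta_bracket p"
  shows "b (x + y) * b (x - y) * b (u + v) * b (u - v) - b (x + v) * b (x - v) * b (u + y) * b (u - y)
        - b (y + v) * b (y - v) * b (x + u) * b (x - u) = 0"
proof -
  define F where "F x = b (x + y) * b (x - y) * (b (u + v) * b (u - v)) - b (x + v) * b (x - v) * (b (u + y) * b (u - y))
        - b (y + v) * b (y - v) * (b (x + u) * b (x - u))" for x
  define G where "G x = b (x + u) * b (x - u)" for x
  note sw = bracket_diff_swap[folded b_def]
  note mn = bracket_minus[folded b_def]
  have b0: "b 0 = 0" using mn[of 0] by simp
  have hol: "(\<lambda>x. b (x + c)) holomorphic_on UNIV" "(\<lambda>x. b (x - c)) holomorphic_on UNIV" for c
    unfolding b_def
    by (intro holomorphic_on_compose_gen[OF _ bracket_holomorphic, unfolded o_def] holomorphic_intros; simp)+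
  have F: "F holomorphic_on UNIV" and G: "G holomorphic_on UNIV"
    unfolding F_def G_def by (intro holomorphic_intros hol)+
  have perP: "b (x + 2 * pi * \<i> + c) * b (x + 2 * pi * \<i> - c) = b (x + c) * b (x - c)" for x c
    using bracket_shift[of "x + c"] bracket_shift[of "x - c"] unfolding b_def by (simp add: algebra_simps)
  \<comment> \<open>The multiplier of \<open>b (x + c) * b (x - c)\<close> under \<open>Ln p\<close>
    does not depend on \<open>c\<close>; so the three terms of \<open>F\<close> and also
    \<open>G\<close> share it, and it drops out of the quotient.\<close>
  define M where "M x = exp (- Ln p - 2 * x)" for x
  have perL: "b (x + Ln p + c) * b (x + Ln p - c) = M x * (b (x + c) * b (x - c))" for x c
  proof -
    have "exp (- Ln p / 2 - (x + c)) * exp (- Ln p / 2 - (x - c)) = M x"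
      unfolding M_def by (simp flip: exp_add)
    then show ?thesis
      using bracket_period[OF p0, of "x + c"] bracket_period[OF p0, of "x - c"]
      unfolding b_def by (simp add: algebra_simps)
  qed
  have FP: "F (x + 2 * pi * \<i>) = F x" and GP: "G (x + 2 * pi * \<i>) = G x" for x
    unfolding F_def G_def perP by simp_all
  have FL: "F (x + Ln p) = M x * F x" and GL: "G (x + Ln p) = M x * G x" for x
    unfolding F_def G_def perL by (simp_all add: algebra_simps)
  have M: "M x \<noteq> 0" for x by (simp add: M_def)
  have F_int: "F (z + of_int m * Ln p + of_int l * (2 * pi * \<i>)) = 0" if "F z = 0" for m l :: int and z
  proof -
    have 1: "F (z + of_int m * Ln p) = 0"
    proof (induction m rule: int_induct[where k = 0])
      case base then show ?case using that by simp
    next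
      case (step1 i)
      then show ?case using FL[of "z + of_int i * Ln p"] by (simp add: algebra_simps)
    next
      case (step2 i)
      have e: "z + of_int (i - 1) * Ln p + Ln p = z + of_int i * Ln p" by (simp add: algebra_simps)
      show ?case using FL[of "z + of_int (i - 1) * Ln p", unfolded e] step2(2) M by simp
    qed
    show ?thesis
    proof (induction l rule: int_induct[where k = 0])
      case base then show ?case using 1 by simp
    next
      case (step1 i)
      then show ?case using FP[of "z + of_int m * Ln p + of_int i * (2 * pi * \<i>)"] by (simp add: algebra_simps)
    next
      case (step2 i)
      have e: "z + of_int m * Ln p + of_int (i - 1) * (2 * pi * \<i>) + 2 * pi * \<i> = z + of_int m * Ln p + of_int i * (2 * pi * \<i>)"
        by (simp add: algebra_simps)
      show ?case using FP[of "z + of_int m * Ln p + of_int (i - 1) * (2 * pi * \<i>)", unfolded e] step2(2) by simp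
    qed
  qed
  \<comment> \<open>At \<open>x = u\<close> the first two terms agree and the third vanishes;
    \<open>F (- u)\<close> has the same value. Translates of these two points by the quasi-periods
    are all the zeros of \<open>G\<close>.\<close>
  have Fu: "F u = 0" unfolding F_def by (simp add: b0)
  have "F (- u) = F u"
  proof -
    have e: "b (- u + c) * b (- u - c) = b (u + c) * b (u - c)" for c
    proof -
      have "- u + c = - (u - c)" "- u - c = - (u + c)" by simp_all
      then show ?thesis by (simp only: mn mult_minus_left mult_minus_right minus_minus mult.commute)
    qed
    show ?thesis unfolding F_def e ..
  qed
  then have Fmu: "F (- u) = 0" using Fu by simp
  have zero: "F z = 0" if "G z = 0" for z
  proof -
    have "b (z + u) = 0 \<or> b (z - u) = 0" using that unfolding G_def by simp
    then show ?thesis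
    proof
      assume "b (z + u) = 0"
      then obtain m l :: int where "z + u = of_int m * Ln p + of_int l * (2 * pi * \<i>)"
        using bracket_zeros[OF p0] unfolding b_def by blast
      then have "z = - u + of_int m * Ln p + of_int l * (2 * pi * \<i>)" by (simp add: algebra_simps)
      then show ?thesis using F_int[OF Fmu] by simp
    next
      assume "b (z - u) = 0"
      then obtain m l :: int where "z - u = of_int m * Ln p + of_int l * (2 * pi * \<i>)"
        using bracket_zeros[OF p0] unfolding b_def by blast
      then have "z = u + of_int m * Ln p + of_int l * (2 * pi * \<i>)" by (simp add: algebra_simps)
      then show ?thesis using F_int[OF Fu] by simp
    qed
  qed
  have dG: "deriv G z \<noteq> 0" if "G z = 0" for z
  proof -
    have d: "(b has_field_derivative deriv b x) (at x)" for x
      unfolding b_def using bracket_holomorphic by (auto intro: holomorphic_derivI)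
    have d1: "((\<lambda>x. b (x + u)) has_field_derivative deriv b (z + u)) (at z)"
      using d[of "z + u"] by (simp add: DERIV_shift)
    have d2: "((\<lambda>x. b (x - u)) has_field_derivative deriv b (z - u)) (at z)"
      using d[of "z - u"] DERIV_shift[of b _ z "- u"] by simp
    have "(G has_field_derivative deriv b (z + u) * b (z - u) + deriv b (z - u) * b (z + u)) (at z)"
      unfolding G_def by (rule DERIV_mult[OF d1 d2])
    then have e: "deriv G z = deriv b (z + u) * b (z - u) + deriv b (z - u) * b (z + u)"
      by (rule DERIV_imp_deriv)
    \<comment> \<open>A common zero of both factors would be a double zero of \<open>G\<close>; it
      is excluded because it would force \<open>b (2 * u) = 0\<close>.\<close>
    have "\<not> (b (z + u) = 0 \<and> b (z - u) = 0)"
      using bracket_zero_diff[of "z + u" "z - u"] nz(1) unfolding b_def by (auto simp: algebra_simps)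
    moreover have "b w = 0 \<Longrightarrow> deriv b w \<noteq> 0" for w
      unfolding b_def by (rule bracket_deriv_nonzero[OF p0])
    ultimately show ?thesis using that unfolding e G_def by auto
  qed
  obtain H where H: "H holomorphic_on UNIV" "\<And>z. F z = H z * G z"
    using entire_quotient[OF F G zero dG] by blast
  have cG: "countable {z. G z = 0}"
  proof (rule countable_subset)
    show "{z. G z = 0} \<subseteq> (\<lambda>z. z - u) ` {z. b z = 0} \<union> (\<lambda>z. z + u) ` {z. b z = 0}"
      unfolding G_def by (auto simp: image_iff) (metis add_diff_cancel diff_add_cancel)+
    show "countable ((\<lambda>z. z - u) ` {z. b z = 0} \<union> (\<lambda>z. z + u) ` {z. b z = 0})"
      using countable_bracket_zeros[OF p0] unfolding b_def by auto
  qed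
  have cH: "continuous_on UNIV H" by (rule holomorphic_on_imp_continuous_on[OF H(1)])
  \<comment> \<open>Periodicity is immediate where \<open>G\<close> does not vanish and extends to
    its countably many zeros by continuity.\<close>
  have per: "H (z + t) - H z = 0" if t: "\<And>x. F (x + t) * G x = F x * G (x + t)" "\<And>x. G x \<noteq> 0 \<Longrightarrow> G (x + t) \<noteq> 0" for t z
  proof (rule continuous_zero_off_countable[where f = "\<lambda>z. H (z + t) - H z", OF _ cG])
    show "continuous_on UNIV (\<lambda>z. H (z + t) - H z)"
      by (intro continuous_intros cH continuous_on_compose2[OF cH]) auto
    fix z assume "z \<notin> {z. G z = 0}"
    then show "H (z + t) - H z = 0" using t[of z] unfolding H(2) by simp
  qed
  have "norm p \<noteq> 1" using p by simp
  then have "Re (Ln p) \<noteq> 0" using p0 p by (simp add: ln_eq_zero_iff)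
  then have const: "H z = H w" for z w
    by (rule entire_elliptic_const[OF H(1)])
       (use per[of "Ln p"] per[of "2 * pi * \<i>"] FL GL FP GP M in auto)
  have "F v = 0"
  proof -
    have "b (v + u) * b (v - u) = - (b (u + v) * b (u - v))" using sw[of v u] by (simp add: add.commute)
    moreover have "b (v + y) * b (v - y) = - (b (y + v) * b (y - v))" using sw[of v y] by (simp add: add.commute)
    ultimately show ?thesis unfolding F_def using b0 by simp
  qed
  then have "H v = 0" using H(2)[of v] nz(2,3) unfolding G_def b_def by simp
  then have "F x = 0" unfolding H(2) using const[of x v] by simp
  then show ?thesis unfolding F_def by (simp add: mult.assoc)
qed

text \<open>For \<open>p = 0\<close> there is no second quasi-period; the bracket is then a multiple
  of a hyperbolic sine, and \<open>b (s + t) * b (s - t)\<close> is a difference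
  \<open>c s - c t\<close>, which makes the relation a polynomial identity. For
  \<open>p \<noteq> 0\<close> the exceptional values of \<open>u\<close> are countable and are
  reached by continuity.\<close>

theorem bracket_three_term:
  defines "b \<equiv> theta_bracket p"
  shows "b (x + y) * b (x - y) * b (u + v) * b (u - v) - b (x + v) * b (x - v) * b (u + y) * b (u - y)
        = b (y + v) * b (y - v) * b (x + u) * b (x - u)"
proof (cases "p = 0")
  case True
  have "qpoch_inf p z = 1 - z" for z
    using qpoch_shift[of z] qpoch_shift[of 0] True LIMSEQ_unique[OF qpoch_LIMSEQ[of 0]] by simp
  then have b: "b z = exp (- z / 2) * (1 - exp z)" for z
    unfolding b_def bracket_qpoch using True by simp
  define c where "c z = exp z + exp (- z)" for z :: complex
  have bb: "b (s + t) * b (s - t) = c s - c t" for s t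
  proof -
    have "b (s + t) * b (s - t) = exp (- (s + t) / 2) * exp (- (s - t) / 2) * ((1 - exp (s + t)) * (1 - exp (s - t)))"
      unfolding b by (simp only: mult_ac)
    also have "exp (- (s + t) / 2) * exp (- (s - t) / 2) = exp (- s)"
      by (simp add: field_simps flip: exp_add)
    finally show ?thesis unfolding c_def by (simp add: algebra_simps flip: exp_add)
  qed
  have "b (x + y) * b (x - y) * (b (u + v) * b (u - v)) - b (x + v) * b (x - v) * (b (u + y) * b (u - y))
        = b (y + v) * b (y - v) * (b (x + u) * b (x - u))"
    unfolding bb by (simp add: algebra_simps)
  then show ?thesis by (simp only: mult.assoc)
next
  case False
  define C where "C = {u. theta_bracket p (2 * u) = 0} \<union> {u. theta_bracket p (v + u) = 0} \<union> {u. theta_bracket p (v - u) = 0}"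
  have "countable C"
  proof -
    have "{u. theta_bracket p (2 * u) = 0} \<subseteq> (\<lambda>z. z / 2) ` {z. theta_bracket p z = 0}"
      "{u. theta_bracket p (v + u) = 0} \<subseteq> (\<lambda>z. z - v) ` {z. theta_bracket p z = 0}"
      "{u. theta_bracket p (v - u) = 0} \<subseteq> (\<lambda>z. v - z) ` {z. theta_bracket p z = 0}"
      by (rule subsetI, rule_tac x = "2 * x" in image_eqI, simp, simp,
          rule subsetI, rule_tac x = "v + x" in image_eqI, simp, simp,
          rule subsetI, rule_tac x = "v - x" in image_eqI, simp, simp)
    then show ?thesis unfolding C_def using countable_bracket_zeros[OF False]
      by (meson countable_Un countable_image countable_subset)
  qed
  define f where "f u = b (x + y) * b (x - y) * b (u + v) * b (u - v) - b (x + v) * b (x - v) * b (u + y) * b (u - y)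
        - b (y + v) * b (y - v) * b (x + u) * b (x - u)" for u
  have "f u = 0"
  proof (rule continuous_zero_off_countable[where f = f, OF _ \<open>countable C\<close>])
    show "continuous_on UNIV f"
      unfolding f_def b_def by (intro continuous_intros continuous_on_compose2[OF bracket_continuous]) auto
    show "f u = 0" if "u \<notin> C" for u
      unfolding f_def b_def using that unfolding C_def by (intro bracket_three_term_generic[OF False]) auto
  qed
  then show ?thesis unfolding f_def by simp
qed

lemma odd_bracket_theta: "odd_bracket (theta_bracket p)"
  by unfold_locales (use bracket_minus bracket_three_term bracket_zero_diff in auto)

end

section \<open>Translation of the summand\<close>

lemma index_pairs_eq: "index_pairs r = ordered_pairs {1..r}"
  by (auto simp: index_pairs_def ordered_pairs_def)

text \<open>The square of \<open>I\<close> consists of the diagonal, the ordered pairs and their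
  mirror images. The setting of commutative monoids serves sums of exponents and products of factors
  at once.\<close>

lemma (in comm_monoid_set) square_ordered_pairs:
  assumes "finite I"
  shows "F (\<lambda>i. F (g i) I) I
    = F (\<lambda>i. g i i) I \<^bold>* F (\<lambda>(i, j). g i j \<^bold>* g j i) (ordered_pairs I)"
proof -
  let ?O = "ordered_pairs I" and ?R = "(\<lambda>(i, j). (j, i)) ` ordered_pairs I" and ?E = "(\<lambda>i. (i, i)) ` I"
  have "I \<times> I = ?E \<union> (?O \<union> ?R)"
    by (auto simp: ordered_pairs_def image_iff)
  moreover have "?E \<inter> (?O \<union> ?R) = {}" "?O \<inter> ?R = {}" by (auto simp: ordered_pairs_def)
  ultimately have "F (case_prod g) (I \<times> I) = F (case_prod g) ?E \<^bold>* (F (case_prod g) ?O \<^bold>* F (case_prod g) ?R)"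
    using assms by (simp add: union_disjoint)
  also have "F (case_prod g) ?E = F (\<lambda>i. g i i) I"
    by (subst reindex) (auto simp: inj_on_def comp_def)
  also have "F (case_prod g) ?R = F (\<lambda>(i, j). g j i) ?O"
    by (subst reindex) (auto simp: inj_on_def case_prod_unfold comp_def)
  finally show ?thesis
    by (simp add: cartesian_product distrib case_prod_unfold)
qed

lemma sum_ordered_pairs_add:
  fixes f :: "nat \<Rightarrow> complex"
  assumes "finite I"
  shows "(\<Sum>(i, j)\<in>ordered_pairs I. f i + f j) = (of_nat (card I) - 1) * sum f I"
  using sum.square_ordered_pairs[OF assms, of "\<lambda>i j. f i"] by (simp add: algebra_simps flip: sum_distrib_right)

lemma sum_ordered_pairs_mult:
  fixes f g :: "nat \<Rightarrow> complex"
  assumes "finite I"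
  shows "(\<Sum>(i, j)\<in>ordered_pairs I. f i * g j + f j * g i) = sum f I * sum g I - (\<Sum>i\<in>I. f i * g i)"
  using sum.square_ordered_pairs[OF assms, of "\<lambda>i j. f i * g j"]
  by (simp add: sum_product)

text \<open>The summand of the theorem verbatim, with \<open>a\<close> and \<open>x\<close> as
  arguments because the limit argument varies both.\<close>

definition jackson_term :: "complex \<Rightarrow> complex \<Rightarrow> nat \<Rightarrow> (nat \<Rightarrow> nat) \<Rightarrow> complex \<Rightarrow> (nat \<Rightarrow> complex) \<Rightarrow> (nat \<Rightarrow> nat) \<Rightarrow> complex" where
  "jackson_term p q r n a x k =
        Delta r (\<lambda>i. x i * q ^ (4 * k i)) p / Delta r x p
        * q powi (int (tuple_sum r k) - 3 * int (e2 r k))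
        * (ell_facts [- 1, - q, - (q\<^sup>2)] (q\<^sup>2) p (tuple_sum r k)
           / (\<Prod>(i, j)\<in>index_pairs r.
                ell_fact (- a\<^sup>2 * x i * x j * q) (q ^ 4) p (k i + k j)))
        * (\<Prod>i = 1..r.
             theta (a * x i * q ^ (tuple_sum r k + 4 * k i)) p / theta (a * x i) p
             * (ell_fact (a * x i) q p (tuple_sum r k)
                * ell_fact (- 1 / (a * x i)) q p (tuple_sum r k - k i)
                / (ell_facts [a * x i * q ^ (4 * n i + 1),
                              - (q powi (- 4 * int (n i))) / (a * x i)] q p (tuple_sum r k)
                   * ell_fact (- (q powi (int (k i) - int (tuple_sum r k) + 1)) * a * x i)
                       q p (3 * k i))))
        * (\<Prod>i = 1..r. \<Prod>j = 1..r.
             ell_facts [q powi (- 4 * int (n j)) * x i / x j,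
                        - a\<^sup>2 * x i * x j * q ^ (4 * n j + 1)] (q ^ 4) p (k i)
             / ell_fact (q ^ 4 * x i / x j) (q ^ 4) p (k i))"

locale theta_base =
  fixes p q \<eta> :: complex
  assumes norm_p: "norm p < 1" and exp_eta: "exp \<eta> = q"
    and q_pow: "\<And>k::nat. k > 0 \<Longrightarrow> (if p = 0 then q ^ k \<noteq> 1 else \<forall>m::int. q ^ k \<noteq> p powi m)"
begin

abbreviation \<theta> :: "complex \<Rightarrow> complex" where "\<theta> \<equiv> theta_bracket p"

abbreviation \<pi>i :: complex where "\<pi>i \<equiv> \<i> * pi"

lemma exp_pii: "exp \<pi>i = -1"
  by (simp add: exp_eq_polar)

lemma q_powi: "q powi m = exp (of_int m * \<eta>)"
  unfolding exp_eta[symmetric] by (simp add: exp_power_int)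

lemma q_power: "q ^ m = exp (of_nat m * \<eta>)"
  using q_powi[of "int m"] by simp

lemma q_powi_not_zero:
  assumes "m \<noteq> 0"
  shows "\<not> (if p = 0 then q powi m = 1 else \<exists>l::int. q powi m = p powi l)"
proof -
  have nat: "\<not> (if p = 0 then q powi m = 1 else \<exists>l::int. q powi m = p powi l)" if "0 < m" for m
    using q_pow[of "nat m"] that by (auto simp: power_int_def split: if_splits)
  show ?thesis
  proof (cases "0 < m")
    case False
    then have m: "0 < - m" using assms by simp
    have "q powi m = inverse (q powi (- m))" by (simp add: power_int_minus)
    moreover have "inverse (q powi (- m)) = p powi l \<Longrightarrow> q powi (- m) = p powi (- l)" for l
      by (simp add: power_int_minus)
    ultimately show ?thesis using nat[OF m] by auto
  next
    case True
    then show ?thesis by (rule nat)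
  qed
qed

sublocale odd_bracket "\<theta>"
  by (rule odd_bracket_theta[OF norm_p])

sublocale quartic_bracket "\<theta>" \<eta> \<pi>i
proof unfold_locales
  show "\<theta> (z + 2 * \<pi>i) = - \<theta> z" for z by (rule bracket_shift[OF norm_p])
  show "\<theta> (of_int m * \<eta>) \<noteq> 0" if "m \<noteq> 0" for m
    using q_powi_not_zero[OF that] unfolding bracket_eq_0[OF norm_p] q_powi by simp
  \<comment> \<open>For \<open>m \<noteq> 0\<close>, if \<open>- (q powi m)\<close> were an integer
    power of \<open>p\<close> (or 1 when \<open>p = 0\<close>), so would be its square
    \<open>q powi (2 * m)\<close>, which is excluded. For \<open>m = 0\<close>, the number -1 is no
    integer power of \<open>p\<close> since the norm of \<open>p\<close> is below 1.\<close>
  show "\<theta> (\<pi>i + of_int m * \<eta>) \<noteq> 0" for m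
  proof
    assume "\<theta> (\<pi>i + of_int m * \<eta>) = 0"
    then have *: "if p = 0 then - (q powi m) = 1 else \<exists>l::int. - (q powi m) = p powi l"
      unfolding bracket_eq_0[OF norm_p] exp_add exp_pii q_powi mult_minus1 .
    show False
    proof (cases "m = 0")
      case False
      have sq: "q powi (2 * m) = (- (q powi m))\<^sup>2" by (simp add: power_int_mult power2_eq_square power_int_mult_distrib)
      have "if p = 0 then q powi (2 * m) = 1 else \<exists>l::int. q powi (2 * m) = p powi l"
      proof (cases "p = 0")
        case True
        then show ?thesis using * unfolding sq by simp
      next
        case F: False
        then obtain l :: int where "- (q powi m) = p powi l" using * by auto
        then have "q powi (2 * m) = p powi (2 * l)"
          unfolding sq using F by (simp add: power_int_mult power2_eq_square power_int_mult_distrib)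
        then show ?thesis using F by auto
      qed
      then show False using q_powi_not_zero[of "2 * m"] False by simp
    next
      case True
      then have p0: "p \<noteq> 0" using * by auto
      then obtain l :: int where l: "- 1 = p powi l" using * True by auto
      then have "norm p powi l = 1" by (metis norm_minus_cancel norm_one norm_power_int)
      moreover have "norm p powi l \<noteq> 1" if "l \<noteq> 0"
        using power_strict_decreasing[of 0 "nat l" "norm p"] power_strict_decreasing[of 0 "nat (- l)" "norm p"]
          that p0 norm_p by (auto simp: power_int_def power_inverse)
      ultimately have "l = 0" by blast
      then show False using l by simp
    qed
  qed
qed

lemma theta_exp: "theta (exp z) p = exp (z / 2) * \<theta> z"
  unfolding theta_bracket_def by (simp add: mult.assoc[symmetric] flip: exp_add)

text \<open>The exponent is the sum of \<open>(z + j * h) / 2\<close> over \<open>j < k\<close>,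
  that is, of the prefactors that separate theta functions from brackets.\<close>

lemma ell_fact_exp:
  "ell_fact (exp z) (exp h) p k
    = exp (of_nat k * z / 2 + of_nat k * (of_nat k - 1) / 4 * h) * sfac h z k"
proof (induction k)
  case 0
  then show ?case by (simp add: ell_fact_def)
next
  case (Suc k)
  have "exp z * exp h ^ k = exp (z + of_nat k * h)" by (simp add: exp_add exp_of_nat_mult)
  then have "ell_fact (exp z) (exp h) p (Suc k)
    = ell_fact (exp z) (exp h) p k * (exp ((z + of_nat k * h) / 2) * \<theta> (z + of_nat k * h))"
    unfolding ell_fact_def by (simp add: theta_exp)
  also have "\<dots> = (exp (of_nat k * z / 2 + of_nat k * (of_nat k - 1) / 4 * h) * exp ((z + of_nat k * h) / 2))
      * sfac h z (Suc k)"
    unfolding Suc.IH sfac_Suc by (simp add: mult_ac)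
  also have "exp (of_nat k * z / 2 + of_nat k * (of_nat k - 1) / 4 * h) * exp ((z + of_nat k * h) / 2)
    = exp (of_nat (Suc k) * z / 2 + of_nat (Suc k) * (of_nat (Suc k) - 1) / 4 * h)"
    unfolding exp_add[symmetric] by (rule arg_cong[of _ _ exp]) (simp add: field_simps)
  finally show ?case .
qed

lemma bracket_reflect: "\<theta> (\<pi>i - u) = \<theta> (\<pi>i + u)"
proof -
  have "\<pi>i - u = - (\<pi>i + u) + 2 * \<pi>i" by simp
  then show ?thesis by (simp only: br_shift br_minus minus_minus)
qed

lemma gfac_add:
  assumes "\<And>m. \<theta> (z + of_int m * \<eta>) \<noteq> 0"
  shows "gfac z (N + int n) = gfac z N * sfac \<eta> (z + of_int N * \<eta>) n"
proof (induction n)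
  case (Suc n)
  have "gfac z (N + int (Suc n)) = gfac z (N + int n) * \<theta> (z + of_int (N + int n) * \<eta>)"
    using gfac_step[OF assms, of "N + int n"] by (simp add: algebra_simps)
  then show ?case unfolding Suc.IH sfac_Suc by (simp add: algebra_simps)
qed simp

text \<open>Reflection about \<open>\<pi>i\<close> reverses the order of the arguments, hence the
  new starting offset \<open>1 - n\<close>.\<close>

lemma sfac_reflect: "sfac \<eta> (\<pi>i - z) n = sfac \<eta> (z + \<pi>i + of_int (1 - int n) * \<eta>) n"
proof -
  have "sfac \<eta> (\<pi>i - z) n = (\<Prod>m<n. \<theta> (\<pi>i + z - of_nat m * \<eta>))"
    unfolding sfac_def
  proof (rule prod.cong[OF refl])
    fix m
    show "\<theta> (\<pi>i - z + of_nat m * \<eta>) = \<theta> (\<pi>i + z - of_nat m * \<eta>)"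
      using bracket_reflect[of "z - of_nat m * \<eta>"] by (simp add: algebra_simps)
  qed
  also have "\<dots> = (\<Prod>m<n. \<theta> (\<pi>i + z - of_nat (n - Suc m) * \<eta>))"
    by (rule prod.nat_diff_reindex[symmetric])
  also have "\<dots> = sfac \<eta> (z + \<pi>i + of_int (1 - int n) * \<eta>) n"
    unfolding sfac_def
  proof (rule prod.cong[OF refl])
    fix m assume "m \<in> {..<n}"
    then have e: "of_nat (n - Suc m) = (of_nat n - 1 - of_nat m :: complex)" by (simp add: of_nat_diff)
    show "\<theta> (\<pi>i + z - of_nat (n - Suc m) * \<eta>)
      = \<theta> (z + \<pi>i + of_int (1 - int n) * \<eta> + of_nat m * \<eta>)"
      unfolding e by (simp add: algebra_simps)
  qed
  finally show ?thesis .
qed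

text \<open>After reflection both factorials start at offset \<open>k - K + 1\<close>. The numerator
  extends to offset 1, where \<open>gfac\<close> is a single bracket, and the denominator extends to
  \<open>4k - K + 1\<close>; the common initial part of \<open>gfac\<close> cancels.\<close>

lemma gfac_quotient:
  assumes nz: "\<And>m. \<theta> (z + \<pi>i + of_int m * \<eta>) \<noteq> 0" and k: "k \<le> K"
  shows "sfac \<eta> (\<pi>i - z) (K - k) / sfac \<eta> (z + \<pi>i + of_int (int k - int K + 1) * \<eta>) (3 * k)
    = \<theta> (z + \<pi>i) / gfac (z + \<pi>i) (4 * int k - int K + 1)"
proof -
  let ?N = "int k - int K + 1"
  have e: "1 - int (K - k) = ?N" using k by simp
  have "gfac (z + \<pi>i) (?N + int (K - k)) = gfac (z + \<pi>i) ?N * sfac \<eta> (\<pi>i - z) (K - k)"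
    unfolding gfac_add[OF nz] sfac_reflect e ..
  moreover have "?N + int (K - k) = 1" using k by simp
  ultimately have 1: "\<theta> (z + \<pi>i) = gfac (z + \<pi>i) ?N * sfac \<eta> (\<pi>i - z) (K - k)"
    by (simp add: gfac_def sfac_Suc)
  have e3: "?N + int (3 * k) = 4 * int k - int K + 1" by simp
  have 2: "gfac (z + \<pi>i) (4 * int k - int K + 1)
      = gfac (z + \<pi>i) ?N * sfac \<eta> (z + \<pi>i + of_int ?N * \<eta>) (3 * k)"
    using gfac_add[OF nz, of ?N "3 * k"] unfolding e3 .
  have "\<theta> (z + \<pi>i) \<noteq> 0" using nz[of 0] by simp
  then have "gfac (z + \<pi>i) ?N \<noteq> 0" using 1 by auto
  then show ?thesis unfolding 1 2 by simp
qed

context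
  fixes r :: nat and n k :: "nat \<Rightarrow> nat" and a :: complex and x \<xi> :: "nat \<Rightarrow> complex"
  assumes a: "a \<noteq> 0" and x: "\<And>i. i \<in> {1..r} \<Longrightarrow> a * x i = exp (\<xi> i)"
    and g: "generic {1..r} \<xi>"
begin

lemma x_eq: "i \<in> {1..r} \<Longrightarrow> x i = exp (\<xi> i) / a"
  using x a by (simp add: field_simps)

lemma Delta_ratio:
  "Delta r (\<lambda>i. x i * q ^ (4 * k i)) p / Delta r x p
    = (\<Prod>(i, j)\<in>ordered_pairs {1..r}. exp (2 * (of_nat (k i) + of_nat (k j)) * \<eta>)
        * (\<theta> (node (\<xi> i) (k i) - node (\<xi> j) (k j)) / \<theta> (\<xi> i - \<xi> j)))"
  unfolding Delta_def index_pairs_eq prod_dividef[symmetric] case_prod_unfold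
proof (rule prod.cong[OF refl])
  fix ij assume "ij \<in> ordered_pairs {1..r}"
  then obtain i j where ij: "ij = (i, j)" "i \<in> {1..r}" "j \<in> {1..r}" by (auto simp: ordered_pairs_def)
  let ?d = "node (\<xi> i) (k i) - node (\<xi> j) (k j)"
  have 1: "x i * q ^ (4 * k i) / (x j * q ^ (4 * k j)) = exp ?d"
    unfolding x_eq[OF ij(2)] x_eq[OF ij(3)] q_power node_def using a
    by (simp add: exp_diff exp_add mult_ac)
  have 2: "x i / x j = exp (\<xi> i - \<xi> j)"
    unfolding x_eq[OF ij(2)] x_eq[OF ij(3)] using a by (simp add: exp_diff)
  have xj: "x j \<noteq> 0" using x[OF ij(3)] by auto
  have "exp (of_nat (4 * k j) * \<eta>) * exp (?d / 2)
     = exp (2 * (of_nat (k i) + of_nat (k j)) * \<eta>) * exp ((\<xi> i - \<xi> j) / 2)"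
    unfolding exp_add[symmetric] by (rule arg_cong[of _ _ exp]) (simp add: node_def field_simps)
  then have "exp (2 * (of_nat (k i) + of_nat (k j)) * \<eta>)
      = exp (of_nat (4 * k j) * \<eta>) * exp (?d / 2) / exp ((\<xi> i - \<xi> j) / 2)"
    by (simp add: field_simps)
  then show "x (snd ij) * q ^ (4 * k (snd ij)) * theta (x (fst ij) * q ^ (4 * k (fst ij)) / (x (snd ij) * q ^ (4 * k (snd ij)))) p
      / (x (snd ij) * theta (x (fst ij) / x (snd ij)) p)
    = exp (2 * (of_nat (k (fst ij)) + of_nat (k (snd ij))) * \<eta>)
        * (\<theta> (node (\<xi> (fst ij)) (k (fst ij)) - node (\<xi> (snd ij)) (k (snd ij)))
           / \<theta> (\<xi> (fst ij) - \<xi> (snd ij)))"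
    unfolding ij(1) fst_conv snd_conv 1 2 unfolding theta_exp q_power[of "4 * k j"] using xj by simp
qed

lemma numerator_facts:
  "ell_facts [- 1, - q, - (q\<^sup>2)] (q\<^sup>2) p K
    = exp (of_nat K * (3 * \<pi>i + 3 * \<eta>) / 2 + 3 * of_nat K * (of_nat K - 1) / 2 * \<eta>) * Nfac K"
proof -
  have e: "- 1 = exp \<pi>i" "- q = exp (\<pi>i + \<eta>)" "- (q\<^sup>2) = exp (\<pi>i + 2 * \<eta>)" "q\<^sup>2 = exp (2 * \<eta>)"
    using exp_pii by (simp_all add: exp_add exp_eta exp_double)
  let ?A = "exp (of_nat K * \<pi>i / 2 + of_nat K * (of_nat K - 1) / 4 * (2 * \<eta>))"
  let ?B = "exp (of_nat K * (\<pi>i + \<eta>) / 2 + of_nat K * (of_nat K - 1) / 4 * (2 * \<eta>))"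
  let ?C = "exp (of_nat K * (\<pi>i + 2 * \<eta>) / 2 + of_nat K * (of_nat K - 1) / 4 * (2 * \<eta>))"
  have ex: "exp (of_nat K * (3 * \<pi>i + 3 * \<eta>) / 2 + 3 * of_nat K * (of_nat K - 1) / 2 * \<eta>) = ?A * ?B * ?C"
    unfolding exp_add[symmetric] by (rule arg_cong[of _ _ exp]) (simp add: field_simps)
  have "ell_facts [- 1, - q, - (q\<^sup>2)] (q\<^sup>2) p K
    = (?A * sfac (2 * \<eta>) \<pi>i K) * ((?B * sfac (2 * \<eta>) (\<pi>i + \<eta>) K) * (?C * sfac (2 * \<eta>) (\<pi>i + 2 * \<eta>) K))"
    unfolding ell_facts_def list.map prod_list.Cons prod_list.Nil mult_1_right
    unfolding e(1,2,3) unfolding e(4) ell_fact_exp ..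
  then show ?thesis unfolding ex Nfac_def by (simp only: mult_ac)
qed

lemma pair_fact:
  assumes "i \<in> {1..r}" "j \<in> {1..r}"
  shows "ell_fact (- a\<^sup>2 * x i * x j * q) (q ^ 4) p N
    = exp (of_nat N * (\<xi> i + \<xi> j + (\<eta> + \<pi>i)) / 2 + of_nat N * (of_nat N - 1) * \<eta>)
      * sfac (4 * \<eta>) (\<xi> i + \<xi> j + (\<eta> + \<pi>i)) N"
proof -
  have "- a\<^sup>2 * x i * x j * q = exp (\<xi> i + \<xi> j + (\<eta> + \<pi>i))"
    unfolding exp_add exp_pii exp_eta x[OF assms(1), symmetric] x[OF assms(2), symmetric]
    by (simp add: power2_eq_square mult_ac)
  moreover have "q ^ 4 = exp (4 * \<eta>)" using q_power[of 4] by simp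
  moreover have "exp (of_nat N * (\<xi> i + \<xi> j + (\<eta> + \<pi>i)) / 2 + of_nat N * (of_nat N - 1) / 4 * (4 * \<eta>))
      = exp (of_nat N * (\<xi> i + \<xi> j + (\<eta> + \<pi>i)) / 2 + of_nat N * (of_nat N - 1) * \<eta>)"
    by (rule arg_cong[of _ _ exp]) (simp add: field_simps)
  ultimately show ?thesis by (simp only: ell_fact_exp)
qed

text \<open>Exponents of the factors in \<open>single_facts\<close>, in their order and with a minus
  sign for denominators. The upper end is absent because it enters the two denominators of length
  \<open>K\<close> with opposite signs.\<close>

definition single_exponent :: "nat \<Rightarrow> nat \<Rightarrow> complex" where
  "single_exponent K i = (of_nat K + 4 * of_nat (k i)) * \<eta> / 2
     + (of_nat K * \<xi> i / 2 + of_nat K * (of_nat K - 1) / 4 * \<eta>)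
     + ((of_nat K - of_nat (k i)) * (\<pi>i - \<xi> i) / 2 + (of_nat K - of_nat (k i)) * (of_nat K - of_nat (k i) - 1) / 4 * \<eta>)
     - (of_nat K * (\<pi>i + \<eta>) / 2 + of_nat K * (of_nat K - 1) / 2 * \<eta>)
     - (3 * of_nat (k i) * (\<pi>i + \<xi> i + (of_nat (k i) - of_nat K + 1) * \<eta>) / 2
        + 3 * of_nat (k i) * (3 * of_nat (k i) - 1) / 4 * \<eta>)"

lemma single_facts:
  assumes i: "i \<in> {1..r}" and kK: "k i \<le> K"
  shows "theta (a * x i * q ^ (K + 4 * k i)) p / theta (a * x i) p
             * (ell_fact (a * x i) q p K
                * ell_fact (- 1 / (a * x i)) q p (K - k i)
                / (ell_facts [a * x i * q ^ (4 * n i + 1),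
                              - (q powi (- 4 * int (n i))) / (a * x i)] q p K
                   * ell_fact (- (q powi (int (k i) - int K + 1)) * a * x i) q p (3 * k i)))
    = exp (single_exponent K i) * (Sfac (\<xi> i) (k i) K * sfac (4 * \<eta>) (4 * \<eta>) (k i)
       / (\<Prod>m<K. D (node (\<xi> i) (n i)) (- of_nat (Suc m) * \<eta>)))" (is "?lhs = _")
proof -
  let ?z = "node (\<xi> i) (n i)"
  have e1: "a * x i * q ^ (K + 4 * k i) = exp (node (\<xi> i) (k i) + of_nat K * \<eta>)"
    unfolding x[OF i] q_power exp_add[symmetric] by (simp add: node_def algebra_simps)
  have e2: "- 1 / (a * x i) = exp (\<pi>i - \<xi> i)"
    unfolding x[OF i] exp_diff exp_pii ..
  have e3: "a * x i * q ^ (4 * n i + 1) = exp (?z + \<eta>)"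
    unfolding x[OF i] q_power exp_add[symmetric] by (simp add: node_def algebra_simps)
  have e4: "- (q powi (- 4 * int (n i))) / (a * x i) = exp (\<pi>i - ?z)"
    unfolding x[OF i] q_powi node_def exp_diff exp_add exp_pii by (simp add: exp_minus field_simps)
  have e5: "- (q powi (int (k i) - int K + 1)) * a * x i = exp (\<xi> i + \<pi>i + of_int (int (k i) - int K + 1) * \<eta>)"
    unfolding mult.assoc[of _ a] x[OF i] q_powi exp_add exp_pii by simp
  have D: "sfac \<eta> (?z + \<eta>) K * sfac \<eta> (\<pi>i - ?z) K = (\<Prod>m<K. D ?z (- of_nat (Suc m) * \<eta>))"
    unfolding sfac_def prod.distrib[symmetric]
  proof (rule prod.cong[OF refl])
    fix m
    have "\<theta> (\<pi>i - ?z + of_nat m * \<eta>) = \<theta> (\<pi>i + (?z - of_nat m * \<eta>))"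
      using bracket_reflect[of "?z - of_nat m * \<eta>"] by (simp add: algebra_simps)
    then show "\<theta> (?z + \<eta> + of_nat m * \<eta>) * \<theta> (\<pi>i - ?z + of_nat m * \<eta>)
      = D ?z (- of_nat (Suc m) * \<eta>)"
      unfolding weier_def by (simp add: algebra_simps)
  qed
  have nz: "\<theta> (\<xi> i + \<pi>i + of_int m * \<eta>) \<noteq> 0" for m
    by (rule genericD(2)[OF g i])
  note gq = gfac_quotient[OF nz kK]
  have s4: "sfac (4 * \<eta>) (4 * \<eta>) (k i) \<noteq> 0"
  proof -
    have "\<theta> (4 * \<eta> + of_nat m * (4 * \<eta>)) \<noteq> 0" for m
      using br_eta[of "4 + 4 * int m"] by (simp add: algebra_simps)
    then show ?thesis unfolding sfac_def by simp
  qed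
  let ?A = "exp ((node (\<xi> i) (k i) + of_nat K * \<eta>) / 2)" and ?B = "exp (\<xi> i / 2)"
  let ?C = "exp (of_nat K * \<xi> i / 2 + of_nat K * (of_nat K - 1) / 4 * \<eta>)"
  let ?E = "exp (of_nat (K - k i) * (\<pi>i - \<xi> i) / 2 + of_nat (K - k i) * (of_nat (K - k i) - 1) / 4 * \<eta>)"
  let ?F = "exp (of_nat K * (?z + \<eta>) / 2 + of_nat K * (of_nat K - 1) / 4 * \<eta>)"
  let ?G = "exp (of_nat K * (\<pi>i - ?z) / 2 + of_nat K * (of_nat K - 1) / 4 * \<eta>)"
  let ?H = "exp (of_nat (3 * k i) * (\<xi> i + \<pi>i + of_int (int (k i) - int K + 1) * \<eta>) / 2 + of_nat (3 * k i) * (of_nat (3 * k i) - 1) / 4 * \<eta>)"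
  have ex: "?A / ?B * (?C * ?E / (?F * ?G * ?H)) = exp (single_exponent K i)"
    unfolding exp_add[symmetric] exp_diff[symmetric] single_exponent_def of_nat_diff[OF kK] node_def
    by (rule arg_cong[of _ _ exp]) (simp add: field_simps)
  have "?lhs
    = (?A * \<theta> (node (\<xi> i) (k i) + of_nat K * \<eta>)) / (?B * \<theta> (\<xi> i))
      * ((?C * sfac \<eta> (\<xi> i) K) * (?E * sfac \<eta> (\<pi>i - \<xi> i) (K - k i))
        / ((?F * sfac \<eta> (?z + \<eta>) K) * (?G * sfac \<eta> (\<pi>i - ?z) K)
           * (?H * sfac \<eta> (\<xi> i + \<pi>i + of_int (int (k i) - int K + 1) * \<eta>) (3 * k i))))"
    unfolding e1 e2 e3 e4 e5 unfolding x[OF i] theta_exp ell_facts_def list.map prod_list.Cons prod_list.Nil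
      ell_fact_exp[of _ \<eta>, unfolded exp_eta] mult_1_right ..
  also have "\<dots> = (?A / ?B * (?C * ?E / (?F * ?G * ?H)))
      * (\<theta> (node (\<xi> i) (k i) + of_nat K * \<eta>) * sfac \<eta> (\<xi> i) K / \<theta> (\<xi> i)
        * (sfac \<eta> (\<pi>i - \<xi> i) (K - k i) / sfac \<eta> (\<xi> i + \<pi>i + of_int (int (k i) - int K + 1) * \<eta>) (3 * k i))
        / (sfac \<eta> (?z + \<eta>) K * sfac \<eta> (\<pi>i - ?z) K))"
    by (simp only: times_divide_eq_left times_divide_eq_right
        divide_divide_eq_left divide_divide_eq_right mult_ac)
  also have "\<dots> = exp (single_exponent K i) * (Sfac (\<xi> i) (k i) K * sfac (4 * \<eta>) (4 * \<eta>) (k i)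
       / (\<Prod>m<K. D ?z (- of_nat (Suc m) * \<eta>)))"
    unfolding ex gq D Sfac_def using s4 by simp
  finally show ?thesis .
qed

text \<open>The upper end again drops out of the exponent, since it enters the two numerator
  factorials with opposite signs.\<close>

lemma double_facts:
  assumes i: "i \<in> {1..r}" and j: "j \<in> {1..r}"
  shows "ell_facts [q powi (- 4 * int (n j)) * x i / x j, - a\<^sup>2 * x i * x j * q ^ (4 * n j + 1)] (q ^ 4) p (k i)
       / ell_fact (q ^ 4 * x i / x j) (q ^ 4) p (k i)
    = exp (of_nat (k i) * (\<xi> i + \<xi> j - 3 * \<eta> + \<pi>i) / 2 + of_nat (k i) * (of_nat (k i) - 1) * \<eta>)
      * ((\<Prod>m<k i. D (node (\<xi> i) m) (node (\<xi> j) (n j))) / sfac (4 * \<eta>) (\<xi> i - \<xi> j + 4 * \<eta>) (k i))" (is "?lhs = _")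
proof -
  let ?z = "node (\<xi> j) (n j)"
  have q4: "q ^ 4 = exp (4 * \<eta>)" using q_power[of 4] by simp
  have e1: "q powi (- 4 * int (n j)) * x i / x j = exp (\<xi> i - ?z)"
    unfolding x_eq[OF i] x_eq[OF j] q_powi node_def exp_diff exp_add using a by (simp add: exp_minus field_simps)
  have e2: "- a\<^sup>2 * x i * x j * q ^ (4 * n j + 1) = exp (\<xi> i + ?z + (\<eta> + \<pi>i))"
  proof -
    have "- a\<^sup>2 * x i * x j * q ^ (4 * n j + 1) = - ((a * x i) * (a * x j) * q ^ (4 * n j + 1))"
      by (simp add: power2_eq_square mult_ac)
    also have "\<dots> = exp (\<xi> i + ?z + (\<eta> + \<pi>i))"
      unfolding x[OF i] x[OF j] q_power node_def exp_add exp_pii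
      by (simp add: exp_add algebra_simps)
    finally show ?thesis .
  qed
  have e3: "q ^ 4 * x i / x j = exp (\<xi> i - \<xi> j + 4 * \<eta>)"
    unfolding x_eq[OF i] x_eq[OF j] q4 exp_add exp_diff using a by simp
  have D: "sfac (4 * \<eta>) (\<xi> i - ?z) (k i) * sfac (4 * \<eta>) (\<xi> i + ?z + (\<eta> + \<pi>i)) (k i)
     = (\<Prod>m<k i. D (node (\<xi> i) m) ?z)"
    unfolding sfac_def prod.distrib[symmetric] weier_def node_def by (simp add: algebra_simps)
  let ?A = "exp (of_nat (k i) * (\<xi> i - ?z) / 2 + of_nat (k i) * (of_nat (k i) - 1) / 4 * (4 * \<eta>))"
  let ?B = "exp (of_nat (k i) * (\<xi> i + ?z + (\<eta> + \<pi>i)) / 2 + of_nat (k i) * (of_nat (k i) - 1) / 4 * (4 * \<eta>))"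
  let ?C = "exp (of_nat (k i) * (\<xi> i - \<xi> j + 4 * \<eta>) / 2 + of_nat (k i) * (of_nat (k i) - 1) / 4 * (4 * \<eta>))"
  have ex: "?A * ?B / ?C = exp (of_nat (k i) * (\<xi> i + \<xi> j - 3 * \<eta> + \<pi>i) / 2 + of_nat (k i) * (of_nat (k i) - 1) * \<eta>)"
    unfolding exp_add[symmetric] exp_diff[symmetric]
    by (rule arg_cong[of _ _ exp]) (simp add: field_simps)
  have "?lhs
    = (?A * sfac (4 * \<eta>) (\<xi> i - ?z) (k i)) * (?B * sfac (4 * \<eta>) (\<xi> i + ?z + (\<eta> + \<pi>i)) (k i))
      / (?C * sfac (4 * \<eta>) (\<xi> i - \<xi> j + 4 * \<eta>) (k i))"
    unfolding e1 e2 e3 unfolding q4 ell_facts_def list.map prod_list.Cons prod_list.Nil ell_fact_exp mult_1_right ..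
  also have "\<dots> = (?A * ?B / ?C) * ((sfac (4 * \<eta>) (\<xi> i - ?z) (k i) * sfac (4 * \<eta>) (\<xi> i + ?z + (\<eta> + \<pi>i)) (k i))
      / sfac (4 * \<eta>) (\<xi> i - \<xi> j + 4 * \<eta>) (k i))"
    by (simp only: times_divide_eq_left times_divide_eq_right
        divide_divide_eq_left divide_divide_eq_right mult_ac)
  finally show ?thesis unfolding D ex .
qed

text \<open>This accounts for the power q^(|k| - 3 e2(k)) in the theorem: with it, all exponential
  prefactors cancel. The sums over pairs reduce to \<open>L\<close>, \<open>S\<close>,
  \<open>A\<close> and \<open>X\<close>, in terms of which \<open>e2\<close> is
  \<open>(L * L - S) / 2\<close>.\<close>

lemma exponent_sum:
  assumes K: "of_nat K = (\<Sum>i\<in>{1..r}. of_nat (k i) :: complex)"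
  shows "(\<Sum>(i, j)\<in>ordered_pairs {1..r}. 2 * (of_nat (k i) + of_nat (k j)) * \<eta>)
     + (of_nat K - 3 * of_nat (e2 r k)) * \<eta>
     + (of_nat K * (3 * \<pi>i + 3 * \<eta>) / 2 + 3 * of_nat K * (of_nat K - 1) / 2 * \<eta>)
     - (\<Sum>(i, j)\<in>ordered_pairs {1..r}. of_nat (k i + k j) * (\<xi> i + \<xi> j + (\<eta> + \<pi>i)) / 2
          + of_nat (k i + k j) * (of_nat (k i + k j) - 1) * \<eta>)
     + (\<Sum>i\<in>{1..r}. single_exponent K i)
     + (\<Sum>i\<in>{1..r}. \<Sum>j\<in>{1..r}. of_nat (k i) * (\<xi> i + \<xi> j - 3 * \<eta> + \<pi>i) / 2
          + of_nat (k i) * (of_nat (k i) - 1) * \<eta>) = 0"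
proof -
  let ?I = "{1..r}" and ?O = "ordered_pairs {1..r}"
  define \<kappa> where "\<kappa> i = (of_nat (k i) :: complex)" for i
  define S where "S = (\<Sum>i\<in>?I. \<kappa> i * \<kappa> i)"
  define A where "A = (\<Sum>i\<in>?I. \<kappa> i * \<xi> i)"
  define X where "X = (\<Sum>i\<in>?I. \<xi> i)"
  define L where "L = (of_nat K :: complex)"
  have L: "(\<Sum>i\<in>?I. \<kappa> i) = L" unfolding L_def K \<kappa>_def ..
  have s1: "(\<Sum>(i, j)\<in>?O. \<kappa> i + \<kappa> j) = (of_nat r - 1) * L"
    using sum_ordered_pairs_add[of ?I \<kappa>] unfolding L by simp
  have s2: "(\<Sum>(i, j)\<in>?O. \<kappa> i * \<kappa> j + \<kappa> j * \<kappa> i) = L * L - S"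
    using sum_ordered_pairs_mult[of ?I \<kappa> \<kappa>] unfolding L S_def by simp
  have s3: "(\<Sum>(i, j)\<in>?O. \<kappa> i * \<xi> i + \<kappa> j * \<xi> j) = (of_nat r - 1) * A"
    using sum_ordered_pairs_add[of ?I "\<lambda>i. \<kappa> i * \<xi> i"] unfolding A_def by simp
  have s4: "(\<Sum>(i, j)\<in>?O. \<kappa> i * \<xi> j + \<kappa> j * \<xi> i) = L * X - A"
    using sum_ordered_pairs_mult[of ?I \<kappa> \<xi>] unfolding L A_def X_def by simp
  have s5: "(\<Sum>(i, j)\<in>?O. \<kappa> i * \<kappa> i + \<kappa> j * \<kappa> j) = (of_nat r - 1) * S"
    using sum_ordered_pairs_add[of ?I "\<lambda>i. \<kappa> i * \<kappa> i"] unfolding S_def by simp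
  have e: "of_nat (e2 r k) = (L * L - S) / 2"
  proof -
    have "2 * of_nat (e2 r k) = (\<Sum>(i, j)\<in>?O. \<kappa> i * \<kappa> j + \<kappa> j * \<kappa> i)"
      unfolding e2_def index_pairs_eq \<kappa>_def of_nat_sum sum_distrib_left
      by (intro sum.cong) auto
    then show ?thesis unfolding s2 by (simp add: eq_divide_eq mult.commute)
  qed
  have t1: "(\<Sum>(i, j)\<in>?O. 2 * (of_nat (k i) + of_nat (k j)) * \<eta>) = 2 * \<eta> * ((of_nat r - 1) * L)"
    unfolding s1[symmetric] sum_distrib_left \<kappa>_def by (intro sum.cong) auto
  have t2: "(\<Sum>(i, j)\<in>?O. of_nat (k i + k j) * (\<xi> i + \<xi> j + (\<eta> + \<pi>i)) / 2
          + of_nat (k i + k j) * (of_nat (k i + k j) - 1) * \<eta>)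
     = (of_nat r - 1) * A / 2 + (L * X - A) / 2 + (\<eta> + \<pi>i) / 2 * ((of_nat r - 1) * L)
       + \<eta> * ((of_nat r - 1) * S) + \<eta> * (L * L - S) - \<eta> * ((of_nat r - 1) * L)"
    unfolding s1[symmetric] s2[symmetric] s3[symmetric] s4[symmetric] s5[symmetric]
      sum_distrib_left sum_divide_distrib sum.distrib[symmetric] sum_subtractf[symmetric]
    by (intro sum.cong) (auto simp: \<kappa>_def field_simps)
  have t3: "(\<Sum>i\<in>?I. single_exponent K i)
     = (3 / 2 * \<eta> - 2 * \<pi>i + L * \<eta>) * L - 7 / 2 * \<eta> * S - A"
    unfolding L[symmetric, THEN arg_cong[where f = "\<lambda>z. (3 / 2 * \<eta> - 2 * \<pi>i + L * \<eta>) * z"]] S_def A_def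
      sum_distrib_left sum_subtractf[symmetric] single_exponent_def L_def[symmetric] \<kappa>_def
    by (intro sum.cong) (auto simp: field_simps)
  let ?f = "\<lambda>i j. of_nat (k i) * (\<xi> i + \<xi> j - 3 * \<eta> + \<pi>i) / 2 + of_nat (k i) * (of_nat (k i) - 1) * \<eta>"
  let ?g = "\<lambda>i. of_nat r * (\<kappa> i * \<xi> i) / 2 + \<kappa> i * X / 2 + of_nat r * ((\<pi>i - 3 * \<eta>) / 2 * \<kappa> i)
        + of_nat r * \<eta> * (\<kappa> i * \<kappa> i - \<kappa> i)"
  have t4: "(\<Sum>i\<in>?I. \<Sum>j\<in>?I. ?f i j)
     = of_nat r * A / 2 + L * X / 2 + of_nat r * ((\<pi>i - 3 * \<eta>) / 2 * L) + of_nat r * \<eta> * (S - L)"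
  proof -
    have "(\<Sum>j\<in>?I. ?f i j)
      = ?g i" for i
    proof -
      have "(\<Sum>j\<in>?I. ?f i j)
        = (\<Sum>j\<in>?I. \<kappa> i / 2 * \<xi> j + (\<kappa> i * (\<xi> i - 3 * \<eta> + \<pi>i) / 2 + \<kappa> i * (\<kappa> i - 1) * \<eta>))"
        by (intro sum.cong) (auto simp: \<kappa>_def field_simps)
      also have "\<dots> = \<kappa> i / 2 * X + of_nat r * (\<kappa> i * (\<xi> i - 3 * \<eta> + \<pi>i) / 2 + \<kappa> i * (\<kappa> i - 1) * \<eta>)"
        unfolding sum.distrib sum_distrib_left[symmetric] X_def by (simp add: field_simps)
      also have "\<dots> = ?g i"
        by (simp add: field_simps)
      finally show ?thesis .
    qed
    then have "(\<Sum>i\<in>?I. \<Sum>j\<in>?I. ?f i j)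
     = (\<Sum>i\<in>?I. ?g i)" by (intro sum.cong) auto
    then show ?thesis
      unfolding sum.distrib sum_subtractf sum_distrib_left[symmetric] sum_divide_distrib[symmetric]
        sum_distrib_right[symmetric] L A_def[symmetric] S_def[symmetric] .
  qed
  show ?thesis
    unfolding t1 t2 t3 t4 e L_def[symmetric] by (simp add: field_simps)
qed

theorem jackson_term_eq_summand:
  "jackson_term p q r n a x k = summand {1..r} (\<lambda>b. node (\<xi> b) (n b)) \<xi> k"
proof -
  let ?I = "{1..r}" and ?O = "ordered_pairs {1..r}"
  define K where "K = sum k ?I"
  have tK: "tuple_sum r k = K" by (simp add: tuple_sum_def K_def)
  have kK: "k i \<le> K" if "i \<in> ?I" for i unfolding K_def by (rule member_le_sum) (use that in auto)
  define s4 where "s4 i = sfac (4 * \<eta>) (4 * \<eta>) (k i)" for i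
  define sf where "sf i j = sfac (4 * \<eta>) (\<xi> i - \<xi> j + 4 * \<eta>) (k i)" for i j
  define P where "P i j = sfac (4 * \<eta>) (\<xi> i + \<xi> j + (\<eta> + \<pi>i)) (k i + k j)" for i j
  define V where "V i j = \<theta> (node (\<xi> i) (k i) - node (\<xi> j) (k j)) / \<theta> (\<xi> i - \<xi> j)" for i j
  define Dn where "Dn i = (\<Prod>m<K. D (node (\<xi> i) (n i)) (- of_nat (Suc m) * \<eta>))" for i
  define Ch where "Ch i j = (\<Prod>m<k i. D (node (\<xi> i) m) (node (\<xi> j) (n j)))" for i j
  define eA where "eA i j = 2 * (of_nat (k i) + of_nat (k j)) * \<eta>" for i j
  define eD where "eD i j = of_nat (k i + k j) * (\<xi> i + \<xi> j + (\<eta> + \<pi>i)) / 2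
      + of_nat (k i + k j) * (of_nat (k i + k j) - 1) * \<eta>" for i j
  define eG where "eG i j = of_nat (k i) * (\<xi> i + \<xi> j - 3 * \<eta> + \<pi>i) / 2 + of_nat (k i) * (of_nat (k i) - 1) * \<eta>" for i j
  let ?eB = "(of_nat K - 3 * of_nat (e2 r k)) * \<eta>"
  let ?eC = "of_nat K * (3 * \<pi>i + 3 * \<eta>) / 2 + 3 * of_nat K * (of_nat K - 1) / 2 * \<eta>"
  have s4nz: "s4 i \<noteq> 0" for i
  proof -
    have "\<theta> (4 * \<eta> + of_nat m * (4 * \<eta>)) \<noteq> 0" for m
      using br_eta[of "4 + 4 * int m"] by (simp add: algebra_simps)
    then show ?thesis unfolding s4_def sfac_def by simp
  qed
  have 1: "Delta r (\<lambda>i. x i * q ^ (4 * k i)) p / Delta r x p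
      = exp (\<Sum>(i, j)\<in>?O. eA i j) * (\<Prod>(i, j)\<in>?O. V i j)"
    unfolding Delta_ratio eA_def[symmetric] V_def[symmetric]
    by (simp add: exp_sum case_prod_unfold prod.distrib)
  have 2: "q powi (int K - 3 * int (e2 r k)) = exp ?eB"
    unfolding q_powi by simp
  have 4: "(\<Prod>(i, j)\<in>index_pairs r. ell_fact (- a\<^sup>2 * x i * x j * q) (q ^ 4) p (k i + k j))
      = exp (\<Sum>(i, j)\<in>?O. eD i j) * (\<Prod>(i, j)\<in>?O. P i j)"
  proof -
    have "(\<Prod>(i, j)\<in>index_pairs r. ell_fact (- a\<^sup>2 * x i * x j * q) (q ^ 4) p (k i + k j))
      = (\<Prod>(i, j)\<in>?O. exp (eD i j) * P i j)"
      unfolding index_pairs_eq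
    proof (rule prod.cong[OF refl])
      fix ij assume "ij \<in> ?O"
      then obtain i j where ij: "ij = (i, j)" "i \<in> ?I" "j \<in> ?I" by (auto simp: ordered_pairs_def)
      show "(case ij of (i, j) \<Rightarrow> ell_fact (- a\<^sup>2 * x i * x j * q) (q ^ 4) p (k i + k j))
        = (case ij of (i, j) \<Rightarrow> exp (eD i j) * P i j)"
        unfolding ij(1) case_prod_conv pair_fact[OF ij(2,3)] eD_def P_def ..
    qed
    then show ?thesis by (simp add: exp_sum case_prod_unfold prod.distrib)
  qed
  have 5: "(\<Prod>i = 1..r. exp (single_exponent K i) * (Sfac (\<xi> i) (k i) K * s4 i / Dn i))
      = exp (\<Sum>i\<in>?I. single_exponent K i) * (\<Prod>i\<in>?I. Sfac (\<xi> i) (k i) K * s4 i / Dn i)"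
    unfolding exp_sum[OF finite_atLeastAtMost] prod.distrib ..
  have 6: "(\<Prod>i = 1..r. \<Prod>j = 1..r. exp (eG i j) * (Ch i j / sf i j))
     = exp (\<Sum>i\<in>?I. \<Sum>j\<in>?I. eG i j) * ((\<Prod>i\<in>?I. \<Prod>j\<in>?I. Ch i j) / (\<Prod>i\<in>?I. \<Prod>j\<in>?I. sf i j))"
    by (simp add: exp_sum prod.distrib prod_dividef)
  have tot: "exp (\<Sum>(i, j)\<in>?O. eA i j) * exp ?eB * (exp ?eC / exp (\<Sum>(i, j)\<in>?O. eD i j))
      * exp (\<Sum>i\<in>?I. single_exponent K i) * exp (\<Sum>i\<in>?I. \<Sum>j\<in>?I. eG i j) = 1"
  proof -
    have "(\<Sum>(i, j)\<in>?O. eA i j) + ?eB + (?eC - (\<Sum>(i, j)\<in>?O. eD i j)) + (\<Sum>i\<in>?I. single_exponent K i)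
       + (\<Sum>i\<in>?I. \<Sum>j\<in>?I. eG i j) = 0"
      using exponent_sum[of K] unfolding eA_def[symmetric] eD_def[symmetric] eG_def[symmetric]
      by (simp add: K_def add_diff_eq)
    then show ?thesis unfolding exp_add[symmetric] exp_diff[symmetric] by simp
  qed
  \<comment> \<open>The diagonal factors belong to \<open>Sfac\<close>, which is why
    \<open>single_facts\<close> carries a compensating \<open>s4 i\<close>; the off-diagonal ones
    belong to \<open>Efac\<close>.\<close>
  have sf: "(\<Prod>i\<in>?I. \<Prod>j\<in>?I. sf i j) = prod s4 ?I * (\<Prod>(i, j)\<in>?O. sf i j * sf j i)"
    using prod.square_ordered_pairs[of ?I sf] by (simp add: sf_def s4_def)
  have E: "(\<Prod>(i, j)\<in>?O. Efac (\<xi> i) (\<xi> j) (k i) (k j))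
     = (\<Prod>(i, j)\<in>?O. V i j) / ((\<Prod>(i, j)\<in>?O. P i j) * (\<Prod>(i, j)\<in>?O. sf i j * sf j i))"
    unfolding prod.distrib[symmetric] prod_dividef[symmetric] case_prod_unfold
    by (intro prod.cong refl) (simp add: Efac_def V_def P_def sf_def mult.assoc)
  have C: "(\<Prod>i\<in>?I. \<Prod>j\<in>?I. Ch i j) = (\<Prod>b\<in>?I. chain ?I \<xi> k (node (\<xi> b) (n b)))"
    unfolding Ch_def chain_def by (rule prod.swap)
  have "jackson_term p q r n a x k
    = (exp (\<Sum>(i, j)\<in>?O. eA i j) * exp ?eB * (exp ?eC / exp (\<Sum>(i, j)\<in>?O. eD i j))
      * exp (\<Sum>i\<in>?I. single_exponent K i) * exp (\<Sum>i\<in>?I. \<Sum>j\<in>?I. eG i j))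
      * ((\<Prod>(i, j)\<in>?O. V i j) * (Nfac K / (\<Prod>(i, j)\<in>?O. P i j))
        * (\<Prod>i\<in>?I. Sfac (\<xi> i) (k i) K * s4 i / Dn i)
        * ((\<Prod>i\<in>?I. \<Prod>j\<in>?I. Ch i j) / (\<Prod>i\<in>?I. \<Prod>j\<in>?I. sf i j)))"
    unfolding jackson_term_def tK 1 2 numerator_facts 4
    by (simp only: single_facts[OF _ kK, folded s4_def Dn_def] double_facts[folded eG_def Ch_def sf_def]
        cong: prod.cong,
      simp only: 5 6,
      simp only: times_divide_eq_left times_divide_eq_right
        divide_divide_eq_left divide_divide_eq_right mult_ac)
  also have "\<dots> = tau ?I \<xi> k * phi ?I (\<lambda>b. node (\<xi> b) (n b)) \<xi> k"
    unfolding tot tau_def phi_def K_def[symmetric] Dn_def[symmetric] E C sf prod_dividef prod.distrib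
    using s4nz by (simp add: mult_ac)
  finally show ?thesis unfolding summand_def .
qed

end

end

context theta_base
begin

lemma jackson_sum_generic:
  assumes a: "a \<noteq> 0" and x: "\<And>i. i \<in> {1..r} \<Longrightarrow> x i \<noteq> 0"
    and generic: "\<And>i m. i \<in> {1..r} \<Longrightarrow> theta (a * x i * q powi m) p \<noteq> 0"
      "\<And>i m. i \<in> {1..r} \<Longrightarrow> theta (- (a * x i) * q powi m) p \<noteq> 0"
      "\<And>i j m. i \<in> {1..r} \<Longrightarrow> j \<in> {1..r} \<Longrightarrow> theta (- (a * x i) * (a * x j) * q powi m) p \<noteq> 0"
      "\<And>i j m. i \<in> {1..r} \<Longrightarrow> j \<in> {1..r} \<Longrightarrow> i \<noteq> j \<Longrightarrow> theta (x i / x j * q powi m) p \<noteq> 0"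
  shows "(\<Sum>k\<in>multi_range r n. jackson_term p q r n a x k)
    = (\<Prod>i = 1..r. ell_fact (a * x i * q) q p (4 * n i) / ell_fact (- a * x i * q) q p (4 * n i))"
proof -
  define \<xi> where "\<xi> i = Ln (a * x i)" for i
  have ex: "a * x i = exp (\<xi> i)" if "i \<in> {1..r}" for i
    using a x[OF that] by (simp add: \<xi>_def)
  have nz: "\<theta> z \<noteq> 0" if "theta (exp z) p \<noteq> 0" for z
    using that by (simp add: theta_bracket_def)
  have g: "quartic_bracket.generic (\<theta>) \<eta> \<pi>i {1..r} \<xi>"
    unfolding generic_def
  proof (intro ballI allI conjI impI)
    fix i m assume i: "i \<in> {1..r}"
    show "\<theta> (\<xi> i + of_int m * \<eta>) \<noteq> 0"
      using generic(1)[OF i, of m] unfolding ex[OF i] q_powi exp_add[symmetric] by (rule nz)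
    have "exp (\<xi> i + \<pi>i + of_int m * \<eta>) = - exp (\<xi> i) * q powi m"
      unfolding exp_add exp_pii q_powi by simp
    then show "\<theta> (\<xi> i + \<pi>i + of_int m * \<eta>) \<noteq> 0"
      using generic(2)[OF i, of m] unfolding ex[OF i] by (intro nz) simp
    fix j assume j: "j \<in> {1..r}"
    have "exp (\<xi> i + \<xi> j + \<pi>i + of_int m * \<eta>) = - exp (\<xi> i) * exp (\<xi> j) * q powi m"
      unfolding exp_add exp_pii q_powi by simp
    then show "\<theta> (\<xi> i + \<xi> j + \<pi>i + of_int m * \<eta>) \<noteq> 0"
      using generic(3)[OF i j, of m] unfolding ex[OF i] ex[OF j] by (intro nz) simp
    assume ij: "i \<noteq> j"
    have "exp (\<xi> i - \<xi> j + of_int m * \<eta>) = x i / x j * q powi m"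
      unfolding exp_add exp_diff q_powi ex[OF i, symmetric] ex[OF j, symmetric] using a by simp
    then show "\<theta> (\<xi> i - \<xi> j + of_int m * \<eta>) \<noteq> 0"
      using generic(4)[OF i j ij, of m] by (intro nz) simp
  qed
  have "(\<Sum>k\<in>multi_range r n. jackson_term p q r n a x k)
    = (\<Sum>k\<in>PiE {1..r} (\<lambda>i. {..n i}). summand {1..r} (\<lambda>b. node (\<xi> b) (n b)) \<xi> k)"
    unfolding multi_range_def atLeast0AtMost
    by (rule sum.cong[OF refl], rule jackson_term_eq_summand[OF a ex g])
  also have "\<dots> = (\<Prod>i\<in>{1..r}. sfac \<eta> (\<xi> i + \<eta>) (4 * n i) / sfac \<eta> (\<xi> i + \<pi>i + \<eta>) (4 * n i))"
    by (rule bracket_sum[OF _ g]) simp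
  also have "\<dots> = (\<Prod>i = 1..r. ell_fact (a * x i * q) q p (4 * n i) / ell_fact (- a * x i * q) q p (4 * n i))"
  proof (rule prod.cong[OF refl])
    fix i assume i: "i \<in> {1..r}"
    have e: "a * x i * q = exp (\<xi> i + \<eta>)" "- a * x i * q = exp (\<xi> i + \<pi>i + \<eta>)"
      using ex[OF i] unfolding exp_add exp_pii exp_eta by simp_all
    let ?A = "exp (of_nat (4 * n i) * (\<xi> i + \<eta>) / 2 + of_nat (4 * n i) * (of_nat (4 * n i) - 1) / 4 * \<eta>)"
    let ?B = "exp (of_nat (4 * n i) * (\<xi> i + \<pi>i + \<eta>) / 2 + of_nat (4 * n i) * (of_nat (4 * n i) - 1) / 4 * \<eta>)"
    \<comment> \<open>Passing from \<open>a * x i * q\<close> to its negative costs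
      \<open>exp (\<pi>i / 2)\<close> in each of the \<open>4 * n i\<close> theta functions; because
      the length is a multiple of four, the total factor is 1.\<close>
    have "?B = ?A * exp (of_nat (2 * n i) * \<pi>i)"
      unfolding exp_add[symmetric] by (rule arg_cong[of _ _ exp]) (simp add: field_simps)
    also have "exp (of_nat (2 * n i) * \<pi>i) = 1"
      unfolding exp_of_nat_mult exp_pii by simp
    finally have AB: "?B = ?A" by simp
    show "sfac \<eta> (\<xi> i + \<eta>) (4 * n i) / sfac \<eta> (\<xi> i + \<pi>i + \<eta>) (4 * n i)
      = ell_fact (a * x i * q) q p (4 * n i) / ell_fact (- a * x i * q) q p (4 * n i)"
      unfolding e ell_fact_exp[of _ \<eta>, unfolded exp_eta] AB by simp
  qed
  finally show ?thesis .
qed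

end

section \<open>Continuity in the parameters and removal of genericity\<close>

lemma isCont_theta:
  assumes p: "norm p < 1" and f: "isCont f u" "f u \<noteq> 0"
  shows "isCont (\<lambda>u. theta (f u) p) u"
proof -
  have "open (- {0 :: complex})" by auto
  then have "isCont (\<lambda>x. theta x p) (f u)"
    using theta_continuous[OF p] f(2) by (simp add: continuous_on_eq_continuous_at)
  with f(1) show ?thesis by (rule isCont_o2)
qed

lemma isCont_ell_fact:
  assumes "norm p < 1" "isCont f u" "f u \<noteq> 0" "q \<noteq> 0"
  shows "isCont (\<lambda>u. ell_fact (f u) q p k) u"
  unfolding ell_fact_def
  by (intro continuous_prod isCont_theta continuous_mult continuous_const assms) (use assms in simp)

text \<open>The nonvanishing conditions concern only the denominators of the summand at the limit
  point, so continuity is available there even where other brackets vanish.\<close>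

lemma isCont_jackson_term:
  fixes A :: "complex \<Rightarrow> complex" and X :: "complex \<Rightarrow> nat \<Rightarrow> complex"
  assumes p: "norm p < 1" and q: "q \<noteq> 0"
    and A: "isCont A u" "A u \<noteq> 0"
    and X: "\<And>i. isCont (\<lambda>u. X u i) u" "\<And>i. i \<in> {1..r} \<Longrightarrow> X u i \<noteq> 0"
    and nz: "Delta r (X u) p \<noteq> 0" "\<And>i. i \<in> {1..r} \<Longrightarrow> theta (A u * X u i) p \<noteq> 0"
      "\<And>i j. (i, j) \<in> index_pairs r \<Longrightarrow> ell_fact (- (A u)\<^sup>2 * X u i * X u j * q) (q ^ 4) p (k i + k j) \<noteq> 0"
      "\<And>i. i \<in> {1..r} \<Longrightarrow>
          ell_facts [A u * X u i * q ^ (4 * n i + 1), - (q powi (- 4 * int (n i))) / (A u * X u i)]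
            q p (tuple_sum r k) \<noteq> 0"
      "\<And>i. i \<in> {1..r} \<Longrightarrow>
          ell_fact (- (q powi (int (k i) - int (tuple_sum r k) + 1)) * A u * X u i) q p (3 * k i) \<noteq> 0"
      "\<And>i j. i \<in> {1..r} \<Longrightarrow> j \<in> {1..r} \<Longrightarrow> ell_fact (q ^ 4 * X u i / X u j) (q ^ 4) p (k i) \<noteq> 0"
  shows "isCont (\<lambda>u. jackson_term p q r n (A u) (X u) k) u"
proof -
  have q4: "q ^ 4 \<noteq> 0" and qi: "q powi m \<noteq> 0" for m using q by simp_all
  have ip: "i \<in> {1..r}" "j \<in> {1..r}" if "(i, j) \<in> index_pairs r" for i j
    using that by (auto simp: index_pairs_def)
  have fip: "finite (index_pairs r)" by (simp add: index_pairs_eq)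
  note [continuous_intros] = isCont_theta[OF p] isCont_ell_fact[OF p] A(1) X(1)
  have Delta: "isCont (\<lambda>u. Delta r (\<lambda>i. X u i * q ^ (4 * f i)) p) u" for f
    unfolding Delta_def case_prod_unfold
    by (intro continuous_intros isCont_divide) (use X(2) ip q in auto)
  have 1: "isCont (\<lambda>u. Delta r (\<lambda>i. X u i * q ^ (4 * k i)) p / Delta r (X u) p) u"
    using Delta[of k] Delta[of "\<lambda>_. 0"] nz(1) by (intro isCont_divide) simp_all
  have 2: "isCont (\<lambda>u. \<Prod>(i, j)\<in>index_pairs r. ell_fact (- (A u)\<^sup>2 * X u i * X u j * q) (q ^ 4) p (k i + k j)) u"
    unfolding case_prod_unfold
    by (intro continuous_intros) (use X(2) ip q A(2) in auto)
  have 2: "isCont (\<lambda>u. ell_facts [- 1, - q, - (q\<^sup>2)] (q\<^sup>2) p (tuple_sum r k)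
      / (\<Prod>(i, j)\<in>index_pairs r. ell_fact (- (A u)\<^sup>2 * X u i * X u j * q) (q ^ 4) p (k i + k j))) u"
    by (rule isCont_divide[OF continuous_const 2]) (use nz(3) fip in auto)
  have 3: "isCont (\<lambda>u. theta (A u * X u i * q ^ (tuple_sum r k + 4 * k i)) p / theta (A u * X u i) p
             * (ell_fact (A u * X u i) q p (tuple_sum r k)
                * ell_fact (- 1 / (A u * X u i)) q p (tuple_sum r k - k i)
                / (ell_facts [A u * X u i * q ^ (4 * n i + 1),
                              - (q powi (- 4 * int (n i))) / (A u * X u i)] q p (tuple_sum r k)
                   * ell_fact (- (q powi (int (k i) - int (tuple_sum r k) + 1)) * A u * X u i)
                       q p (3 * k i)))) u" if i: "i \<in> {1..r}" for i
  proof -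
    have "isCont (\<lambda>u. ell_facts [A u * X u i * q ^ (4 * n i + 1),
        - (q powi (- 4 * int (n i))) / (A u * X u i)] q p (tuple_sum r k)) u"
      unfolding ell_facts_def list.map prod_list.Cons prod_list.Nil
      by (intro continuous_intros isCont_divide) (use X(2)[OF i] A(2) q in auto)
    then show ?thesis
      by (intro continuous_mult isCont_divide continuous_intros)
         (use X(2)[OF i] A(2) q nz(2,4,5)[OF i] in auto)
  qed
  have 4: "isCont (\<lambda>u. ell_facts [q powi (- 4 * int (n j)) * X u i / X u j,
                        - (A u)\<^sup>2 * X u i * X u j * q ^ (4 * n j + 1)] (q ^ 4) p (k i)
             / ell_fact (q ^ 4 * X u i / X u j) (q ^ 4) p (k i)) u"
    if ij: "i \<in> {1..r}" "j \<in> {1..r}" for i j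
    unfolding ell_facts_def list.map prod_list.Cons prod_list.Nil
    by (intro continuous_mult isCont_divide continuous_intros)
       (use X(2)[OF ij(1)] X(2)[OF ij(2)] A(2) q nz(6)[OF ij] in auto)
  show ?thesis
    unfolding jackson_term_def
    by (intro continuous_mult continuous_prod continuous_const 1 2 3 4; assumption)
qed

text \<open>The hypotheses of the theorem exclude only vanishing denominators, whereas the telescoping needs
  all brackets to be nonzero. Replacing \<open>a\<close> by \<open>a u\<close> and \<open>x i\<close> by \<open>x i u\<^sup>i\<close> makes every bracket nonzero
  for all but countably many real \<open>u > 0\<close>.\<close>

lemma countable_theta_zeros_power:
  assumes p: "norm p < 1" and c: "c \<noteq> 0" and d: "d \<noteq> 0"
  shows "countable {u::real. 0 < u \<and> theta (c * of_real u powi d) p = 0}"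
proof -
  let ?f = "\<lambda>u::real. c * of_real u powi d"
  let ?B = "{u::real. 0 < u \<and> theta (?f u) p = 0}"
  have "?f ` ?B \<subseteq> insert 1 (range (\<lambda>m::int. p powi m))"
  proof
    fix z assume "z \<in> ?f ` ?B"
    then obtain u where u: "0 < u" "theta z p = 0" "z = ?f u" by auto
    then have "z \<noteq> 0" using c by simp
    then show "z \<in> insert 1 (range (\<lambda>m::int. p powi m))"
      using u(2) by (auto simp: theta_eq_0[OF p] split: if_splits)
  qed
  moreover have "countable (insert 1 (range (\<lambda>m::int. p powi m)))" by simp
  ultimately have "countable (?f ` ?B)" by (rule countable_subset)
  \<comment> \<open>On positive reals a nonzero power is injective, so the countably many zeros of
    theta have countably many preimages.\<close>
  moreover have "inj_on ?f ?B"
  proof (rule inj_onI)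
    fix u v :: real assume uv: "u \<in> ?B" "v \<in> ?B" "?f u = ?f v"
    then have "of_real (u powi d) = (of_real (v powi d) :: complex)" using c by simp
    then have e: "u powi d = v powi d" by (simp only: of_real_eq_iff)
    show "u = v"
    proof (cases "0 \<le> d")
      case True
      then show ?thesis using e uv d power_eq_iff_eq_base[of "nat d" u v] by (simp add: power_int_def)
    next
      case False
      then show ?thesis using e uv d power_eq_iff_eq_base[of "nat (- d)" u v]
        by (simp add: power_int_def power_inverse)
    qed
  qed
  ultimately show ?thesis by (rule countable_image_inj_on)
qed

theorem theorem4p13:
  fixes p q a :: complex and r :: nat and n :: "nat \<Rightarrow> nat" and x :: "nat \<Rightarrow> complex"
  assumes p: "norm p < 1"
    and q: "q \<noteq> 0"
    and q_powers: "\<And>k::nat. k > 0 \<Longrightarrow>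
          (if p = 0 then q ^ k \<noteq> 1 else \<forall>m::int. q ^ k \<noteq> p powi m)"
    and r: "r \<ge> 1"
    and a: "a \<noteq> 0"
    and x: "\<And>i. i \<in> {1..r} \<Longrightarrow> x i \<noteq> 0"
    and generic_Delta: "Delta r x p \<noteq> 0"
    and generic_theta: "\<And>i. i \<in> {1..r} \<Longrightarrow> theta (a * x i) p \<noteq> 0"
    and generic_pairs: "\<And>k i j. k \<in> multi_range r n \<Longrightarrow> (i, j) \<in> index_pairs r \<Longrightarrow>
          ell_fact (- a\<^sup>2 * x i * x j * q) (q ^ 4) p (k i + k j) \<noteq> 0"
    and generic_single: "\<And>k i. k \<in> multi_range r n \<Longrightarrow> i \<in> {1..r} \<Longrightarrow>
          ell_facts [a * x i * q ^ (4 * n i + 1), - (q powi (- 4 * int (n i))) / (a * x i)]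
            q p (tuple_sum r k) \<noteq> 0"
    and generic_3k: "\<And>k i. k \<in> multi_range r n \<Longrightarrow> i \<in> {1..r} \<Longrightarrow>
          ell_fact (- (q powi (int (k i) - int (tuple_sum r k) + 1)) * a * x i) q p (3 * k i) \<noteq> 0"
    and generic_double: "\<And>k i j. k \<in> multi_range r n \<Longrightarrow> i \<in> {1..r} \<Longrightarrow> j \<in> {1..r} \<Longrightarrow>
          ell_fact (q ^ 4 * x i / x j) (q ^ 4) p (k i) \<noteq> 0"
    and generic_rhs: "\<And>i. i \<in> {1..r} \<Longrightarrow> ell_fact (- a * x i * q) q p (4 * n i) \<noteq> 0"
  shows
    "(\<Sum>k\<in>multi_range r n.
        Delta r (\<lambda>i. x i * q ^ (4 * k i)) p / Delta r x p
        * q powi (int (tuple_sum r k) - 3 * int (e2 r k))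
        * (ell_facts [- 1, - q, - (q\<^sup>2)] (q\<^sup>2) p (tuple_sum r k)
           / (\<Prod>(i, j)\<in>index_pairs r.
                ell_fact (- a\<^sup>2 * x i * x j * q) (q ^ 4) p (k i + k j)))
        * (\<Prod>i = 1..r.
             theta (a * x i * q ^ (tuple_sum r k + 4 * k i)) p / theta (a * x i) p
             * (ell_fact (a * x i) q p (tuple_sum r k)
                * ell_fact (- 1 / (a * x i)) q p (tuple_sum r k - k i)
                / (ell_facts [a * x i * q ^ (4 * n i + 1),
                              - (q powi (- 4 * int (n i))) / (a * x i)] q p (tuple_sum r k)
                   * ell_fact (- (q powi (int (k i) - int (tuple_sum r k) + 1)) * a * x i)
                       q p (3 * k i))))
        * (\<Prod>i = 1..r. \<Prod>j = 1..r.
             ell_facts [q powi (- 4 * int (n j)) * x i / x j,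
                        - a\<^sup>2 * x i * x j * q ^ (4 * n j + 1)] (q ^ 4) p (k i)
             / ell_fact (q ^ 4 * x i / x j) (q ^ 4) p (k i)))
     = (\<Prod>i = 1..r. ell_fact (a * x i * q) q p (4 * n i) / ell_fact (- a * x i * q) q p (4 * n i))"
proof -
  define A where "A u = a * u" for u :: complex
  define X where "X u i = x i * u ^ i" for u :: complex and i :: nat
  define lhs where "lhs u = (\<Sum>k\<in>multi_range r n. jackson_term p q r n (A u) (X u) k)" for u
  define rhs where "rhs u = (\<Prod>i = 1..r. ell_fact (A u * X u i * q) q p (4 * n i)
      / ell_fact (- A u * X u i * q) q p (4 * n i))" for u
  have at1: "A 1 = a" "X 1 = x" by (auto simp: A_def X_def)
  have contA: "isCont A 1" and contX: "isCont (\<lambda>u. X u i) 1" for i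
    unfolding A_def X_def by (intro continuous_intros)+
  have cont_lhs: "isCont lhs 1"
    unfolding lhs_def
  proof (rule continuous_sum)
    fix k assume k: "k \<in> multi_range r n"
    show "isCont (\<lambda>u. jackson_term p q r n (A u) (X u) k) 1"
      by (rule isCont_jackson_term[OF p q contA _ contX]; unfold at1)
         (use a x generic_Delta generic_theta generic_pairs[OF k] generic_single[OF k]
            generic_3k[OF k] generic_double[OF k] in auto)
  qed
  have cont_rhs: "isCont rhs 1"
    unfolding rhs_def
    by (intro continuous_prod isCont_divide isCont_ell_fact[OF p] continuous_intros contA contX; (unfold at1)?)
       (use a x q generic_rhs in auto)

  define I where "I = {1..r}"
  define Z where "Z c d = {u::real. 0 < u \<and> theta (c * of_real u powi d) p = 0}" for c :: complex and d :: int
  \<comment> \<open>Along the curve \<open>a * x i\<close> scales with exponent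
    \<open>i + 1\<close>, a product of two such numbers with \<open>i + j + 2\<close>, and a ratio
    of two parameters with \<open>i - j\<close>. None of these exponents is zero, so each bracket
    vanishes for only countably many \<open>u\<close>.\<close>
  define bad1 where "bad1 = (\<Union>i\<in>I. \<Union>m::int. Z (a * x i * q powi m) (int i + 1))"
  define bad2 where "bad2 = (\<Union>i\<in>I. \<Union>m::int. Z (- (a * x i) * q powi m) (int i + 1))"
  define bad3 where "bad3 = (\<Union>i\<in>I. \<Union>j\<in>I. \<Union>m::int. Z (- (a * x i) * (a * x j) * q powi m) (int i + int j + 2))"
  define bad4 where "bad4 = (\<Union>i\<in>I. \<Union>j\<in>I - {i}. \<Union>m::int. Z (x i / x j * q powi m) (int i - int j))"
  define bad where "bad = bad1 \<union> bad2 \<union> bad3 \<union> bad4"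
  have cZ: "countable (Z c d)" if "c \<noteq> 0" "d \<noteq> 0" for c d
    unfolding Z_def by (rule countable_theta_zeros_power[OF p that])
  have "countable bad"
    unfolding bad_def bad1_def bad2_def bad3_def bad4_def using a x q
    by (intro countable_Un countable_UN cZ) (auto simp: I_def intro: countable_finite)
  \<comment> \<open>A real interval is uncountable, so good values of \<open>u\<close> exist
    arbitrarily close to 1, where the curve passes through the given parameters.\<close>
  have "\<exists>u. 1 < u \<and> u < 1 + 1 / real (Suc N) \<and> u \<notin> bad" for N
  proof -
    have "uncountable {1<..<1 + 1 / real (Suc N)}" by (simp add: uncountable_open_interval)
    then have "\<not> {1<..<1 + 1 / real (Suc N)} \<subseteq> bad"
      using \<open>countable bad\<close> countable_subset by blast
    then show ?thesis by auto
  qed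
  then obtain u where u: "\<And>N. 1 < u N" "\<And>N. u N < 1 + 1 / real (Suc N)" "\<And>N. u N \<notin> bad"
    by metis
  have "(\<lambda>N. 1 + 1 / real (Suc N)) \<longlonglongrightarrow> 1"
    using tendsto_add[OF tendsto_const LIMSEQ_Suc[OF lim_1_over_n], of "1::real"] by simp
  then have "u \<longlonglongrightarrow> 1"
    by (rule tendsto_sandwich[OF _ _ tendsto_const, rotated 2])
       (use less_imp_le[OF u(1)] less_imp_le[OF u(2)] in \<open>auto intro!: always_eventually\<close>)
  then have lim: "(\<lambda>N. complex_of_real (u N)) \<longlonglongrightarrow> 1"
    using tendsto_of_real[of u 1 sequentially] by simp
  interpret theta_base p q "Ln q"
    by unfold_locales (use p q q_powers in auto)
  have "lhs (of_real (u N)) = rhs (of_real (u N))" for N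
    unfolding lhs_def rhs_def
  proof (rule jackson_sum_generic)
    define w where "w = complex_of_real (u N)"
    have pos: "0 < u N" using u(1)[of N] by linarith
    then have w: "w \<noteq> 0" by (simp add: w_def)
    have good: "theta (c * w powi d) p \<noteq> 0" if "u N \<notin> Z c d" for c d
      using that pos unfolding Z_def w_def by simp
    have AX: "A w * X w i = a * x i * w powi (int i + 1)" for i
      using w by (simp add: A_def X_def power_int_add)
    show "A (of_real (u N)) \<noteq> 0" using a w by (simp add: A_def w_def)
    show "X (of_real (u N)) i \<noteq> 0" if "i \<in> {1..r}" for i
      using x[OF that] w by (simp add: X_def w_def)
    fix i m assume i: "i \<in> {1..r}"
    then have i': "i \<in> I" by (simp add: I_def)
    have "u N \<notin> bad1" "u N \<notin> bad2" "u N \<notin> bad3" "u N \<notin> bad4"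
      using u(3)[of N] by (simp_all add: bad_def)
    note u_bad = this[unfolded bad1_def bad2_def bad3_def bad4_def UN_iff, simplified bex_simps]
    have "u N \<notin> Z (a * x i * q powi m) (int i + 1)" "u N \<notin> Z (- (a * x i) * q powi m) (int i + 1)"
      using u_bad(1,2) i' by (simp_all del: mult_minus_left)
    from this[THEN good] show "theta (A (of_real (u N)) * X (of_real (u N)) i * q powi m) p \<noteq> 0"
      "theta (- (A (of_real (u N)) * X (of_real (u N)) i) * q powi m) p \<noteq> 0"
      unfolding w_def[symmetric] AX by (simp_all add: mult_ac)
    fix j assume j: "j \<in> {1..r}"
    then have j': "j \<in> I" by (simp add: I_def)
    have z: "u N \<notin> Z (- (a * x i) * (a * x j) * q powi m) (int i + int j + 2)"
      using u_bad(3) i' j' by (simp del: mult_minus_left)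
    have "w powi (int i + int j + 2) = w powi (int i + 1) * w powi (int j + 1)"
      using w by (simp flip: power_int_add) (simp add: algebra_simps)
    then show "theta (- (A (of_real (u N)) * X (of_real (u N)) i)
        * (A (of_real (u N)) * X (of_real (u N)) j) * q powi m) p \<noteq> 0"
      using good[OF z] unfolding w_def[symmetric] AX by (simp add: mult_ac)
    assume ij: "i \<noteq> j"
    have z': "u N \<notin> Z (x i / x j * q powi m) (int i - int j)"
      using u_bad(4) i' j' ij by simp
    have "X w i / X w j = x i / x j * w powi (int i - int j)"
      using w by (simp add: X_def power_int_diff)
    then show "theta (X (of_real (u N)) i / X (of_real (u N)) j * q powi m) p \<noteq> 0"
      using good[OF z'] unfolding w_def[symmetric] by (simp add: mult_ac)
  qed
  moreover have "(\<lambda>N. lhs (of_real (u N))) \<longlonglongrightarrow> lhs 1" "(\<lambda>N. rhs (of_real (u N))) \<longlonglongrightarrow> rhs 1"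
    using cont_lhs cont_rhs lim by (auto intro: isCont_tendsto_compose)
  ultimately have "lhs 1 = rhs 1" by (simp add: LIMSEQ_unique)
  then show ?thesis
    unfolding lhs_def rhs_def at1 jackson_term_def .
qed

end
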